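(* Let $d\in\mathbb{N}$, $s_0\in(0,1)$, $1<p\le q$ and $c>0$. There exists a constant $C>0$ depending only on $d,s_0,p,q$ and $c$ such that the following holds. Let $s\in[s_0,1)$, let $\Omega\subset\mathbb{R}^d$ be open, and let $f:[0,\infty)\to[0,\infty)$ be convex, strictly increasing and differentiable with $f(0)=0$, $f(1)=1$ and $$p f(t)\le t f'(t)\le q f(t)\quad\text{for all } t\ge 0 .$$ If $u\in G(\Omega;q,c,s,f)$ is nonnegative in a ball $B_R(x_0)\subset\Omega$, then $$\sup_{B_{R/2}(x_0)}u\le C\left(\inf_{B_{R/2}(x_0)}u+\mathrm{Tail}_{f'}(u_-;x_0,R)\right).$$
   Context: $a_\pm=\max\{\pm a,0\}$; $\sup$ and $\inf$ of measurable functions are essential. Generalized inverse: $(f')^{-1}(y)=\inf\{t\ge0: f'(t)\ge y\}$ for $y\ge 0$. Tail: $$\mathrm{Tail}_{f'}(u;x_0,R)=R^s (f')^{-1}\left((1-s)R^s\int_{\mathbb{R}^d\setminus B_R(x_0)}f'\left(\frac{|u(y)|}{|y-x_0|^s}\right)\frac{dy}{|y-x_0|^{d+s}}\right).$$ Modulars: $\Phi_{L^f(\Omega)}(u)=\int_\Omega f(|u(x)|)\,dx$, $\Phi_{W^{s,f}(\Omega)}(u)=(1-s)\int_\Omega\int_\Omega f\left(\frac{|u(x)-u(y)|}{|x-y|^s}\right)\frac{dy\,dx}{|x-y|^d}$, $\Phi_{V^{s,f}(\Omega|\mathbb{R}^d)}(u)=(1-s)\iint_{(\Omega^c\times\Omega^c)^c}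 f\left(\frac{|u(x)-u(y)|}{|x-y|^s}\right)\frac{dy\,dx}{|x-y|^d}$. The space $V^{s,f}(\Omega|\mathbb{R}^d)$ consists of the measurable $u:\mathbb{R}^d\to\mathbb{R}$ with $\Phi_{L^f(\Omega)}(u)<\infty$ and $\Phi_{V^{s,f}(\Omega|\mathbb{R}^d)}(u)<\infty$. De Giorgi classes: $u\in G_+(\Omega;q,c,s,f)$ if $u\in V^{s,f}(\Omega|\mathbb{R}^d)$ and for every $x_0\in\Omega$, $0<r<R\le \mathrm{dist}(x_0,\partial\Omega)$ and $k\in\mathbb{R}$, with $w_\pm(x)=(u(x)-k)_\pm$ and $A_k^-=\{y\in\mathbb{R}^d:u(y)<k\}$, $$\Phi_{W^{s,f}(B_r(x_0))}(w_+)+(1-s)\int_{B_r(x_0)}\int_{A_k^-}f'\left(\frac{w_-(y)}{|x-y|^s}\right)\frac{w_+(x)}{|x-y|^s}\frac{dy\,dx}{|x-y|^d}$$ $$\le c\left(\frac{R}{R-r}\right)^q\Phi_{L^f(B_R(x_0))}\left(\frac{w_+}{R^s}\right)+c\left(\frac{R}{R-r}\right)^{d+sq}\|w_+\|_{L^1(B_R(x_0))}(1-s)\int_{\mathbb{R}^d\setminus B_r(x_0)}f'\left(\frac{w_+(y)}{|y-x_0|^s}\right)\frac{dy}{|y-x_0|^{d+s}}.$$ $u\in G_-(\Omega;q,c,s,f)$ if $u\in V^{s,f}(\Omega|\mathbb{R}^d)$ and the same inequality holds with $w_+,w_-,A_k^-$ replaced by $w_-,w_+,A_k^+=\{y\in\mathbb{R}^d:u(y)>k\}$,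 respectively. $G(\Omega;q,c,s,f)=G_+(\Omega;q,c,s,f)\cap G_-(\Omega;q,c,s,f)$. *)

theory Defs
  imports "HOL-Analysis.Analysis" "HOL-Probability.Essential_Supremum"
begin

text \<open>
  A function \<open>f : [0,\<infinity>) \<rightarrow> [0,\<infinity>)\<close> is represented by a \<open>real \<Rightarrow> real\<close> function of which only the
  values on \<open>{0..}\<close> are ever used; its derivative is accordingly taken relative to \<open>{0..}\<close>, i.e.
  it is one-sided at \<open>0\<close>.  Integrals of nonnegative functions are \<open>ennreal\<close>-valued, with respect
  to Lebesgue measure on the completed sigma-algebra, so infinite values are allowed.  On the
  diagonal \<open>x = y\<close> (a null set) the quotients below have the value \<open>0\<close>.
\<close>

definition deriv_Ici :: "(real \<Rightarrow> real) \<Rightarrow> real \<Rightarrow> real" where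
  "deriv_Ici f t = vector_derivative f (at t within {0..})"

text \<open>The value at \<open>y = \<infinity>\<close> is \<open>Inf {} = \<infinity>\<close>.\<close>

definition gen_inverse :: "(real \<Rightarrow> real) \<Rightarrow> ennreal \<Rightarrow> ennreal" where
  "gen_inverse g y = (INF t\<in>{t. 0 \<le> t \<and> y \<le> ennreal (g t)}. ennreal t)"

definition Tail ::
  "(real \<Rightarrow> real) \<Rightarrow> real \<Rightarrow> ('a::euclidean_space \<Rightarrow> real) \<Rightarrow> 'a \<Rightarrow> real \<Rightarrow> ennreal" where
  "Tail g s u x0 R =
     ennreal (R powr s) *
     gen_inverse g
       (ennreal ((1 - s) * R powr s) *
        (\<integral>\<^sup>+y\<in>- ball x0 R.
           ennreal (g (\<bar>u y\<bar> / norm (y - x0) powr s) / norm (y - x0) powr (real DIM('a) + s))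
         \<partial>lebesgue))"

definition modular_L ::
  "(real \<Rightarrow> real) \<Rightarrow> 'a::euclidean_space set \<Rightarrow> ('a \<Rightarrow> real) \<Rightarrow> ennreal" where
  "modular_L f \<Omega> u = (\<integral>\<^sup>+x\<in>\<Omega>. ennreal (f \<bar>u x\<bar>) \<partial>lebesgue)"

definition modular_W ::
  "real \<Rightarrow> (real \<Rightarrow> real) \<Rightarrow> 'a::euclidean_space set \<Rightarrow> ('a \<Rightarrow> real) \<Rightarrow> ennreal" where
  "modular_W s f \<Omega> u =
     ennreal (1 - s) *
     (\<integral>\<^sup>+x\<in>\<Omega>. (\<integral>\<^sup>+y\<in>\<Omega>.
        ennreal (f (\<bar>u x - u y\<bar> / norm (x - y) powr s) / norm (x - y) ^ DIM('a))
      \<partial>lebesgue) \<partial>lebesgue)"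

definition modular_V ::
  "real \<Rightarrow> (real \<Rightarrow> real) \<Rightarrow> 'a::euclidean_space set \<Rightarrow> ('a \<Rightarrow> real) \<Rightarrow> ennreal" where
  "modular_V s f \<Omega> u =
     ennreal (1 - s) *
     set_nn_integral (lebesgue \<Otimes>\<^sub>M lebesgue) (- ((- \<Omega>) \<times> (- \<Omega>)))
       (\<lambda>(x, y). ennreal (f (\<bar>u x - u y\<bar> / norm (x - y) powr s) / norm (x - y) ^ DIM('a)))"

definition V_space ::
  "real \<Rightarrow> (real \<Rightarrow> real) \<Rightarrow> 'a::euclidean_space set \<Rightarrow> ('a \<Rightarrow> real) set" where
  "V_space s f \<Omega> =
     {u. u \<in> borel_measurable lebesgue \<and> modular_L f \<Omega> u < \<infinity> \<and> modular_V s f \<Omega> u < \<infinity>}"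

text \<open>
  Extended-real valued, so that the distance to the empty boundary (\<open>\<Omega> = UNIV\<close>) is \<open>\<infinity>\<close>,
  whereas \<open>infdist x {} = 0\<close>.
\<close>

definition boundary_dist :: "'a::euclidean_space \<Rightarrow> 'a set \<Rightarrow> ereal" where
  "boundary_dist x \<Omega> = (INF y\<in>frontier \<Omega>. ereal (dist x y))"

text \<open>
  The Caccioppoli-type inequality at a fixed centre, pair of radii and level: \<open>v\<close> and \<open>w\<close> are the
  truncation under consideration and the opposite one, \<open>A\<close> is the level set carrying \<open>w\<close>.
\<close>

definition caccioppoli ::
  "real \<Rightarrow> real \<Rightarrow> real \<Rightarrow> (real \<Rightarrow> real) \<Rightarrow> 'a::euclidean_space \<Rightarrow> real \<Rightarrow> real \<Rightarrow>
    ('a \<Rightarrow> real) \<Rightarrow> ('a \<Rightarrow> real) \<Rightarrow> 'a set \<Rightarrow> bool" where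
  "caccioppoli q c s f x0 r R v w A \<longleftrightarrow>
     modular_W s f (ball x0 r) v
     + ennreal (1 - s) *
       (\<integral>\<^sup>+x\<in>ball x0 r. (\<integral>\<^sup>+y\<in>A.
          ennreal (deriv_Ici f (w y / norm (x - y) powr s) * (v x / norm (x - y) powr s)
                   / norm (x - y) ^ DIM('a))
        \<partial>lebesgue) \<partial>lebesgue)
     \<le> ennreal (c * (R / (R - r)) powr q) * modular_L f (ball x0 R) (\<lambda>x. v x / R powr s)
       + ennreal (c * (R / (R - r)) powr (real DIM('a) + s * q)) *
         (\<integral>\<^sup>+x\<in>ball x0 R. ennreal \<bar>v x\<bar> \<partial>lebesgue) *
         (ennreal (1 - s) *
          (\<integral>\<^sup>+y\<in>- ball x0 r.
             ennreal (deriv_Ici f (v y / norm (y - x0) powr s) / norm (y - x0) powr (real DIM('a) + s))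
           \<partial>lebesgue))"

definition G_plus ::
  "'a::euclidean_space set \<Rightarrow> real \<Rightarrow> real \<Rightarrow> real \<Rightarrow> (real \<Rightarrow> real) \<Rightarrow> ('a \<Rightarrow> real) set" where
  "G_plus \<Omega> q c s f =
     {u \<in> V_space s f \<Omega>.
        \<forall>x0\<in>\<Omega>. \<forall>r R k. 0 < r \<and> r < R \<and> ereal R \<le> boundary_dist x0 \<Omega> \<longrightarrow>
          caccioppoli q c s f x0 r R
            (\<lambda>x. max (u x - k) 0) (\<lambda>x. max (- (u x - k)) 0) {y. u y < k}}"

definition G_minus ::
  "'a::euclidean_space set \<Rightarrow> real \<Rightarrow> real \<Rightarrow> real \<Rightarrow> (real \<Rightarrow> real) \<Rightarrow> ('a \<Rightarrow> real) set" where
  "G_minus \<Omega> q c s f =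
     {u \<in> V_space s f \<Omega>.
        \<forall>x0\<in>\<Omega>. \<forall>r R k. 0 < r \<and> r < R \<and> ereal R \<le> boundary_dist x0 \<Omega> \<longrightarrow>
          caccioppoli q c s f x0 r R
            (\<lambda>x. max (- (u x - k)) 0) (\<lambda>x. max (u x - k) 0) {y. u y > k}}"

definition De_Giorgi_class ::
  "'a::euclidean_space set \<Rightarrow> real \<Rightarrow> real \<Rightarrow> real \<Rightarrow> (real \<Rightarrow> real) \<Rightarrow> ('a \<Rightarrow> real) set" where
  "De_Giorgi_class \<Omega> q c s f = G_plus \<Omega> q c s f \<inter> G_minus \<Omega> q c s f"

definition ess_sup_on :: "'a::euclidean_space set \<Rightarrow> ('a \<Rightarrow> real) \<Rightarrow> ereal" where
  "ess_sup_on S u = esssup (restrict_space lebesgue S) (\<lambda>x. ereal (u x))"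

definition ess_inf_on :: "'a::euclidean_space set \<Rightarrow> ('a \<Rightarrow> real) \<Rightarrow> ereal" where
  "ess_inf_on S u = - ess_sup_on S (\<lambda>x. - u x)"

end

theory Submission
  imports Defs
begin

text \<open>
  Write \<open>\<omega>(T)\<close> for the integral of \<open>|W x - W y|\<close> over the pairs in a ball at distance less than \<open>T\<close>.  Passing
  through midpoints gives \<open>\<omega>(2 T) \<le> 2 powr (d + 1) * \<omega>(T)\<close>, and summing over dyadic scales bounds \<open>\<omega>(T)\<close> by
  \<open>1 - s\<close> times a fractional seminorm of order one in the integrability exponent.  This one inequality, uniform as
  \<open>s \<rightarrow> 1\<close>, serves both as Sobolev inequality in the De Giorgi iteration (for \<open>f((u - k)\<^sub>+)\<close>) and as Poincare
  inequality for truncations of \<open>u\<close> between two levels.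

  In the latter case pairs with a large difference quotient are absorbed by the energy because \<open>p > 1\<close>, and far
  apart pairs jumping across both levels are controlled by the second term of the Caccioppoli inequality.  Hence
  each of many successive intermediate level sets has measure bounded below unless the lowest sublevel set is
  small; with the De Giorgi iteration this gives expansion of positivity, with a power law under iteration.

  The Harnack inequality follows without a covering argument: at a point \<open>x\<close> where \<open>u\<close> times a power of the distance
  to the boundary of a larger ball is almost maximal, \<open>u\<close> is comparable to its maximum \<open>M\<close> over a ball of radius
  comparable to that distance.  There the tail of \<open>u\<close> is bounded through the second Caccioppoli term at level \<open>2 M\<close>, so by
  the De Giorgi iteration \<open>{u \<ge> M / 2}\<close> has positive density, and positivity spreads from there with the matching power.
\<close>

text \<open>For a general \<open>f\<close> there is no norm to rescale, so every estimate concerns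
  modulars, and the Sobolev inequality is applied with exponent one to the composition
  \<open>f (w / R powr s)\<close>. In place of a superlinear recursion the iteration has a free
  scale \<open>T\<close>: a function whose support has measure of order \<open>T ^ d\<close> gains
  the factor \<open>(T / R) powr s0\<^sup>2\<close>, and \<open>T\<close> is prescribed to decrease
  geometrically.

  Only the tail of the negative part is given. It enters through a number \<open>L\<close> exceeding
  it: while the levels considered dominate a fixed multiple of \<open>L\<close> the tail is
  absorbed, and once they do not, the supremum is already bounded by a multiple of \<open>L\<close>.

  Circular constants are avoided in the last part because the rate \<open>\<eta>\<close> at which
  positivity spreads is fixed for the density of a small ball in a larger one, before the behaviour
  near the maximum is examined. It determines the exponent \<open>\<beta>\<close> of the weight. The
  density of the set where \<open>u\<close> is comparable to its maximum depends on
  \<open>\<beta>\<close>, but enters only through one further factor \<open>\<eta>'\<close>, never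
  through the exponent.\<close>

lemma sets_borel_ball [measurable]: "ball (z :: 'a::euclidean_space) r \<in> sets borel"
  by simp

lemma nn_integral_lborel_affine:
  fixes f :: "'a::euclidean_space \<Rightarrow> ennreal"
  assumes [measurable]: "f \<in> borel_measurable borel" and "c \<noteq> 0"
  shows "(\<integral>\<^sup>+x. f x \<partial>lborel) = ennreal (\<bar>c\<bar> ^ DIM('a)) * (\<integral>\<^sup>+x. f (t + c *\<^sub>R x) \<partial>lborel)"
  by (subst lborel_affine[OF assms(2), of t])
     (simp add: nn_integral_density nn_integral_distr nn_integral_cmult ennreal_power)

section \<open>Iterated integrals over the square of a set, and Tonelli's theorem for them\<close>

definition double_int :: "'a::euclidean_space set \<Rightarrow> ('a \<Rightarrow> 'a \<Rightarrow> ennreal) \<Rightarrow> ennreal" where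
  "double_int B K = (\<integral>\<^sup>+x\<in>B. (\<integral>\<^sup>+y\<in>B. K x y \<partial>lborel) \<partial>lborel)"

lemma double_int_mono:
  assumes "\<And>x y. x \<in> B \<Longrightarrow> y \<in> B \<Longrightarrow> K x y \<le> L x y"
  shows "double_int B K \<le> double_int B L"
  unfolding double_int_def
  using assms by (intro nn_integral_mono) (auto simp: indicator_def intro!: nn_integral_mono)

lemma measurable_pair1:
  fixes K :: "'a::euclidean_space \<Rightarrow> 'a \<Rightarrow> ennreal"
  assumes "(\<lambda>(x, y). K x y) \<in> borel_measurable (borel \<Otimes>\<^sub>M borel)"
  shows "(\<lambda>y. K x y) \<in> borel_measurable borel" "(\<lambda>x. K x y) \<in> borel_measurable borel"
  using measurable_compose[OF _ assms, of "\<lambda>y. (x, y)" borel]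
        measurable_compose[OF _ assms, of "\<lambda>x. (x, y)" borel] by auto

lemma measurable_lborel_pair:
  fixes K :: "'a::euclidean_space \<Rightarrow> 'a \<Rightarrow> ennreal"
  assumes "(\<lambda>(x, y). K x y) \<in> borel_measurable (borel \<Otimes>\<^sub>M borel)"
  shows "(\<lambda>(x, y). K x y) \<in> borel_measurable (lborel \<Otimes>\<^sub>M lborel)"
  using assms by (subst measurable_cong_sets[OF sets_pair_measure_cong[OF sets_lborel sets_lborel] refl])

lemma measurable_inner_int:
  fixes K :: "'a::euclidean_space \<Rightarrow> 'a \<Rightarrow> ennreal"
  assumes [measurable]: "B \<in> sets borel"
    and K: "(\<lambda>(x, y). K x y) \<in> borel_measurable (borel \<Otimes>\<^sub>M borel)"
  shows "(\<lambda>x. \<integral>\<^sup>+y\<in>B. K x y \<partial>lborel) \<in> borel_measurable borel"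
proof -
  have [measurable]: "(\<lambda>(x, y). K x y) \<in> borel_measurable (borel \<Otimes>\<^sub>M lborel)"
    using K by (subst measurable_cong_sets[OF sets_pair_measure_cong[OF refl sets_lborel] refl])
  show ?thesis by measurable
qed

lemma double_int_cmult:
  fixes K :: "'a::euclidean_space \<Rightarrow> 'a \<Rightarrow> ennreal"
  assumes [measurable]: "B \<in> sets borel"
    and K: "(\<lambda>(x, y). K x y) \<in> borel_measurable (borel \<Otimes>\<^sub>M borel)"
  shows "double_int B (\<lambda>x y. c * K x y) = c * double_int B K"
proof -
  note [measurable] = measurable_pair1[OF K] measurable_inner_int[OF assms]
  show ?thesis unfolding double_int_def by (simp add: mult.assoc nn_integral_cmult)
qed

lemma double_int_add:
  fixes K L :: "'a::euclidean_space \<Rightarrow> 'a \<Rightarrow> ennreal"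
  assumes [measurable]: "B \<in> sets borel"
    and K: "(\<lambda>(x, y). K x y) \<in> borel_measurable (borel \<Otimes>\<^sub>M borel)"
    and L: "(\<lambda>(x, y). L x y) \<in> borel_measurable (borel \<Otimes>\<^sub>M borel)"
  shows "double_int B (\<lambda>x y. K x y + L x y) = double_int B K + double_int B L"
proof -
  note [measurable] = measurable_pair1[OF K] measurable_inner_int[OF assms(1) K]
    measurable_pair1[OF L] measurable_inner_int[OF assms(1) L]
  show ?thesis unfolding double_int_def by (simp add: distrib_right nn_integral_add)
qed

lemma double_int_swap:
  fixes K :: "'a::euclidean_space \<Rightarrow> 'a \<Rightarrow> ennreal"
  assumes [measurable]: "B \<in> sets borel"
    and K: "(\<lambda>(x, y). K x y) \<in> borel_measurable (borel \<Otimes>\<^sub>M borel)"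
  shows "double_int B (\<lambda>x y. K y x) = double_int B K"
proof -
  note K' [measurable] = measurable_lborel_pair[OF K]
  note [measurable] = measurable_pair1[OF K]
  have [measurable]: "B \<in> sets lborel" by simp
  have "double_int B K = (\<integral>\<^sup>+x. (\<integral>\<^sup>+y. K x y * indicator B y * indicator B x \<partial>lborel) \<partial>lborel)"
    unfolding double_int_def by (simp add: nn_integral_multc)
  also have "\<dots> = (\<integral>\<^sup>+y. (\<integral>\<^sup>+x. K x y * indicator B y * indicator B x \<partial>lborel) \<partial>lborel)"
    by (rule lborel_pair.Fubini'[symmetric]) measurable
  also have "\<dots> = double_int B (\<lambda>x y. K y x)"
    unfolding double_int_def
    by (auto simp: nn_integral_cmult nn_integral_multc mult_ac split: split_indicator intro!: nn_integral_cong)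
  finally show ?thesis ..
qed

lemma double_int_suminf:
  fixes K :: "nat \<Rightarrow> 'a::euclidean_space \<Rightarrow> 'a \<Rightarrow> ennreal"
  assumes [measurable]: "B \<in> sets borel"
    and K: "\<And>m. (\<lambda>(x, y). K m x y) \<in> borel_measurable (borel \<Otimes>\<^sub>M borel)"
  shows "double_int B (\<lambda>x y. \<Sum>m. K m x y) = (\<Sum>m. double_int B (K m))"
proof -
  note [measurable] = measurable_pair1[OF K] measurable_inner_int[OF assms(1) K]
  show ?thesis unfolding double_int_def
    by (simp add: nn_integral_suminf flip: ennreal_suminf_multc)
qed

subsection \<open>Kernels\<close>

lemma dyadic_interval:
  fixes t \<rho> :: real
  assumes "0 < t" "t < \<rho>"
  obtains m :: nat where "\<rho> / 2 ^ Suc m \<le> t" "t < \<rho> / 2 ^ m"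
proof -
  define P where "P n \<longleftrightarrow> \<rho> / 2 ^ Suc n \<le> t" for n :: nat
  obtain n where "\<rho> / t < 2 ^ n" using real_arch_pow[of 2 "\<rho> / t"] by auto
  then have "P n" using assms unfolding P_def by (simp add: field_simps)
  then have L: "P (LEAST n. P n)" by (rule LeastI)
  have "t < \<rho> / 2 ^ (LEAST n. P n)"
  proof (cases "LEAST n. P n")
    case 0 then show ?thesis using assms by simp
  next
    case (Suc m)
    then have "\<not> P m" using not_less_Least[of m P] by simp
    then show ?thesis using Suc unfolding P_def by simp
  qed
  with L show ?thesis using that unfolding P_def by blast
qed

lemma dyadic_interval_large:
  fixes t \<rho> :: real
  assumes "0 < \<rho>" "\<rho> \<le> t"
  obtains m :: nat where "\<rho> * 2 ^ m \<le> t" "t < \<rho> * 2 ^ Suc m"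
proof -
  define P where "P n \<longleftrightarrow> t < \<rho> * 2 ^ Suc n" for n :: nat
  obtain n where "t / \<rho> < 2 ^ n" using real_arch_pow[of 2 "t / \<rho>"] by auto
  then have "P n" using assms unfolding P_def by (simp add: field_simps)
  then have L: "P (LEAST n. P n)" by (rule LeastI)
  have "\<rho> * 2 ^ (LEAST n. P n) \<le> t"
  proof (cases "LEAST n. P n")
    case 0 then show ?thesis using assms by simp
  next
    case (Suc m)
    then have "\<not> P m" using not_less_Least[of m P] by simp
    then show ?thesis using Suc unfolding P_def by simp
  qed
  with L show ?thesis using that unfolding P_def by blast
qed

text \<open>Convexity: \<open>exp\<close> lies below its chord between \<open>- ln 2\<close> and
  \<open>0\<close>, and the slope of that chord gives the factor 1/2.\<close>

lemma one_minus_two_powr_ge: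
  fixes \<alpha> :: real
  assumes "0 < \<alpha>" "\<alpha> \<le> 1"
  shows "\<alpha> / 2 \<le> 1 - 2 powr (-\<alpha>)"
proof -
  have "exp ((1 - \<alpha>) *\<^sub>R 0 + \<alpha> *\<^sub>R (- ln 2)) \<le> (1 - \<alpha>) * exp 0 + \<alpha> * exp (- ln 2 :: real)"
    by (rule convex_onD[OF exp_convex]) (use assms in auto)
  moreover have "exp (- ln 2 :: real) = 1 / 2" by (simp add: exp_minus)
  moreover have "2 powr (-\<alpha>) = exp ((1 - \<alpha>) *\<^sub>R 0 + \<alpha> *\<^sub>R (- ln 2))" by (simp add: powr_def)
  ultimately show ?thesis by simp
qed

text \<open>The sum is comparable to \<open>1 / \<alpha>\<close> from both sides. The upper bound
  serves to integrate kernels; the lower bound turns an estimate that holds at every dyadic scale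
  into a gain proportional to the exponent.\<close>

lemma suminf_geometric_powr:
  fixes \<alpha> :: real
  assumes "0 < \<alpha>" "\<alpha> \<le> 1"
  shows "(\<Sum>m. ennreal (2 powr (- \<alpha> * real m))) \<le> ennreal (2 / \<alpha>)"
    and "(\<Sum>m. ennreal (2 powr (- \<alpha> * real m))) \<ge> ennreal (1 / \<alpha>)"
proof -
  have eq: "2 powr (- \<alpha> * real m) = (2 powr (-\<alpha>)) ^ m" for m
    by (simp add: powr_realpow[symmetric] powr_powr)
  have lt: "2 powr (-\<alpha>) < 1" using assms by (simp add: powr_less_one)
  have "(\<Sum>m. ennreal (2 powr (- \<alpha> * real m))) = ennreal (\<Sum>m. (2 powr (-\<alpha>)) ^ m)"
    unfolding eq by (rule suminf_ennreal2) (use lt in \<open>auto intro!: summable_geometric\<close>)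
  also have "(\<Sum>m. (2 powr (-\<alpha>)) ^ m) = 1 / (1 - 2 powr (-\<alpha>))"
    using lt by (intro suminf_geometric) auto
  finally have *: "(\<Sum>m. ennreal (2 powr (- \<alpha> * real m))) = ennreal (1 / (1 - 2 powr (-\<alpha>)))" .
  show "(\<Sum>m. ennreal (2 powr (- \<alpha> * real m))) \<le> ennreal (2 / \<alpha>)"
    unfolding * using one_minus_two_powr_ge[OF assms] assms lt
    by (intro ennreal_leI) (simp add: field_simps)
  have "1 - \<alpha> \<le> exp (- \<alpha>)" using exp_ge_add_one_self[of "-\<alpha>"] by simp
  also have "exp (-\<alpha>) \<le> 2 powr (-\<alpha>)"
    using assms ln_2_less_1 by (simp add: powr_def)
  finally have "1 - 2 powr (-\<alpha>) \<le> \<alpha>" by simp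
  then show "(\<Sum>m. ennreal (2 powr (- \<alpha> * real m))) \<ge> ennreal (1 / \<alpha>)"
    unfolding * using lt assms by (intro ennreal_leI) (simp add: field_simps)
qed

lemma emeasure_ball_le:
  "emeasure lborel (ball (x::'a::euclidean_space) r) \<le> ennreal (unit_ball_vol DIM('a) * \<bar>r\<bar> ^ DIM('a))"
proof (cases "0 \<le> r")
  case False then show ?thesis by (simp add: ball_empty)
qed (simp add: emeasure_ball)

lemma ennreal_le_suminf: "(f m :: ennreal) \<le> (\<Sum>m. f m)"
  using sum_le_suminf[OF summableI, of "{m}" f] by simp

lemma nn_integral_suminf_indicator:
  fixes c :: "nat \<Rightarrow> ennreal"
  assumes A: "\<And>m. A m \<in> sets M"
  shows "(\<integral>\<^sup>+y. (\<Sum>m. c m * indicator (A m) y) \<partial>M) = (\<Sum>m. c m * emeasure M (A m))"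
proof -
  have "(\<integral>\<^sup>+y. (\<Sum>m. c m * indicator (A m) y) \<partial>M) = (\<Sum>m. \<integral>\<^sup>+y. c m * indicator (A m) y \<partial>M)"
    using A by (intro nn_integral_suminf borel_measurable_times_ennreal borel_measurable_const borel_measurable_indicator)
  then show ?thesis by (simp only: nn_integral_cmult_indicator[OF A])
qed

text \<open>Dyadic annuli take the place of polar coordinates. Because
  \<open>\<alpha> \<le> 1 \<le> d\<close> the exponent is not positive, so on each annulus the
  kernel is at most its value at the inner radius. At \<open>y = x\<close> the kernel has the value
  0.\<close>

lemma nn_integral_near_kernel:
  fixes x :: "'a::euclidean_space" and \<alpha> \<rho> :: real
  assumes "0 < \<alpha>" "\<alpha> \<le> 1" "0 < \<rho>"
  shows "(\<integral>\<^sup>+y\<in>ball x \<rho>. ennreal (norm (x - y) powr (\<alpha> - DIM('a))) \<partial>lborel)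
    \<le> ennreal (2 * 2 ^ DIM('a) * unit_ball_vol DIM('a) * \<rho> powr \<alpha> / \<alpha>)"
proof -
  let ?N = "DIM('a)" and ?w = "unit_ball_vol DIM('a)"
  have N1: "1 \<le> real ?N" using DIM_positive[where 'a='a] by linarith
  have "(\<integral>\<^sup>+y\<in>ball x \<rho>. ennreal (norm (x - y) powr (\<alpha> - ?N)) \<partial>lborel)
    \<le> (\<integral>\<^sup>+y. (\<Sum>m. ennreal ((\<rho> / 2 ^ Suc m) powr (\<alpha> - ?N)) * indicator (ball x (\<rho> / 2 ^ m)) y) \<partial>lborel)"
  proof (rule nn_integral_mono)
    fix y :: 'a
    show "ennreal (norm (x - y) powr (\<alpha> - ?N)) * indicator (ball x \<rho>) y
      \<le> (\<Sum>m. ennreal ((\<rho> / 2 ^ Suc m) powr (\<alpha> - ?N)) * indicator (ball x (\<rho> / 2 ^ m)) y)"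
    proof (cases "y \<in> ball x \<rho> \<and> y \<noteq> x")
      case True
      then have "0 < norm (x - y)" "norm (x - y) < \<rho>" by (auto simp: dist_norm)
      then obtain m :: nat where m: "\<rho> / 2 ^ Suc m \<le> norm (x - y)" "norm (x - y) < \<rho> / 2 ^ m"
        by (rule dyadic_interval)
      have "ennreal (norm (x - y) powr (\<alpha> - ?N)) \<le> ennreal ((\<rho> / 2 ^ Suc m) powr (\<alpha> - ?N))"
        using m N1 assms by (intro ennreal_leI powr_mono2') (auto simp del: DIM_ge_Suc0)
      then have "ennreal (norm (x - y) powr (\<alpha> - ?N)) * indicator (ball x \<rho>) y
        \<le> ennreal ((\<rho> / 2 ^ Suc m) powr (\<alpha> - ?N)) * indicator (ball x (\<rho> / 2 ^ m)) y"
        using m by (auto simp: indicator_def dist_norm)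
      also have "\<dots> \<le> (\<Sum>m. ennreal ((\<rho> / 2 ^ Suc m) powr (\<alpha> - ?N)) * indicator (ball x (\<rho> / 2 ^ m)) y)"
        by (rule ennreal_le_suminf)
      finally show ?thesis .
    qed auto
  qed
  also have "\<dots> = (\<Sum>m. ennreal ((\<rho> / 2 ^ Suc m) powr (\<alpha> - ?N)) * emeasure lborel (ball x (\<rho> / 2 ^ m)))"
    by (rule nn_integral_suminf_indicator) simp
  also have "\<dots> \<le> (\<Sum>m. ennreal (2 ^ ?N * ?w * \<rho> powr \<alpha>) * ennreal (2 powr (- \<alpha> * real m)))"
  proof (intro suminf_le summableI)
    fix m
    have "ennreal ((\<rho> / 2 ^ Suc m) powr (\<alpha> - ?N)) * emeasure lborel (ball x (\<rho> / 2 ^ m))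
      = ennreal ((\<rho> / 2 ^ Suc m) powr (\<alpha> - ?N) * (?w * (\<rho> / 2 ^ m) ^ ?N))"
      using assms by (simp add: emeasure_ball ennreal_mult)
    also have "(\<rho> / 2 ^ Suc m) powr (\<alpha> - ?N) * (?w * (\<rho> / 2 ^ m) ^ ?N) = 
       2 powr (?N - \<alpha>) * ?w * \<rho> powr \<alpha> * 2 powr (- \<alpha> * real m)"
    proof -
      have "(\<rho> / 2 ^ Suc m) powr (\<alpha> - ?N) = \<rho> powr \<alpha> / \<rho> powr ?N * 2 powr (real (Suc m) * (?N - \<alpha>))"
      proof -
        have "(\<rho> / 2 ^ Suc m) powr (\<alpha> - ?N) = \<rho> powr (\<alpha> - ?N) / (2 powr real (Suc m)) powr (\<alpha> - ?N)"
          using assms by (simp add: powr_divide powr_realpow del: power_Suc of_nat_Suc)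
        also have "\<dots> = \<rho> powr (\<alpha> - ?N) * 2 powr (real (Suc m) * (?N - \<alpha>))"
          by (simp only: powr_powr divide_powr_uminus) (simp add: algebra_simps)
        finally show ?thesis by (simp add: powr_diff)
      qed
      moreover have "(\<rho> / 2 ^ m) ^ ?N = \<rho> powr ?N / 2 powr (real m * ?N)"
        using assms by (simp add: powr_realpow power_divide power_mult flip: powr_powr)
      ultimately have "(\<rho> / 2 ^ Suc m) powr (\<alpha> - ?N) * (?w * (\<rho> / 2 ^ m) ^ ?N) =
        (\<rho> powr \<alpha> / \<rho> powr ?N * 2 powr (real (Suc m) * (?N - \<alpha>))) * (?w * (\<rho> powr ?N / 2 powr (real m * ?N)))"
        by (simp only:)
      also have "\<dots> = ?w * \<rho> powr \<alpha> * (2 powr (real (Suc m) * (?N - \<alpha>)) / 2 powr (real m * ?N))"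
        using assms by simp
      also have "2 powr (real (Suc m) * (?N - \<alpha>)) / 2 powr (real m * ?N) = 2 powr (?N - \<alpha>) * 2 powr (- \<alpha> * real m)"
        by (simp add: powr_diff[symmetric] powr_add[symmetric] algebra_simps)
      finally show ?thesis by (simp only: mult_ac)
    qed
    also have "ennreal (\<dots>) \<le> ennreal (2 ^ ?N * ?w * \<rho> powr \<alpha> * 2 powr (- \<alpha> * real m))"
      using assms by (intro ennreal_leI mult_right_mono) (auto simp flip: powr_realpow intro!: powr_mono)
    also have "\<dots> = ennreal (2 ^ ?N * ?w * \<rho> powr \<alpha>) * ennreal (2 powr (- \<alpha> * real m))"
      by (rule ennreal_mult) auto
    finally show "ennreal ((\<rho> / 2 ^ Suc m) powr (\<alpha> - ?N)) * emeasure lborel (ball x (\<rho> / 2 ^ m)) \<le> \<dots>" .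
  qed
  also have "\<dots> \<le> ennreal (2 ^ ?N * ?w * \<rho> powr \<alpha>) * ennreal (2 / \<alpha>)"
    using suminf_geometric_powr(1)[OF assms(1,2)] by (simp add: mult_left_mono)
  also have "\<dots> = ennreal (2 ^ ?N * ?w * \<rho> powr \<alpha> * (2 / \<alpha>))"
    using assms by (intro ennreal_mult[symmetric]) auto
  finally show ?thesis by (simp add: mult_ac)
qed

text \<open>The annuli now grow outwards. The power \<open>- d\<close> of the kernel cancels the
  volume of each annulus up to the factor \<open>2 ^ d\<close>, which leaves a geometric series in
  \<open>2 powr (- s)\<close>.\<close>

lemma nn_integral_far_kernel:
  fixes x :: "'a::euclidean_space" and s \<rho> :: real
  assumes "0 < s" "s \<le> 1" "0 < \<rho>"
  shows "(\<integral>\<^sup>+y\<in>- ball x \<rho>. ennreal (1 / norm (y - x) powr (DIM('a) + s)) \<partial>lborel)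
    \<le> ennreal (2 * 2 ^ DIM('a) * unit_ball_vol DIM('a) * \<rho> powr (- s) / s)"
proof -
  let ?N = "DIM('a)" and ?w = "unit_ball_vol DIM('a)"
  have "(\<integral>\<^sup>+y\<in>- ball x \<rho>. ennreal (1 / norm (y - x) powr (?N + s)) \<partial>lborel)
    \<le> (\<integral>\<^sup>+y. (\<Sum>m. ennreal ((\<rho> * 2 ^ m) powr (- (?N + s))) * indicator (ball x (\<rho> * 2 ^ Suc m)) y) \<partial>lborel)"
  proof (rule nn_integral_mono)
    fix y :: 'a
    show "ennreal (1 / norm (y - x) powr (?N + s)) * indicator (- ball x \<rho>) y
      \<le> (\<Sum>m. ennreal ((\<rho> * 2 ^ m) powr (- (?N + s))) * indicator (ball x (\<rho> * 2 ^ Suc m)) y)"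
    proof (cases "y \<in> - ball x \<rho>")
      case True
      then have ge: "\<rho> \<le> norm (y - x)" by (auto simp: dist_norm norm_minus_commute)
      have pos: "0 < norm (y - x)" using ge assms by linarith
      obtain m where m: "\<rho> * 2 ^ m \<le> norm (y - x)" "norm (y - x) < \<rho> * 2 ^ Suc m"
        using dyadic_interval_large[OF assms(3) ge] by blast
      have "ennreal (1 / norm (y - x) powr (?N + s)) \<le> ennreal ((\<rho> * 2 ^ m) powr (- (?N + s)))"
        using m assms pos by (subst powr_minus_divide) (intro ennreal_leI divide_left_mono powr_mono2, auto)
      then have "ennreal (1 / norm (y - x) powr (?N + s)) * indicator (- ball x \<rho>) y
        \<le> ennreal ((\<rho> * 2 ^ m) powr (- (?N + s))) * indicator (ball x (\<rho> * 2 ^ Suc m)) y"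
        using m by (auto simp: indicator_def dist_norm norm_minus_commute)
      also have "\<dots> \<le> (\<Sum>m. ennreal ((\<rho> * 2 ^ m) powr (- (?N + s))) * indicator (ball x (\<rho> * 2 ^ Suc m)) y)"
        by (rule ennreal_le_suminf)
      finally show ?thesis .
    qed auto
  qed
  also have "\<dots> = (\<Sum>m. ennreal ((\<rho> * 2 ^ m) powr (- (?N + s))) * emeasure lborel (ball x (\<rho> * 2 ^ Suc m)))"
    by (rule nn_integral_suminf_indicator) simp
  also have "\<dots> = (\<Sum>m. ennreal (2 ^ ?N * ?w * \<rho> powr (-s)) * ennreal (2 powr (- s * real m)))"
  proof (intro suminf_cong)
    fix m
    have "ennreal ((\<rho> * 2 ^ m) powr (- (?N + s))) * emeasure lborel (ball x (\<rho> * 2 ^ Suc m))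
      = ennreal ((\<rho> * 2 ^ m) powr (- (?N + s)) * (?w * (\<rho> * 2 ^ Suc m) ^ ?N))"
      using assms by (simp add: emeasure_ball ennreal_mult)
    also have "(\<rho> * 2 ^ m) powr (- (?N + s)) * (?w * (\<rho> * 2 ^ Suc m) ^ ?N) = 
       2 ^ ?N * ?w * \<rho> powr (- s) * 2 powr (- s * real m)"
    proof -
      have "(\<rho> * 2 ^ m) powr (- (?N + s)) = (\<rho> * 2 ^ m) powr (-?N) * (\<rho> powr (-s) * (2^m) powr (-s))"
        using assms by (simp add: powr_mult[symmetric] powr_add[symmetric])
      moreover have "(2^m) powr (-s) = 2 powr (- s * real m)"
        by (simp add: powr_realpow[symmetric] powr_powr mult_ac)
      moreover have "(\<rho> * 2 ^ Suc m) ^ ?N = 2 ^ ?N * (\<rho> * 2 ^ m) ^ ?N" by (simp add: power_mult_distrib mult_ac)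
      moreover have "(\<rho> * 2 ^ m) powr (-?N) * (\<rho> * 2 ^ m) ^ ?N = 1"
        using assms by (simp add: powr_minus powr_realpow)
      ultimately show ?thesis by (simp add: mult_ac)
    qed
    also have "ennreal \<dots> = ennreal (2 ^ ?N * ?w * \<rho> powr (-s)) * ennreal (2 powr (- s * real m))"
      by (rule ennreal_mult) auto
    finally show "ennreal ((\<rho> * 2 ^ m) powr (- (?N + s))) * emeasure lborel (ball x (\<rho> * 2 ^ Suc m)) = \<dots>" .
  qed
  also have "\<dots> \<le> ennreal (2 ^ ?N * ?w * \<rho> powr (-s)) * ennreal (2 / s)"
    using suminf_geometric_powr(1)[OF assms(1,2)] by (simp add: mult_left_mono)
  also have "\<dots> = ennreal (2 ^ ?N * ?w * \<rho> powr (-s) * (2 / s))"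
    using assms by (intro ennreal_mult[symmetric]) auto
  finally show ?thesis by (simp add: mult_ac)
qed


subsection \<open>Differences of functions on convex sets\<close>

text \<open>A pair at distance less than \<open>2 * t\<close> is joined through its midpoint, which
  lies in \<open>B\<close> by convexity and has distance less than \<open>t\<close> from both ends.
  Taking the midpoint as the new variable, \<open>y = 2 z - x\<close>, has the Jacobian
  \<open>2 ^ d\<close>, and the two halves contribute equally by symmetry.\<close>

lemma double_int_midpoint_doubling:
  fixes W :: "'a::euclidean_space \<Rightarrow> real"
  assumes "convex B" and [measurable]: "B \<in> sets borel" "W \<in> borel_measurable borel"
  shows "double_int B (\<lambda>x y. ennreal \<bar>W x - W y\<bar> * indicator {..<2 * t} (norm (x - y)))
    \<le> ennreal (2 ^ Suc DIM('a)) * double_int B (\<lambda>x y. ennreal \<bar>W x - W y\<bar> * indicator {..<t} (norm (x - y)))"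
proof -
  define m :: "'a \<Rightarrow> 'a \<Rightarrow> 'a" where "m x y = (1/2) *\<^sub>R (x + y)" for x y
  define K where "K x y = ennreal \<bar>W x - W (m x y)\<bar> * indicator {..<2 * t} (norm (x - y))" for x y
  define L where "L x y = ennreal \<bar>W x - W y\<bar> * indicator {..<t} (norm (x - y))" for x y
  have [measurable]: "(\<lambda>(x, y). m x y) \<in> borel \<Otimes>\<^sub>M borel \<rightarrow>\<^sub>M borel"
    unfolding m_def by measurable
  have Km [measurable]: "(\<lambda>(x, y). K x y) \<in> borel_measurable (borel \<Otimes>\<^sub>M borel)"
    unfolding K_def by measurable
  have Lm [measurable]: "(\<lambda>(x, y). L x y) \<in> borel_measurable (borel \<Otimes>\<^sub>M borel)"
    unfolding L_def by measurable
  have K': "(\<lambda>(x, y). K y x) \<in> borel_measurable (borel \<Otimes>\<^sub>M borel)" by measurable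
  note [measurable] = measurable_pair1[OF Km] measurable_pair1[OF Lm] measurable_inner_int[OF assms(2) Lm]
  have inner: "(\<integral>\<^sup>+y\<in>B. K x y \<partial>lborel) \<le> ennreal (2 ^ DIM('a)) * (\<integral>\<^sup>+y\<in>B. L x y \<partial>lborel)" if "x \<in> B" for x
  proof -
    have "(\<integral>\<^sup>+y\<in>B. K x y \<partial>lborel) =
        ennreal (2 ^ DIM('a)) * (\<integral>\<^sup>+z. K x (- x + 2 *\<^sub>R z) * indicator B (- x + 2 *\<^sub>R z) \<partial>lborel)"
      by (subst nn_integral_lborel_affine[of _ 2 "- x"]) auto
    also have "(\<integral>\<^sup>+z. K x (- x + 2 *\<^sub>R z) * indicator B (- x + 2 *\<^sub>R z) \<partial>lborel) \<le> (\<integral>\<^sup>+y\<in>B. L x y \<partial>lborel)"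
    proof (rule nn_integral_mono)
      fix z
      have 1: "m x (- x + 2 *\<^sub>R z) = z" by (simp add: m_def)
      have "x - (- x + 2 *\<^sub>R z) = 2 *\<^sub>R (x - z)" by (simp add: algebra_simps scaleR_2)
      then have 2: "norm (x - (- x + 2 *\<^sub>R z)) = 2 * norm (x - z)" by simp
      have 3: "z \<in> B" if "- x + 2 *\<^sub>R z \<in> B"
        using convexD[OF assms(1) \<open>x \<in> B\<close> that, of "1/2" "1/2"] by (simp add: algebra_simps)
      show "K x (- x + 2 *\<^sub>R z) * indicator B (- x + 2 *\<^sub>R z) \<le> L x z * indicator B z"
        unfolding K_def L_def 1 2 using 3 by (auto simp: indicator_def)
    qed
    finally show ?thesis by (simp add: mult_left_mono)
  qed
  have "double_int B K \<le> (\<integral>\<^sup>+x. ennreal (2 ^ DIM('a)) * ((\<integral>\<^sup>+y\<in>B. L x y \<partial>lborel) * indicator B x) \<partial>lborel)"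
    unfolding double_int_def using inner by (intro nn_integral_mono) (auto simp: indicator_def)
  also have "\<dots> = ennreal (2 ^ DIM('a)) * double_int B L"
    unfolding double_int_def by (rule nn_integral_cmult) measurable
  finally have KL: "double_int B K \<le> ennreal (2 ^ DIM('a)) * double_int B L" .
  have "double_int B (\<lambda>x y. ennreal \<bar>W x - W y\<bar> * indicator {..<2 * t} (norm (x - y)))
      \<le> double_int B (\<lambda>x y. K x y + K y x)"
  proof (rule double_int_mono)
    fix x y
    have "ennreal \<bar>W x - W y\<bar> \<le> ennreal (\<bar>W x - W (m x y)\<bar> + \<bar>W y - W (m x y)\<bar>)"
      by (rule ennreal_leI) linarith
    also have "\<dots> = ennreal \<bar>W x - W (m x y)\<bar> + ennreal \<bar>W y - W (m y x)\<bar>"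
      by (simp add: m_def add.commute)
    finally show "ennreal \<bar>W x - W y\<bar> * indicator {..<2 * t} (norm (x - y)) \<le> K x y + K y x"
      unfolding K_def norm_minus_commute[of y x] by (auto simp: indicator_def)
  qed
  also have "\<dots> = double_int B K + double_int B K"
    using double_int_add[OF assms(2) Km K'] double_int_swap[OF assms(2) Km] by simp
  also have "\<dots> \<le> ennreal (2 ^ DIM('a)) * double_int B L + ennreal (2 ^ DIM('a)) * double_int B L"
    using KL by (intro add_mono)
  also have "\<dots> = ennreal (2 ^ Suc DIM('a)) * double_int B L"
    by (simp add: distrib_right[symmetric] ennreal_plus[symmetric] del: ennreal_plus)
  finally show ?thesis unfolding L_def .
qed

text \<open>Only the finitely many scales with \<open>h < T / 2 ^ m\<close> contribute. As
  \<open>\<gamma> \<ge> 1\<close> the terms at least double, so the sum is at most twice its last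
  term, where \<open>2 ^ m < T / h\<close>.\<close>

lemma suminf_dyadic_kernel:
  fixes h T \<gamma> :: real
  assumes "0 < h" "0 < T" "1 \<le> \<gamma>"
  shows "(\<Sum>m. ennreal (2 powr (\<gamma> * real m)) * indicator {..<T / 2 ^ m} h) \<le> ennreal (2 * (T / h) powr \<gamma>)"
proof (cases "h < T")
  case False
  have "T / 2 ^ m \<le> h" for m
  proof -
    have "T / 2 ^ m \<le> T / 1" using assms by (intro divide_left_mono) auto
    with False show ?thesis by linarith
  qed
  then have "ennreal (2 powr (\<gamma> * real m)) * indicator {..<T / 2 ^ m} h = 0" for m
    by (auto simp: indicator_def not_less)
  then show ?thesis by simp
next
  case True
  with assms(1) obtain n where n: "T / 2 ^ Suc n \<le> h" "h < T / 2 ^ n" by (rule dyadic_interval)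
  have le: "h < T / 2 ^ m \<longleftrightarrow> m \<le> n" for m
  proof
    assume "h < T / 2 ^ m"
    then have "T / 2 ^ Suc n < T / 2 ^ m" using n by linarith
    then have "(2::real) ^ m < 2 ^ Suc n" using assms by (simp add: field_simps)
    then show "m \<le> n" by (simp del: power_Suc)
  next
    assume "m \<le> n"
    then have "T / 2 ^ n \<le> T / 2 ^ m" using assms by (intro divide_left_mono) auto
    then show "h < T / 2 ^ m" using n by linarith
  qed
  have sum: "(\<Sum>m\<le>n. 2 powr (\<gamma> * real m)) \<le> 2 * 2 powr (\<gamma> * real n)"
  proof (induction n)
    case (Suc n)
    have "2 powr (\<gamma> * real n) * 2 powr 1 \<le> 2 powr (\<gamma> * real n) * 2 powr \<gamma>"
      using assms by (intro mult_left_mono powr_mono) auto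
    also have "\<dots> = 2 powr (\<gamma> * real (Suc n))" by (simp add: powr_add[symmetric] algebra_simps)
    finally have "2 * 2 powr (\<gamma> * real n) \<le> 2 powr (\<gamma> * real (Suc n))" by simp
    with Suc show ?case by simp
  qed simp
  have "(\<Sum>m. ennreal (2 powr (\<gamma> * real m)) * indicator {..<T / 2 ^ m} h)
     = (\<Sum>m\<le>n. ennreal (2 powr (\<gamma> * real m)) * indicator {..<T / 2 ^ m} h)"
    by (rule suminf_finite) (auto simp: indicator_def le)
  also have "\<dots> = (\<Sum>m\<le>n. ennreal (2 powr (\<gamma> * real m)))"
    by (rule sum.cong) (auto simp: indicator_def le)
  also have "\<dots> = ennreal (\<Sum>m\<le>n. 2 powr (\<gamma> * real m))" by (rule sum_ennreal) auto
  also have "\<dots> \<le> ennreal (2 * 2 powr (\<gamma> * real n))" by (rule ennreal_leI[OF sum])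
  also have "\<dots> \<le> ennreal (2 * (T / h) powr \<gamma>)"
  proof (intro ennreal_leI mult_left_mono)
    have "2 powr (\<gamma> * real n) = (2 ^ n) powr \<gamma>" by (simp add: powr_realpow[symmetric] powr_powr mult_ac)
    also have "\<dots> \<le> (T / h) powr \<gamma>"
      using n assms by (intro powr_mono2) (auto simp: field_simps)
    finally show "2 powr (\<gamma> * real n) \<le> (T / h) powr \<gamma>" .
  qed simp
  finally show ?thesis .
qed

text \<open>The factor \<open>1 - \<sigma>\<close> is what keeps everything uniform as \<open>s \<rightarrow> 1\<close>: by the doubling bound every dyadic
  scale below \<open>T\<close> contributes to the right-hand side, and effectively there are \<open>1 / (1 - \<sigma>)\<close> of them.\<close>

lemma double_int_diff_le_kernel:
  fixes W :: "'a::euclidean_space \<Rightarrow> real" and \<sigma> T :: real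
  assumes "convex B" and [measurable]: "B \<in> sets borel" "W \<in> borel_measurable borel"
    and "0 < T" "0 < \<sigma>" "\<sigma> < 1"
  shows "double_int B (\<lambda>x y. ennreal \<bar>W x - W y\<bar> * indicator {..<T} (norm (x - y)))
    \<le> ennreal (2 * T powr (DIM('a) + \<sigma>) * (1 - \<sigma>)) *
       double_int B (\<lambda>x y. ennreal (\<bar>W x - W y\<bar> * norm (x - y) powr (- (DIM('a) + \<sigma>))))"
proof -
  let ?N = "DIM('a)"
  have N1: "1 \<le> real ?N" using DIM_positive[where 'a='a] by linarith
  define Q where "Q t = double_int B (\<lambda>x y. ennreal \<bar>W x - W y\<bar> * indicator {..<t} (norm (x - y)))" for t
  define e where "e = 1 - \<sigma>"
  have e: "0 < e" "e \<le> 1" using assms by (auto simp: e_def)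
  have iter: "Q T \<le> ennreal (2 ^ (Suc ?N * m)) * Q (T / 2 ^ m)" for m
  proof (induction m)
    case (Suc m)
    have "Q (2 * (T / 2 ^ Suc m)) \<le> ennreal (2 ^ Suc ?N) * Q (T / 2 ^ Suc m)"
      unfolding Q_def by (rule double_int_midpoint_doubling) fact+
    then have "Q (T / 2 ^ m) \<le> ennreal (2 ^ Suc ?N) * Q (T / 2 ^ Suc m)" by simp
    then have "ennreal (2 ^ (Suc ?N * m)) * Q (T / 2 ^ m) \<le>
        ennreal (2 ^ (Suc ?N * m)) * (ennreal (2 ^ Suc ?N) * Q (T / 2 ^ Suc m))"
      by (rule mult_left_mono) simp
    also have "\<dots> = ennreal (2 ^ (Suc ?N * Suc m)) * Q (T / 2 ^ Suc m)"
      by (simp add: mult.assoc[symmetric] ennreal_mult[symmetric] power_add[symmetric] del: power_Suc) (simp add: add.commute)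
    finally show ?case using Suc.IH by (rule order_trans[rotated])
  qed simp
  \<comment> \<open>Descending \<open>m\<close> scales costs \<open>2 ^ ((d + 1) * m)\<close>. Since
    \<open>d + 1 - e = d + \<sigma>\<close>, the weight remaining at scale \<open>m\<close> is the
    one that \<open>suminf_dyadic_kernel\<close> reassembles into the kernel of order
    \<open>\<sigma>\<close>.\<close>
  have scale: "ennreal (2 powr (- e * real m)) * Q T \<le>
      double_int B (\<lambda>x y. ennreal \<bar>W x - W y\<bar> * (ennreal (2 powr ((?N + \<sigma>) * real m)) * indicator {..<T / 2 ^ m} (norm (x - y))))" for m
  proof -
    have "ennreal (2 powr (- e * real m)) * Q T \<le>
      ennreal (2 powr (- e * real m)) * (ennreal (2 ^ (Suc ?N * m)) * Q (T / 2 ^ m))"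
      using iter by (rule mult_left_mono) simp
    also have "\<dots> = ennreal (2 powr ((?N + \<sigma>) * real m)) * Q (T / 2 ^ m)"
    proof -
      have "(2::real) ^ (Suc ?N * m) = 2 powr (real (Suc ?N) * real m)"
        by (simp add: powr_realpow[symmetric] algebra_simps)
      then have "2 powr (- e * real m) * 2 ^ (Suc ?N * m) = 2 powr ((?N + \<sigma>) * real m)"
        by (simp only: powr_add[symmetric]) (simp add: e_def algebra_simps)
      then show ?thesis by (simp add: mult.assoc[symmetric] ennreal_mult[symmetric])
    qed
    also have "\<dots> = double_int B (\<lambda>x y. ennreal (2 powr ((?N + \<sigma>) * real m)) * (ennreal \<bar>W x - W y\<bar> * indicator {..<T / 2 ^ m} (norm (x - y))))"
      unfolding Q_def by (rule double_int_cmult[symmetric]) measurable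
    finally show ?thesis by (simp add: mult_ac)
  qed
  have "ennreal (1 / e) * Q T \<le> (\<Sum>m. ennreal (2 powr (- e * real m))) * Q T"
    using suminf_geometric_powr(2)[OF e] by (rule mult_right_mono) simp
  also have "\<dots> = (\<Sum>m. ennreal (2 powr (- e * real m)) * Q T)"
    by (rule ennreal_suminf_multc[symmetric])
  also have "\<dots> \<le> (\<Sum>m. double_int B (\<lambda>x y. ennreal \<bar>W x - W y\<bar> * (ennreal (2 powr ((?N + \<sigma>) * real m)) * indicator {..<T / 2 ^ m} (norm (x - y)))))"
    by (intro suminf_le summableI scale)
  also have "\<dots> = double_int B (\<lambda>x y. \<Sum>m. ennreal \<bar>W x - W y\<bar> * (ennreal (2 powr ((?N + \<sigma>) * real m)) * indicator {..<T / 2 ^ m} (norm (x - y))))"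
    by (rule double_int_suminf[symmetric]) measurable
  also have "\<dots> \<le> double_int B (\<lambda>x y. ennreal (2 * T powr (?N + \<sigma>)) * ennreal (\<bar>W x - W y\<bar> * norm (x - y) powr (- (?N + \<sigma>))))"
  proof (rule double_int_mono)
    fix x y
    show "(\<Sum>m. ennreal \<bar>W x - W y\<bar> * (ennreal (2 powr ((?N + \<sigma>) * real m)) * indicator {..<T / 2 ^ m} (norm (x - y))))
      \<le> ennreal (2 * T powr (?N + \<sigma>)) * ennreal (\<bar>W x - W y\<bar> * norm (x - y) powr (- (?N + \<sigma>)))"
    proof (cases "x = y")
      case False
      have "(\<Sum>m. ennreal \<bar>W x - W y\<bar> * (ennreal (2 powr ((?N + \<sigma>) * real m)) * indicator {..<T / 2 ^ m} (norm (x - y))))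
         = ennreal \<bar>W x - W y\<bar> * (\<Sum>m. ennreal (2 powr ((?N + \<sigma>) * real m)) * indicator {..<T / 2 ^ m} (norm (x - y)))"
        by (rule ennreal_suminf_cmult)
      also have "\<dots> \<le> ennreal \<bar>W x - W y\<bar> * ennreal (2 * (T / norm (x - y)) powr (?N + \<sigma>))"
        using assms N1 False by (intro mult_left_mono suminf_dyadic_kernel) (auto simp del: DIM_ge_Suc0)
      also have "\<dots> = ennreal (2 * T powr (?N + \<sigma>)) * ennreal (\<bar>W x - W y\<bar> * norm (x - y) powr (- (?N + \<sigma>)))"
        using assms unfolding powr_minus_divide by (simp add: ennreal_mult[symmetric] powr_divide field_simps)
      finally show ?thesis .
    qed simp
  qed
  also have "\<dots> = ennreal (2 * T powr (?N + \<sigma>)) * double_int B (\<lambda>x y. ennreal (\<bar>W x - W y\<bar> * norm (x - y) powr (- (?N + \<sigma>))))"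
    by (rule double_int_cmult) measurable
  finally have "ennreal e * (ennreal (1 / e) * Q T) \<le> ennreal e * (ennreal (2 * T powr (?N + \<sigma>)) * double_int B (\<lambda>x y. ennreal (\<bar>W x - W y\<bar> * norm (x - y) powr (- (?N + \<sigma>)))))"
    by (rule mult_left_mono) simp
  moreover have "ennreal e * (ennreal (1 / e) * Q T) = Q T"
    using e by (simp add: mult.assoc[symmetric] ennreal_mult[symmetric])
  moreover have "ennreal e * (ennreal (2 * T powr (?N + \<sigma>)) * X) = ennreal (2 * T powr (?N + \<sigma>) * (1 - \<sigma>)) * X" for X
    using e by (simp add: mult.assoc[symmetric] ennreal_mult[symmetric] e_def mult_ac)
  ultimately show ?thesis unfolding Q_def by simp
qed

text \<open>The intersection contains a ball of radius \<open>T / 2\<close>. Its centre is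
  \<open>x\<close> moved towards \<open>z\<close> by the fraction \<open>T / (2 * r)\<close> of the
  way, which is at most \<open>T / 2\<close> and brings it within \<open>r - T / 2\<close> of
  \<open>z\<close>.\<close>

lemma emeasure_ball_Int_ball_ge:
  fixes x z :: "'a::euclidean_space"
  assumes "x \<in> ball z r" "0 < T" "T \<le> r"
  shows "ennreal (unit_ball_vol DIM('a) * (T / 2) ^ DIM('a)) \<le> emeasure lborel (ball x T \<inter> ball z r)"
proof -
  define c where "c = x + (T / (2 * r)) *\<^sub>R (z - x)"
  have r: "0 < r" using assms by linarith
  have d: "norm (z - x) < r" using assms by (simp add: dist_norm)
  have 1: "dist c x \<le> T / 2"
  proof -
    have "dist c x = T / (2 * r) * norm (z - x)" using assms r by (simp add: c_def dist_norm)
    also have "\<dots> \<le> T / (2 * r) * r" using assms r d by (intro mult_left_mono) auto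
    finally show ?thesis using r by simp
  qed
  have 2: "dist c z \<le> r - T / 2"
  proof -
    have "c - z = (1 - T / (2 * r)) *\<^sub>R (x - z)" by (simp add: c_def algebra_simps)
    then have "dist c z = \<bar>1 - T / (2 * r)\<bar> * norm (z - x)" by (simp add: dist_norm norm_minus_commute)
    also have "\<bar>1 - T / (2 * r)\<bar> = 1 - T / (2 * r)" using assms r by (intro abs_of_nonneg) (simp add: field_simps)
    also have "\<dots> * norm (z - x) \<le> (1 - T / (2 * r)) * r" using assms r d by (intro mult_left_mono) (auto simp: field_simps)
    also have "(1 - T / (2 * r)) * r = r - T / 2" using r by (simp add: field_simps)
    finally show ?thesis .
  qed
  have "ball c (T / 2) \<subseteq> ball x T \<inter> ball z r"
  proof
    fix y assume "y \<in> ball c (T / 2)"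
    then have "dist c y < T / 2" by simp
    then show "y \<in> ball x T \<inter> ball z r"
      using 1 2 dist_triangle[of x y c] dist_triangle[of z y c] by (simp add: dist_commute)
  qed
  then have "emeasure lborel (ball c (T / 2)) \<le> emeasure lborel (ball x T \<inter> ball z r)"
    by (intro emeasure_mono) auto
  then show ?thesis using assms by (simp add: emeasure_ball)
qed

text \<open>This replaces the Sobolev inequality in the De Giorgi iteration.\<close>

lemma nn_integral_le_double_int_diff:
  fixes F :: "'a::euclidean_space \<Rightarrow> real"
  assumes [measurable]: "F \<in> borel_measurable borel" and F: "\<And>x. 0 \<le> F x"
    and T: "0 < T" "T \<le> r"
    and small: "emeasure lborel {y \<in> ball z r. 0 < F y} \<le> ennreal (unit_ball_vol DIM('a) * (T / 2) ^ DIM('a) / 2)"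
  shows "ennreal (unit_ball_vol DIM('a) * (T / 2) ^ DIM('a) / 2) * (\<integral>\<^sup>+x\<in>ball z r. ennreal (F x) \<partial>lborel)
    \<le> double_int (ball z r) (\<lambda>x y. ennreal \<bar>F x - F y\<bar> * indicator {..<T} (norm (x - y)))"
proof -
  define v where "v = unit_ball_vol DIM('a) * (T / 2) ^ DIM('a)"
  have v: "0 \<le> v" using T by (simp add: v_def)
  define A where "A = {y \<in> ball z r. 0 < F y}"
  have [measurable]: "A \<in> sets borel" unfolding A_def by measurable
  have inner: "ennreal (v / 2) * ennreal (F x) \<le> (\<integral>\<^sup>+y\<in>ball z r. ennreal \<bar>F x - F y\<bar> * indicator {..<T} (norm (x - y)) \<partial>lborel)"
    if x: "x \<in> ball z r" for x
  proof -
    \<comment> \<open>The set \<open>?U\<close> has measure at least \<open>v\<close> and the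
      support \<open>A\<close> of \<open>F\<close> takes at most half of that; on the remainder
      \<open>F y = 0\<close>, so the difference there is all of \<open>F x\<close>.\<close>
    let ?U = "ball x T \<inter> ball z r"
    have "ennreal v \<le> emeasure lborel ?U"
      unfolding v_def by (rule emeasure_ball_Int_ball_ge) fact+
    also have "\<dots> \<le> emeasure lborel (?U - A) + emeasure lborel A"
      by (rule order_trans[OF emeasure_mono emeasure_subadditive]) auto
    also have "\<dots> \<le> emeasure lborel (?U - A) + ennreal (v / 2)"
      using small unfolding v_def A_def by (intro add_left_mono) simp
    finally have *: "ennreal v \<le> emeasure lborel (?U - A) + ennreal (v / 2)" .
    have "ennreal (v / 2) + ennreal (v / 2) = ennreal v"
      using v by (simp add: ennreal_plus[symmetric] del: ennreal_plus)
    with * have "ennreal (v / 2) \<le> emeasure lborel (?U - A)"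
      by (metis add_right_mono ennreal_add_left_cancel_le ennreal_neq_top add.commute infinity_ennreal_def)
    then have "ennreal (v / 2) * ennreal (F x) \<le> emeasure lborel (?U - A) * ennreal (F x)"
      by (rule mult_right_mono) simp
    also have "\<dots> = (\<integral>\<^sup>+y. ennreal (F x) * indicator (?U - A) y \<partial>lborel)"
      by (subst nn_integral_cmult_indicator) (auto simp: mult.commute)
    also have "\<dots> \<le> (\<integral>\<^sup>+y\<in>ball z r. ennreal \<bar>F x - F y\<bar> * indicator {..<T} (norm (x - y)) \<partial>lborel)"
    proof (rule nn_integral_mono)
      fix y
      show "ennreal (F x) * indicator (?U - A) y \<le> ennreal \<bar>F x - F y\<bar> * indicator {..<T} (norm (x - y)) * indicator (ball z r) y"
      proof (cases "y \<in> ?U - A")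
        case True
        then have "F y = 0" using F[of y] by (auto simp: A_def)
        then show ?thesis using True F[of x] by (auto simp: dist_norm)
      qed simp
    qed
    finally show ?thesis .
  qed
  have "ennreal (v / 2) * (\<integral>\<^sup>+x\<in>ball z r. ennreal (F x) \<partial>lborel)
      = (\<integral>\<^sup>+x. ennreal (v / 2) * (ennreal (F x) * indicator (ball z r) x) \<partial>lborel)"
    by (rule nn_integral_cmult[symmetric]) measurable
  also have "\<dots> = (\<integral>\<^sup>+x\<in>ball z r. ennreal (v / 2) * ennreal (F x) \<partial>lborel)"
    by (simp only: mult.assoc)
  also have "\<dots> \<le> double_int (ball z r) (\<lambda>x y. ennreal \<bar>F x - F y\<bar> * indicator {..<T} (norm (x - y)))"
    unfolding double_int_def using inner by (intro nn_integral_mono) (auto simp: indicator_def)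
  finally show ?thesis by (simp add: v_def)
qed

subsection \<open>Growth functions\<close>

text \<open>Here \<open>g\<close> stands for the derivative of \<open>f\<close>. The estimates use
  only inequalities between the two, so these are the axioms, and all differentiation is confined to
  \<open>orlicz_of_growth\<close>, which provides the instance.\<close>

locale orlicz =
  fixes p q s0 s :: real and f g :: "real \<Rightarrow> real"
  assumes p1: "1 < p" and pq: "p \<le> q" and s0: "0 < s0" and s0_le: "s0 \<le> s" and s1: "s < 1"
    and f_measurable [measurable]: "f \<in> borel_measurable borel"
    and g_measurable [measurable]: "g \<in> borel_measurable borel"
    and f_0: "f 0 = 0" and g_0: "g 0 = 0" and f_pos: "\<And>t. 0 < t \<Longrightarrow> 0 < f t"
    and f_mono: "\<And>a b. 0 \<le> a \<Longrightarrow> a \<le> b \<Longrightarrow> f a \<le> f b"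
    and g_mono: "\<And>a b. 0 \<le> a \<Longrightarrow> a \<le> b \<Longrightarrow> g a \<le> g b"
    and f_diff: "\<And>a b. 0 \<le> a \<Longrightarrow> a \<le> b \<Longrightarrow> f b - f a \<le> g b * (b - a)"
    and gf_lower: "\<And>t. 0 \<le> t \<Longrightarrow> p * f t \<le> t * g t"
    and gf_upper: "\<And>t. 0 \<le> t \<Longrightarrow> t * g t \<le> q * f t"
    and f_scale_upper: "\<And>l t. 1 \<le> l \<Longrightarrow> 0 \<le> t \<Longrightarrow> f (l * t) \<le> l powr q * f t"
    and f_scale_lower: "\<And>l t. 1 \<le> l \<Longrightarrow> 0 \<le> t \<Longrightarrow> l powr p * f t \<le> f (l * t)"
begin

lemma s_pos: "0 < s" and q1: "1 < q" and s0_lt1: "s0 < 1"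
  using s0 s0_le s1 p1 pq by auto

lemma f_nonneg: "0 \<le> t \<Longrightarrow> 0 \<le> f t"
  using f_mono[of 0 t] f_0 by simp

lemma g_nonneg: "0 \<le> t \<Longrightarrow> 0 \<le> g t"
  using g_mono[of 0 t] g_0 by simp

lemma g_pos: "0 < t \<Longrightarrow> 0 < g t"
  using gf_lower[of t] f_pos[of t] p1 by (smt (verit, best) mult_pos_pos zero_less_mult_pos)

text \<open>The scaling laws of \<open>f\<close> pass to \<open>g\<close> through the comparison of
  \<open>t * g t\<close> with \<open>f t\<close>, at the price of a factor \<open>q\<close>.\<close>

lemma g_scale_upper:
  assumes "1 \<le> l" "0 \<le> t" shows "g (l * t) \<le> q * l powr q * g t"
proof (cases "t = 0")
  case False
  with assms have t: "0 < t" by simp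
  have "t * g (l * t) \<le> l * t * g (l * t)"
    using assms t g_nonneg[of "l * t"] by (intro mult_right_mono) auto
  also have "\<dots> \<le> q * f (l * t)" using assms by (intro gf_upper) auto
  also have "\<dots> \<le> q * (l powr q * f t)" using assms q1 by (intro mult_left_mono f_scale_upper) auto
  also have "\<dots> \<le> q * (l powr q * (t * g t))"
  proof -
    have "f t \<le> p * f t" using p1 f_nonneg[of t] t by (simp add: mult_le_cancel_right1)
    then show ?thesis using gf_lower[of t] t q1 by (intro mult_left_mono) auto
  qed
  finally have "t * g (l * t) \<le> t * (q * l powr q * g t)" by (simp add: mult_ac)
  then show ?thesis using t by simp
qed (simp add: g_0)

lemma g_scale_lower:
  assumes "1 \<le> l" "0 \<le> t" shows "l powr (p - 1) * g t \<le> q * g (l * t)"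
proof (cases "t = 0")
  case False
  with assms have t: "0 < t" by simp
  have "l powr p * (t * g t) \<le> l powr p * (q * f t)"
    using gf_upper[of t] t by (intro mult_left_mono) auto
  also have "\<dots> \<le> q * f (l * t)" using f_scale_lower[OF assms] q1 by (simp add: mult.left_commute)
  also have "f (l * t) \<le> p * f (l * t)"
    using p1 f_nonneg[of "l * t"] t assms by (simp add: mult_le_cancel_right1)
  also have "\<dots> \<le> l * t * g (l * t)" using gf_lower[of "l * t"] assms by simp
  finally have "l powr p * (t * g t) \<le> q * (l * t * g (l * t))" using q1 by simp
  moreover have "l powr p = l * l powr (p - 1)"
    using assms by (simp add: powr_mult_base)
  ultimately have "(l * t) * (l powr (p - 1) * g t) \<le> (l * t) * (q * g (l * t))"
    by (simp add: mult_ac)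
  then show ?thesis using t assms by (simp add: mult_le_cancel_left)
qed (simp add: g_0)

text \<open>Young's inequality without the conjugate function: replacing the smaller of
  \<open>a\<close> and \<open>t\<close> by the larger one leaves a product \<open>t * g t\<close>,
  which is at most \<open>q * f t\<close>.\<close>

lemma g_young:
  assumes "0 \<le> a" "0 \<le> t" shows "g a * t \<le> q * (f a + f t)"
proof (cases "t \<le> a")
  case True
  have "g a * t \<le> a * g a" using assms True g_nonneg[of a] by (simp add: mult.commute mult_right_mono)
  also have "\<dots> \<le> q * f a" using assms by (intro gf_upper)
  finally show ?thesis using assms q1 f_nonneg[of t] by (simp add: distrib_left add_increasing2)
next
  case False
  have "g a * t \<le> t * g t" using assms False g_mono[of a t] by (simp add: mult.commute mult_right_mono)
  also have "\<dots> \<le> q * f t" using assms by (intro gf_upper)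
  finally show ?thesis using assms q1 f_nonneg[of a] by (simp add: distrib_left add_increasing)
qed

text \<open>This is where \<open>p > 1\<close> produces a small factor. With
  \<open>t = l * a\<close> and \<open>l \<ge> \<mu>\<close>, the product is \<open>l\<close> times
  \<open>a * g a\<close>, hence at most \<open>q * l * f a\<close>, while \<open>f t\<close> is at
  least \<open>l powr p * f a\<close>.\<close>

lemma g_young_large:
  assumes "0 \<le> a" "1 \<le> \<mu>" "\<mu> * a \<le> t" shows "g a * t \<le> q * \<mu> powr (1 - p) * f t"
proof (cases "a = 0")
  case True
  then show ?thesis using assms q1 f_nonneg[of t] by (simp add: g_0)
next
  case False
  with assms have a: "0 < a" by simp
  define l where "l = t / a"
  have t: "t = l * a" and l: "\<mu> \<le> l" using a assms by (auto simp: l_def field_simps)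
  have "l powr p * (a * g a) \<le> l powr p * (q * f a)"
    using gf_upper[of a] a by (intro mult_left_mono) auto
  also have "\<dots> \<le> q * f t"
    using f_scale_lower[of l a] l assms q1 unfolding t by (simp add: mult.left_commute)
  finally have *: "l powr p * (a * g a) \<le> q * f t" .
  have "g a * t = l powr (1 - p) * (l powr p * (a * g a))"
    using l assms a by (simp add: t mult_ac powr_diff)
  also have "\<dots> \<le> l powr (1 - p) * (q * f t)" using * by (intro mult_left_mono) auto
  also have "\<dots> \<le> \<mu> powr (1 - p) * (q * f t)"
  proof (intro mult_right_mono powr_mono2')
    have "0 \<le> \<mu> * a" using assms by simp
    then have "0 \<le> t" using assms by linarith
    then show "0 \<le> q * f t" using q1 f_nonneg by simp
  qed (use assms l p1 in auto)
  finally show ?thesis by (simp add: mult_ac)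
qed

lemma g_add:
  assumes "0 \<le> a" "0 \<le> b" shows "g (a + b) \<le> q * 2 powr q * (g a + g b)"
proof -
  have "g (a + b) \<le> g (2 * max a b)" using assms by (intro g_mono) auto
  also have "\<dots> \<le> q * 2 powr q * g (max a b)" using assms by (intro g_scale_upper) auto
  also have "\<dots> \<le> q * 2 powr q * (g a + g b)"
    using assms g_nonneg[of a] g_nonneg[of b] q1 by (intro mult_left_mono) (auto simp: max_def)
  finally show ?thesis .
qed

lemma f_abs_diff:
  assumes "0 \<le> a" "0 \<le> b" shows "\<bar>f a - f b\<bar> \<le> g (max a b) * \<bar>a - b\<bar>"
proof (cases "a \<le> b")
  case True
  then show ?thesis using f_diff[OF assms(1) True] f_mono[OF assms(1) True] by (simp add: max_def)
next
  case False
  then have "b \<le> a" by simp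
  then show ?thesis using f_diff[OF assms(2), of a] f_mono[OF assms(2), of a] by (simp add: max_def)
qed

end

subsection \<open>The Caccioppoli inequality\<close>

text \<open>This is \<open>modular_W\<close> on a ball, over \<open>lborel\<close> instead of the
  completed measure: for Borel functions Tonelli's theorem applies directly. The passage is
  \<open>modular_W_eq_energy\<close>.\<close>

definition energy :: "real \<Rightarrow> (real \<Rightarrow> real) \<Rightarrow> 'a::euclidean_space \<Rightarrow> real \<Rightarrow> ('a \<Rightarrow> real) \<Rightarrow> ennreal" where
  "energy s f x r v = ennreal (1 - s) *
     double_int (ball x r) (\<lambda>a b. ennreal (f (\<bar>v a - v b\<bar> / norm (a - b) powr s) / norm (a - b) ^ DIM('a)))"

definition tail_int :: "real \<Rightarrow> (real \<Rightarrow> real) \<Rightarrow> 'a::euclidean_space \<Rightarrow> 'a set \<Rightarrow> ('a \<Rightarrow> real) \<Rightarrow> ennreal" where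
  "tail_int s g x A v = ennreal (1 - s) *
     (\<integral>\<^sup>+y\<in>A. ennreal (g (v y / norm (y - x) powr s) / norm (y - x) powr (real DIM('a) + s)) \<partial>lborel)"

definition caccioppoli_rhs :: "real \<Rightarrow> real \<Rightarrow> real \<Rightarrow> (real \<Rightarrow> real) \<Rightarrow> (real \<Rightarrow> real) \<Rightarrow> 'a::euclidean_space \<Rightarrow>
    real \<Rightarrow> real \<Rightarrow> ('a \<Rightarrow> real) \<Rightarrow> ennreal" where
  "caccioppoli_rhs q c s f g x r R v =
     ennreal (c * (R / (R - r)) powr q) * (\<integral>\<^sup>+y\<in>ball x R. ennreal (f (v y / R powr s)) \<partial>lborel)
     + ennreal (c * (R / (R - r)) powr (real DIM('a) + s * q)) * (\<integral>\<^sup>+y\<in>ball x R. ennreal (v y) \<partial>lborel)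
       * tail_int s g x (- ball x r) v"

text \<open>Up to a power of \<open>R\<close>, \<open>kernel_const\<close> is \<open>1 - s\<close>
  times the bound for the near kernel on a ball of radius \<open>2 * R\<close>: the quotient
  \<open>(1 - s) / \<alpha>\<close> equals \<open>1 / s0\<close>, and another factor 2 bounds
  \<open>2 powr \<alpha>\<close>. In \<open>energy_const\<close> the factor \<open>q\<close> comes
  from Young's inequality and the 2 from the two symmetric kernel terms. For
  \<open>gain_const\<close> this is divided by half the volume of a ball of radius
  \<open>T / 2\<close>.\<close>

definition kernel_const :: "real \<Rightarrow> nat \<Rightarrow> real" where
  "kernel_const s0 N = 4 * 2 ^ N * unit_ball_vol N / s0"

definition energy_const :: "real \<Rightarrow> real \<Rightarrow> nat \<Rightarrow> real" where
  "energy_const q s0 N = 2 * q * (kernel_const s0 N + 1)"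

definition gain_const :: "real \<Rightarrow> real \<Rightarrow> nat \<Rightarrow> real" where
  "gain_const q s0 N = 8 * 2 ^ N / unit_ball_vol N * energy_const q s0 N"

context orlicz begin

text \<open>Lowering the order from \<open>s\<close> to \<open>\<sigma> = s - \<alpha>\<close> makes room for Young's inequality.  With \<open>\<alpha>\<close> proportional
  to \<open>1 - s\<close> both \<open>(1 - s) / \<alpha>\<close>, which comes from integrating the kernel \<open>|x - y| powr (\<alpha> - d)\<close>, and
  \<open>(1 - \<sigma>) / (1 - s)\<close> are bounded.\<close>

definition \<alpha> where "\<alpha> = s0 * (1 - s)"
definition \<sigma> where "\<sigma> = s - \<alpha>"

lemma \<alpha>: "0 < \<alpha>" "\<alpha> \<le> 1" "\<alpha> < s"
proof -
  have "s0 * (1 - s) < s0 * 1"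
    using s0 s_pos by (intro mult_strict_left_mono) auto
  then have "s0 * (1 - s) < s" "s0 * (1 - s) \<le> 1" using s0_le s0_lt1 by auto
  then show "0 < \<alpha>" "\<alpha> \<le> 1" "\<alpha> < s" using s0 s1 by (auto simp: \<alpha>_def)
qed

text \<open>The lower bound is \<open>s0 - s0 * (1 - s0) = s0\<^sup>2\<close>, since
  \<open>s - s0 * (1 - s)\<close> increases with \<open>s\<close>. It becomes the exponent of the
  gain, which therefore does not degenerate.\<close>

lemma \<sigma>: "0 < \<sigma>" "\<sigma> < 1" "s0\<^sup>2 \<le> \<sigma>" "1 - \<sigma> \<le> 2 * (1 - s)"
proof -
  have "s0 * (1 - s) \<le> s0 * (1 - s0)" using s0 s0_le by (intro mult_left_mono) auto
  then show "s0\<^sup>2 \<le> \<sigma>" using s0_le by (simp add: \<sigma>_def \<alpha>_def power2_eq_square algebra_simps)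
  have "s0 * (1 - s) \<le> 1 * (1 - s)" using s0_lt1 s1 by (intro mult_right_mono) auto
  then show "1 - \<sigma> \<le> 2 * (1 - s)" by (simp add: \<sigma>_def \<alpha>_def)
qed (use \<alpha> s1 in \<open>auto simp: \<sigma>_def\<close>)

text \<open>The ball lies in the ball of radius \<open>2 * R\<close> about each of its points, so
  the inner integral is bounded by the near kernel. Its divergent factor \<open>1 / \<alpha>\<close>
  is compensated by \<open>1 - s\<close>.\<close>

lemma double_int_kernel_le:
  fixes H :: "'a::euclidean_space \<Rightarrow> ennreal"
  assumes [measurable]: "H \<in> borel_measurable borel" and R: "0 < R" "r \<le> R"
  shows "ennreal (1 - s) * double_int (ball z r) (\<lambda>x y. H x * ennreal (norm (x - y) powr (\<alpha> - DIM('a))))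
    \<le> ennreal (kernel_const s0 DIM('a) * R powr \<alpha>) * (\<integral>\<^sup>+x\<in>ball z r. H x \<partial>lborel)"
proof -
  let ?N = "DIM('a)"
  define C where "C = 2 * 2 ^ ?N * unit_ball_vol ?N * (2 * R) powr \<alpha> / \<alpha>"
  have C: "(1 - s) * C \<le> kernel_const s0 ?N * R powr \<alpha>"
  proof -
    have "(2 * R) powr \<alpha> \<le> 2 * R powr \<alpha>"
      using powr_mono[of \<alpha> 1 2] \<alpha> R by (auto simp: powr_mult intro!: mult_right_mono)
    then have "2 * 2 ^ ?N * unit_ball_vol ?N * (2 * R) powr \<alpha> / s0 \<le> 2 * 2 ^ ?N * unit_ball_vol ?N * (2 * R powr \<alpha>) / s0"
      using s0 by (intro divide_right_mono mult_left_mono) auto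
    moreover have "(1 - s) * C = 2 * 2 ^ ?N * unit_ball_vol ?N * (2 * R) powr \<alpha> / s0"
      using s1 s0 by (simp add: C_def \<alpha>_def)
    ultimately show ?thesis by (simp add: kernel_const_def)
  qed
  have "0 \<le> C" using \<alpha> by (simp add: C_def)
  have inner: "(\<integral>\<^sup>+y\<in>ball z r. H x * ennreal (norm (x - y) powr (\<alpha> - ?N)) \<partial>lborel) \<le> ennreal C * H x" if "x \<in> ball z r" for x
  proof -
    have "(\<integral>\<^sup>+y\<in>ball z r. H x * ennreal (norm (x - y) powr (\<alpha> - ?N)) \<partial>lborel)
      = H x * (\<integral>\<^sup>+y\<in>ball z r. ennreal (norm (x - y) powr (\<alpha> - ?N)) \<partial>lborel)"
      unfolding mult.assoc by (rule nn_integral_cmult) measurable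
    also have "\<dots> \<le> H x * ennreal C"
    proof (rule mult_left_mono)
      have "(\<integral>\<^sup>+y\<in>ball z r. ennreal (norm (x - y) powr (\<alpha> - ?N)) \<partial>lborel)
         \<le> (\<integral>\<^sup>+y\<in>ball x (2 * R). ennreal (norm (x - y) powr (\<alpha> - ?N)) \<partial>lborel)"
      proof (rule nn_integral_mono)
        fix y
        have "y \<in> ball x (2 * R)" if "y \<in> ball z r"
          using that \<open>x \<in> ball z r\<close> R dist_triangle[of x y z] by (simp add: dist_commute)
        then show "ennreal (norm (x - y) powr (\<alpha> - ?N)) * indicator (ball z r) y \<le> ennreal (norm (x - y) powr (\<alpha> - ?N)) * indicator (ball x (2 * R)) y"
          by (auto simp: indicator_def)
      qed
      also have "\<dots> \<le> ennreal C"
        unfolding C_def using nn_integral_near_kernel[OF \<alpha>(1,2), of "2 * R" x] R by simp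
      finally show "(\<integral>\<^sup>+y\<in>ball z r. ennreal (norm (x - y) powr (\<alpha> - ?N)) \<partial>lborel) \<le> ennreal C" .
    qed simp
    finally show ?thesis by (simp add: mult.commute)
  qed
  have "double_int (ball z r) (\<lambda>x y. H x * ennreal (norm (x - y) powr (\<alpha> - ?N)))
     \<le> (\<integral>\<^sup>+x. ennreal C * (H x * indicator (ball z r) x) \<partial>lborel)"
    unfolding double_int_def using inner by (intro nn_integral_mono) (auto simp: indicator_def)
  also have "\<dots> = ennreal C * (\<integral>\<^sup>+x\<in>ball z r. H x \<partial>lborel)"
    by (rule nn_integral_cmult) measurable
  finally have "ennreal (1 - s) * double_int (ball z r) (\<lambda>x y. H x * ennreal (norm (x - y) powr (\<alpha> - ?N)))
      \<le> ennreal (1 - s) * (ennreal C * (\<integral>\<^sup>+x\<in>ball z r. H x \<partial>lborel))"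
    by (rule mult_left_mono) simp
  also have "\<dots> = ennreal ((1 - s) * C) * (\<integral>\<^sup>+x\<in>ball z r. H x \<partial>lborel)"
    using s1 \<open>0 \<le> C\<close> by (simp add: mult.assoc[symmetric] ennreal_mult[symmetric])
  also have "\<dots> \<le> ennreal (kernel_const s0 ?N * R powr \<alpha>) * (\<integral>\<^sup>+x\<in>ball z r. H x \<partial>lborel)"
    using C by (intro mult_right_mono ennreal_leI) auto
  finally show ?thesis .
qed

text \<open>The surplus \<open>\<alpha>\<close> in the exponent is bounded on a ball, so the
  integrable kernel is also controlled by the kernel of the energy.\<close>

lemma norm_kernel_split:
  fixes x y :: "'a::euclidean_space"
  assumes "x \<in> ball z r" "y \<in> ball z r" "r \<le> R"
  shows "norm (x - y) powr (\<alpha> - DIM('a)) \<le> 2 * R powr \<alpha> / norm (x - y) ^ DIM('a)"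
proof (cases "x = y")
  case False
  have R: "0 < R" using assms(1,3) by (simp add: order_le_less_trans[OF zero_le_dist]) (smt (verit) zero_le_dist)
  have "norm (x - y) \<le> 2 * R"
    using assms dist_triangle[of x y z] by (simp add: dist_commute dist_norm[of x y, symmetric])
  then have "norm (x - y) powr \<alpha> \<le> (2 * R) powr \<alpha>" using \<alpha> by (intro powr_mono2) auto
  also have "\<dots> \<le> 2 * R powr \<alpha>"
    using powr_mono[of \<alpha> 1 2] \<alpha> R by (auto simp: powr_mult intro!: mult_right_mono)
  finally show ?thesis using False by (simp add: powr_diff powr_realpow divide_right_mono)
qed (simp add: power_0_left)

text \<open>A chain rule in difference form. The increment of \<open>F\<close> is at most
  \<open>g\<close> of the larger value times the increment of \<open>w / R powr s\<close>, and
  Young's inequality splits this product. The values of \<open>f\<close> at the two points meet the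
  integrable kernel with exponent \<open>\<alpha> - d\<close>; the value at the difference quotient
  is the density of the energy.\<close>

lemma energy_compose:
  fixes w :: "'a::euclidean_space \<Rightarrow> real"
  assumes [measurable]: "w \<in> borel_measurable borel" and w: "\<And>x. 0 \<le> w x" and R: "0 < R" "r \<le> R"
  defines "F \<equiv> \<lambda>x. f (w x / R powr s)"
  shows "ennreal (1 - s) * double_int (ball z r) (\<lambda>x y. ennreal (\<bar>F x - F y\<bar> * norm (x - y) powr (- (DIM('a) + \<sigma>))))
    \<le> ennreal (energy_const q s0 DIM('a) * R powr (- \<sigma>)) * (energy s f z r w + (\<integral>\<^sup>+x\<in>ball z r. ennreal (F x) \<partial>lborel))"
proof -
  let ?N = "DIM('a)" and ?B = "ball z r"
  have [measurable]: "F \<in> borel_measurable borel" unfolding F_def by measurable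
  have F: "0 \<le> F x" for x using w by (simp add: F_def f_nonneg)
  define Q where "Q = q * R powr (- s)"
  have Q: "0 \<le> Q" using q1 by (simp add: Q_def)
  define t where "t x y = \<bar>w x - w y\<bar> / norm (x - y) powr s" for x y
  define k where "k x y = norm (x - y) powr (\<alpha> - ?N)" for x y :: 'a
  define E where "E x y = ennreal (f (t x y) / norm (x - y) ^ ?N)" for x y
  define IF where "IF = (\<integral>\<^sup>+x\<in>?B. ennreal (F x) \<partial>lborel)"
  have Em [measurable]: "(\<lambda>(x, y). E x y) \<in> borel_measurable (borel \<Otimes>\<^sub>M borel)"
    unfolding E_def t_def by measurable
  have km [measurable]: "(\<lambda>(x, y). k x y) \<in> borel_measurable (borel \<Otimes>\<^sub>M borel)"
    unfolding k_def by measurable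
  have Gm: "(\<lambda>(x, y). ennreal (F x) * ennreal (k x y)) \<in> borel_measurable (borel \<Otimes>\<^sub>M borel)"
    by measurable
  have Gm': "(\<lambda>(x, y). ennreal (F y) * ennreal (k y x)) \<in> borel_measurable (borel \<Otimes>\<^sub>M borel)"
    by measurable
  have pointwise: "ennreal (\<bar>F x - F y\<bar> * norm (x - y) powr (- (?N + \<sigma>)))
     \<le> ennreal Q * (ennreal (F x) * ennreal (k x y) + ennreal (F y) * ennreal (k y x) + ennreal (2 * R powr \<alpha>) * E x y)"
    if xy: "x \<in> ?B" "y \<in> ?B" for x y
  proof (cases "x = y")
    case False
    define h where "h = norm (x - y)"
    have h: "0 < h" using False by (simp add: h_def)
    define a where "a = w x / R powr s"
    define b where "b = w y / R powr s"
    have ab: "0 \<le> a" "0 \<le> b" using w by (auto simp: a_def b_def)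
    have t0: "0 \<le> t x y" by (simp add: t_def)
    have "\<bar>a - b\<bar> = t x y * h powr s * R powr (- s)"
    proof -
      have "a - b = (w x - w y) / R powr s" by (simp add: a_def b_def diff_divide_distrib)
      then show ?thesis using h by (simp add: t_def h_def[symmetric] powr_minus divide_inverse abs_mult)
    qed
    then have "\<bar>F x - F y\<bar> \<le> g (max a b) * t x y * (h powr s * R powr (- s))"
      using f_abs_diff[OF ab] by (simp add: F_def a_def b_def mult_ac)
    also have "\<dots> \<le> q * (f (max a b) + f (t x y)) * (h powr s * R powr (- s))"
      using ab t0 by (intro mult_right_mono g_young) auto
    also have "\<dots> \<le> q * ((F x + F y) + f (t x y)) * (h powr s * R powr (- s))"
      using q1 F[of x] F[of y] by (intro mult_right_mono mult_left_mono add_right_mono)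
        (auto simp: F_def a_def b_def max_def)
    also have "\<dots> = Q * (F x + F y + f (t x y)) * h powr s" by (simp add: Q_def mult_ac)
    finally have "\<bar>F x - F y\<bar> * h powr (- (?N + \<sigma>)) \<le> Q * (F x + F y + f (t x y)) * h powr s * h powr (- (?N + \<sigma>))"
      by (rule mult_right_mono) simp
    also have "\<dots> = Q * (F x + F y + f (t x y)) * k x y"
      by (simp add: mult.assoc powr_add[symmetric] k_def h_def \<sigma>_def)
    also have "\<dots> = Q * (F x * k x y + F y * k y x + f (t x y) * k x y)"
      by (simp add: k_def norm_minus_commute algebra_simps)
    also have "\<dots> \<le> Q * (F x * k x y + F y * k y x + f (t x y) * (2 * R powr \<alpha> / h ^ ?N))"
      unfolding k_def h_def using xy R Q t0 by (intro mult_left_mono add_left_mono norm_kernel_split f_nonneg)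
    finally have le: "\<bar>F x - F y\<bar> * h powr (- (?N + \<sigma>))
      \<le> Q * (F x * k x y + F y * k y x + (2 * R powr \<alpha>) * (f (t x y) / h ^ ?N))"
      by (simp add: mult_ac)
    have k0: "0 \<le> k x y" "0 \<le> k y x" by (auto simp: k_def)
    have ft: "0 \<le> f (t x y) / h ^ ?N" using h t0 f_nonneg by simp
    have "ennreal (Q * (F x * k x y + F y * k y x + (2 * R powr \<alpha>) * (f (t x y) / h ^ ?N)))
      = ennreal Q * (ennreal (F x) * ennreal (k x y) + ennreal (F y) * ennreal (k y x) + ennreal (2 * R powr \<alpha>) * E x y)"
      unfolding E_def h_def[symmetric] using Q F[of x] F[of y] k0 ft R
      by (simp only: ennreal_mult[symmetric] ennreal_plus[symmetric] add_nonneg_nonneg mult_nonneg_nonneg zero_le_numeral powr_ge_zero)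
    then show ?thesis using ennreal_leI[OF le] by (simp add: h_def)
  qed simp
  have "double_int ?B (\<lambda>x y. ennreal (\<bar>F x - F y\<bar> * norm (x - y) powr (- (?N + \<sigma>))))
    \<le> double_int ?B (\<lambda>x y. ennreal Q * (ennreal (F x) * ennreal (k x y) + ennreal (F y) * ennreal (k y x) + ennreal (2 * R powr \<alpha>) * E x y))"
    by (rule double_int_mono) (rule pointwise)
  also have "\<dots> = ennreal Q * double_int ?B (\<lambda>x y. ennreal (F x) * ennreal (k x y) + ennreal (F y) * ennreal (k y x) + ennreal (2 * R powr \<alpha>) * E x y)"
    by (intro double_int_cmult) measurable
  also have "double_int ?B (\<lambda>x y. ennreal (F x) * ennreal (k x y) + ennreal (F y) * ennreal (k y x) + ennreal (2 * R powr \<alpha>) * E x y)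
     = double_int ?B (\<lambda>x y. ennreal (F x) * ennreal (k x y) + ennreal (F y) * ennreal (k y x)) + double_int ?B (\<lambda>x y. ennreal (2 * R powr \<alpha>) * E x y)"
    by (intro double_int_add) measurable
  also have "double_int ?B (\<lambda>x y. ennreal (2 * R powr \<alpha>) * E x y) = ennreal (2 * R powr \<alpha>) * double_int ?B E"
    by (intro double_int_cmult) measurable
  also have "double_int ?B (\<lambda>x y. ennreal (F x) * ennreal (k x y) + ennreal (F y) * ennreal (k y x))
     = double_int ?B (\<lambda>x y. ennreal (F x) * ennreal (k x y)) + double_int ?B (\<lambda>x y. ennreal (F y) * ennreal (k y x))"
    by (intro double_int_add) measurable
  also have "double_int ?B (\<lambda>x y. ennreal (F y) * ennreal (k y x)) = double_int ?B (\<lambda>x y. ennreal (F x) * ennreal (k x y))"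
    by (rule double_int_swap[OF _ Gm]) simp
  finally have "ennreal (1 - s) * double_int ?B (\<lambda>x y. ennreal (\<bar>F x - F y\<bar> * norm (x - y) powr (- (?N + \<sigma>))))
    \<le> ennreal (1 - s) * (ennreal Q * (double_int ?B (\<lambda>x y. ennreal (F x) * ennreal (k x y)) + double_int ?B (\<lambda>x y. ennreal (F x) * ennreal (k x y)) + ennreal (2 * R powr \<alpha>) * double_int ?B E))"
    by (rule mult_left_mono) simp
  also have "\<dots> = ennreal Q * (ennreal (1 - s) * double_int ?B (\<lambda>x y. ennreal (F x) * ennreal (k x y)) +
       ennreal (1 - s) * double_int ?B (\<lambda>x y. ennreal (F x) * ennreal (k x y)) + ennreal (2 * R powr \<alpha>) * (ennreal (1 - s) * double_int ?B E))"
    by (simp add: distrib_left mult_ac)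
  also have "\<dots> \<le> ennreal Q * (ennreal (kernel_const s0 ?N * R powr \<alpha>) * IF + ennreal (kernel_const s0 ?N * R powr \<alpha>) * IF
      + ennreal (2 * R powr \<alpha>) * energy s f z r w)"
  proof -
    have "ennreal (1 - s) * double_int ?B (\<lambda>x y. ennreal (F x) * ennreal (k x y)) \<le> ennreal (kernel_const s0 ?N * R powr \<alpha>) * IF"
      unfolding k_def IF_def using R by (intro double_int_kernel_le) auto
    moreover have "ennreal (1 - s) * double_int ?B E = energy s f z r w" by (simp add: energy_def E_def[abs_def] t_def)
    ultimately show ?thesis by (intro mult_left_mono add_mono) auto
  qed
  also have "\<dots> \<le> ennreal Q * (ennreal (2 * (kernel_const s0 ?N + 1) * R powr \<alpha>) * (energy s f z r w + IF))"
  proof (intro mult_left_mono)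
    have kc: "0 \<le> kernel_const s0 ?N" using s0 by (simp add: kernel_const_def)
    have "ennreal (kernel_const s0 ?N * R powr \<alpha>) * IF + ennreal (kernel_const s0 ?N * R powr \<alpha>) * IF = ennreal (2 * kernel_const s0 ?N * R powr \<alpha>) * IF"
      using kc by (simp add: distrib_right[symmetric] ennreal_plus[symmetric] del: ennreal_plus)
    also have "\<dots> \<le> ennreal (2 * (kernel_const s0 ?N + 1) * R powr \<alpha>) * IF"
      by (intro mult_right_mono ennreal_leI) auto
    finally have 1: "ennreal (kernel_const s0 ?N * R powr \<alpha>) * IF + ennreal (kernel_const s0 ?N * R powr \<alpha>) * IF \<le> \<dots>" .
    have 2: "ennreal (2 * R powr \<alpha>) * energy s f z r w \<le> ennreal (2 * (kernel_const s0 ?N + 1) * R powr \<alpha>) * energy s f z r w"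
      using kc by (intro mult_right_mono ennreal_leI) auto
    show "ennreal (kernel_const s0 ?N * R powr \<alpha>) * IF + ennreal (kernel_const s0 ?N * R powr \<alpha>) * IF
      + ennreal (2 * R powr \<alpha>) * energy s f z r w \<le> ennreal (2 * (kernel_const s0 ?N + 1) * R powr \<alpha>) * (energy s f z r w + IF)"
      using add_mono[OF 1 2] by (simp add: distrib_left add.commute)
  qed simp
  also have "\<dots> = ennreal (energy_const q s0 ?N * R powr (- \<sigma>)) * (energy s f z r w + IF)"
  proof -
    have "Q * (2 * (kernel_const s0 ?N + 1) * R powr \<alpha>) = energy_const q s0 ?N * (R powr (- s) * R powr \<alpha>)"
      by (simp add: Q_def energy_const_def mult_ac)
    also have "R powr (- s) * R powr \<alpha> = R powr (- \<sigma>)" by (simp add: powr_add[symmetric] \<sigma>_def)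
    finally show ?thesis using Q s0 by (simp add: mult.assoc[symmetric] ennreal_mult[symmetric] kernel_const_def)
  qed
  finally show ?thesis unfolding IF_def .
qed

text \<open>The smallness of the support fixes an admissible scale \<open>T\<close>, and smaller
  \<open>T\<close> means a smaller factor in front of the energy. The powers balance because
  \<open>T powr (d + \<sigma>)\<close> from the kernel is divided by the volume of order
  \<open>T ^ d\<close>; finally \<open>\<sigma>\<close> is lowered to \<open>s0\<^sup>2\<close>, as
  \<open>T \<le> R\<close>.\<close>

lemma gain:
  fixes w :: "'a::euclidean_space \<Rightarrow> real"
  assumes [measurable]: "w \<in> borel_measurable borel" and w: "\<And>x. 0 \<le> w x" and R: "0 < R" "r \<le> R"
    and T: "0 < T" "T \<le> r"
    and small: "emeasure lborel {y \<in> ball z r. 0 < w y} \<le> ennreal (unit_ball_vol DIM('a) * (T / 2) ^ DIM('a) / 2)"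
  defines "F \<equiv> \<lambda>x. f (w x / R powr s)"
  shows "(\<integral>\<^sup>+x\<in>ball z r. ennreal (F x) \<partial>lborel) \<le> ennreal (gain_const q s0 DIM('a) * (T / R) powr s0\<^sup>2) *
     (energy s f z r w + (\<integral>\<^sup>+x\<in>ball z r. ennreal (F x) \<partial>lborel))"
proof -
  let ?N = "DIM('a)" and ?B = "ball z r"
  have [measurable]: "F \<in> borel_measurable borel" unfolding F_def by measurable
  have F: "0 \<le> F x" for x using w by (simp add: F_def f_nonneg)
  have Fw: "0 < w y" if "0 < F y" for y
  proof (rule ccontr)
    assume "\<not> 0 < w y"
    then have "w y = 0" using w[of y] by linarith
    with that show False by (simp add: F_def f_0)
  qed
  define D where "D = double_int ?B (\<lambda>x y. ennreal (\<bar>F x - F y\<bar> * norm (x - y) powr (- (?N + \<sigma>))))"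
  define Z where "Z = energy s f z r w + (\<integral>\<^sup>+x\<in>?B. ennreal (F x) \<partial>lborel)"
  define v where "v = unit_ball_vol ?N * (T / 2) ^ ?N / 2"
  have v: "0 < v" using T by (simp add: v_def)
  have ec: "0 \<le> energy_const q s0 ?N" using s0 q1 by (simp add: energy_const_def kernel_const_def)
  have "ennreal v * (\<integral>\<^sup>+x\<in>?B. ennreal (F x) \<partial>lborel)
     \<le> double_int ?B (\<lambda>x y. ennreal \<bar>F x - F y\<bar> * indicator {..<T} (norm (x - y)))"
    unfolding v_def
  proof (rule nn_integral_le_double_int_diff)
    have "emeasure lborel {y \<in> ?B. 0 < F y} \<le> emeasure lborel {y \<in> ?B. 0 < w y}"
      using Fw by (intro emeasure_mono) auto
    with small show "emeasure lborel {y \<in> ?B. 0 < F y} \<le> ennreal (unit_ball_vol ?N * (T / 2) ^ ?N / 2)" by simp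
  qed (use F T in auto)
  also have "\<dots> \<le> ennreal (2 * T powr (?N + \<sigma>) * (1 - \<sigma>)) * D"
    unfolding D_def by (rule double_int_diff_le_kernel) (use \<sigma> T in auto)
  also have "\<dots> \<le> ennreal (4 * T powr (?N + \<sigma>) * (1 - s)) * D"
    using \<sigma> T by (intro mult_right_mono ennreal_leI) (auto simp: mult_left_mono)
  also have "\<dots> = ennreal (4 * T powr (?N + \<sigma>)) * (ennreal (1 - s) * D)"
    using s1 by (simp add: mult.assoc[symmetric] ennreal_mult[symmetric])
  also have "\<dots> \<le> ennreal (4 * T powr (?N + \<sigma>)) * (ennreal (energy_const q s0 ?N * R powr (- \<sigma>)) * Z)"
    unfolding D_def Z_def F_def by (intro mult_left_mono energy_compose) (use w R in auto)
  also have "\<dots> = ennreal (4 * T powr (?N + \<sigma>) * (energy_const q s0 ?N * R powr (- \<sigma>))) * Z"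
    using ec by (simp add: mult.assoc[symmetric] ennreal_mult[symmetric])
  finally have "ennreal (1 / v) * (ennreal v * (\<integral>\<^sup>+x\<in>?B. ennreal (F x) \<partial>lborel))
    \<le> ennreal (1 / v) * (ennreal (4 * T powr (?N + \<sigma>) * (energy_const q s0 ?N * R powr (- \<sigma>))) * Z)"
    by (rule mult_left_mono) simp
  moreover have "ennreal (1 / v) * (ennreal v * X) = X" for X
    using v by (simp add: mult.assoc[symmetric] ennreal_mult[symmetric])
  moreover have "ennreal (1 / v) * (ennreal (4 * T powr (?N + \<sigma>) * (energy_const q s0 ?N * R powr (- \<sigma>))) * Z)
     = ennreal (gain_const q s0 ?N * (T / R) powr \<sigma>) * Z"
  proof -
    have "1 / v * (4 * T powr (?N + \<sigma>) * (energy_const q s0 ?N * R powr (- \<sigma>))) = gain_const q s0 ?N * (T / R) powr \<sigma>"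
      using T R by (simp add: v_def gain_const_def powr_add powr_realpow powr_minus powr_divide power_divide field_simps)
    then show ?thesis using v ec by (simp add: mult.assoc[symmetric] ennreal_mult[symmetric])
  qed
  ultimately have "(\<integral>\<^sup>+x\<in>?B. ennreal (F x) \<partial>lborel) \<le> ennreal (gain_const q s0 ?N * (T / R) powr \<sigma>) * Z" by simp
  also have "\<dots> \<le> ennreal (gain_const q s0 ?N * (T / R) powr s0\<^sup>2) * Z"
    using ec T R \<sigma> by (intro mult_right_mono ennreal_leI mult_left_mono powr_mono') (auto simp: gain_const_def)
  finally show ?thesis unfolding Z_def .
qed


section \<open>The De Giorgi iteration\<close>

lemma f_rescale:
  assumes "0 \<le> t" "0 < \<rho>" "\<rho> \<le> R" "R \<le> 2 * \<rho>"
  shows "f (t / \<rho> powr s) \<le> 2 powr q * f (t / R powr s)"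
proof -
  have "(R / \<rho>) powr s \<le> 2 powr s" using assms s_pos by (intro powr_mono2) (auto simp: field_simps)
  also have "\<dots> \<le> 2 powr 1" using s1 by (intro powr_mono) auto
  finally have le: "(R / \<rho>) powr s \<le> 2" by simp
  have "t / \<rho> powr s = (R / \<rho>) powr s * (t / R powr s)"
    using assms by (simp add: powr_divide)
  also have "\<dots> \<le> 2 * (t / R powr s)" using assms le by (intro mult_right_mono) auto
  finally have "f (t / \<rho> powr s) \<le> f (2 * (t / R powr s))" using assms by (intro f_mono) auto
  also have "\<dots> \<le> 2 powr q * f (t / R powr s)" using assms by (intro f_scale_upper) auto
  finally show ?thesis .
qed

lemma tail_int_mono:
  assumes "\<And>y. y \<in> A \<Longrightarrow> 0 \<le> v y \<and> v y \<le> v' y" "A \<subseteq> A'"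
  shows "tail_int s g x A v \<le> tail_int s g x A' v'"
  unfolding tail_int_def using assms
  by (intro mult_left_mono nn_integral_mono)
     (auto simp: indicator_def intro!: ennreal_leI divide_right_mono g_mono)

text \<open>Where a function exceeds a level by at least \<open>h\<close>, its modular pays for both
  the linear quantity \<open>t * g m\<close> in the nonlocal term and the constant
  \<open>f m\<close>, at the price of a power of \<open>m / h\<close>.\<close>

lemma excess_le:
  assumes m: "0 < m" and h: "0 < h" "h \<le> m" and t: "h \<le> t"
  shows "t * g m \<le> q\<^sup>2 * (m / h) powr q * f t" and "f m \<le> (m / h) powr q * f h"
proof -
  have mh: "1 \<le> m / h" "m / h * h = m" using assms by auto
  have "g m \<le> q * (m / h) powr q * g h" using g_scale_upper[of "m / h" h] mh h by simp
  also have "\<dots> \<le> q * (m / h) powr q * g t" using q1 h t by (intro mult_left_mono g_mono) auto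
  finally have "t * g m \<le> t * (q * (m / h) powr q * g t)" using h t by (intro mult_left_mono) auto
  also have "\<dots> = q * (m / h) powr q * (t * g t)" by simp
  also have "\<dots> \<le> q * (m / h) powr q * (q * f t)" using q1 h t by (intro mult_left_mono gf_upper) auto
  finally show "t * g m \<le> q\<^sup>2 * (m / h) powr q * f t" by (simp add: power2_eq_square mult_ac)
  show "f m \<le> (m / h) powr q * f h" using f_scale_upper[of "m / h" h] mh h by simp
qed

definition step_const :: "real \<Rightarrow> real \<Rightarrow> nat \<Rightarrow> real" where
  "step_const c K N = gain_const q s0 N * (c * (2 powr q + K * q\<^sup>2) + 1)"

text \<open>Raising the level by \<open>h\<close> and shrinking the radius bounds the energy of the
  new truncation by the old integral, and bounds the measure of its support as well. Then
  \<open>gain\<close> applies at the scale \<open>T\<close>. The single number \<open>a\<close>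
  dominates both the ratio of the radii and \<open>M / h\<close>, so all losses are powers of
  \<open>a\<close>.\<close>

lemma de_giorgi_step:
  fixes v :: "'a::euclidean_space \<Rightarrow> real"
  assumes [measurable]: "v \<in> borel_measurable borel"
    and R: "0 < R" "3 * R / 4 \<le> r" "r < \<rho>" "\<rho> \<le> R" and a: "\<rho> / (\<rho> - r) \<le> a"
    and h: "0 < h" "h \<le> M" "M \<le> a * h" and c: "0 < c" "0 < K"
    and cacc: "energy s f x r (\<lambda>y. max (v y - (k + h)) 0) \<le> caccioppoli_rhs q c s f g x r \<rho> (\<lambda>y. max (v y - (k + h)) 0)"
    and tail: "tail_int s g x (- ball x r) (\<lambda>y. max (v y - (k + h)) 0) \<le> ennreal (K * R powr (- s) * g (M / R powr s))"
    and Y: "(\<integral>\<^sup>+y\<in>ball x \<rho>. ennreal (f (max (v y - k) 0 / R powr s)) \<partial>lborel) \<le> ennreal Y" "0 \<le> Y"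
    and T: "0 < T" "T \<le> r"
    and small: "a powr q * Y \<le> f (M / R powr s) * (unit_ball_vol DIM('a) * (T / 2) ^ DIM('a) / 2)"
  shows "(\<integral>\<^sup>+y\<in>ball x r. ennreal (f (max (v y - (k + h)) 0 / R powr s)) \<partial>lborel)
    \<le> ennreal (step_const c K DIM('a) * (T / R) powr s0\<^sup>2 * a powr (DIM('a) + 2 * q) * Y)"
proof -
  let ?N = "DIM('a)"
  define w where "w = (\<lambda>y. max (v y - (k + h)) 0)"
  define w0 where "w0 = (\<lambda>y. max (v y - k) 0)"
  have [measurable]: "w \<in> borel_measurable borel" "w0 \<in> borel_measurable borel"
    unfolding w_def w0_def by measurable
  have w: "0 \<le> w y" "w y \<le> w0 y" "0 < w y \<Longrightarrow> h \<le> w0 y" for y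
    using h by (auto simp: w_def w0_def)
  define m where "m = M / R powr s"
  define h' where "h' = h / R powr s"
  have Rs: "0 < R powr s" using R by simp
  have m: "0 < m" "0 < h'" "h' \<le> m" "m / h' = M / h" using h Rs by (auto simp: m_def h'_def divide_right_mono)
  have r: "0 < r" "0 < \<rho>" using R by auto
  have a1: "1 \<le> a"
  proof -
    have "1 \<le> \<rho> / (\<rho> - r)" using R r by simp
    with a show ?thesis by linarith
  qed
  have Mh: "(M / h) powr q \<le> a powr q" using h q1 by (intro powr_mono2) (auto simp: field_simps)
  have Q0: "0 \<le> gain_const q s0 ?N" using q1 s0 by (simp add: gain_const_def energy_const_def kernel_const_def)
  have f0: "0 \<le> f (w0 y / R powr s)" for y using w(1,2)[of y] Rs by (intro f_nonneg) auto
  have term1: "(\<integral>\<^sup>+y\<in>ball x \<rho>. ennreal (f (w y / \<rho> powr s)) \<partial>lborel) \<le> ennreal (2 powr q * Y)"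
  proof -
    have "(\<integral>\<^sup>+y\<in>ball x \<rho>. ennreal (f (w y / \<rho> powr s)) \<partial>lborel)
      \<le> (\<integral>\<^sup>+y. ennreal (2 powr q) * (ennreal (f (w0 y / R powr s)) * indicator (ball x \<rho>) y) \<partial>lborel)"
    proof (rule nn_integral_mono)
      fix y
      have "f (w y / \<rho> powr s) \<le> f (w0 y / \<rho> powr s)" using w(1,2)[of y] r by (intro f_mono divide_right_mono) auto
      also have "\<dots> \<le> 2 powr q * f (w0 y / R powr s)" using w(1,2)[of y] r R by (intro f_rescale) auto
      finally show "ennreal (f (w y / \<rho> powr s)) * indicator (ball x \<rho>) y \<le> ennreal (2 powr q) * (ennreal (f (w0 y / R powr s)) * indicator (ball x \<rho>) y)"
        using f0[of y] by (auto simp: indicator_def ennreal_mult[symmetric] intro!: ennreal_leI)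
    qed
    also have "\<dots> = ennreal (2 powr q) * (\<integral>\<^sup>+y\<in>ball x \<rho>. ennreal (f (w0 y / R powr s)) \<partial>lborel)"
      by (rule nn_integral_cmult) measurable
    also have "\<dots> \<le> ennreal (2 powr q) * ennreal Y" using Y unfolding w0_def by (intro mult_left_mono) auto
    finally show ?thesis using Y by (simp add: ennreal_mult)
  qed
  \<comment> \<open>Inserting the tail bound turns the product into one integral of
    \<open>w y\<close> times a constant. Where \<open>w y > 0\<close> the lower truncation
    \<open>w0 y\<close> is at least \<open>h\<close>, so \<open>excess_le\<close> compares the
    integrand with \<open>f (w0 y / R powr s)\<close>.\<close>
  have term2: "(\<integral>\<^sup>+y\<in>ball x \<rho>. ennreal (w y) \<partial>lborel) * tail_int s g x (- ball x r) w \<le> ennreal (K * q\<^sup>2 * a powr q * Y)"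
  proof -
    have "(\<integral>\<^sup>+y\<in>ball x \<rho>. ennreal (w y) \<partial>lborel) * tail_int s g x (- ball x r) w
      \<le> (\<integral>\<^sup>+y\<in>ball x \<rho>. ennreal (w y) \<partial>lborel) * ennreal (K * R powr (- s) * g m)"
      using tail unfolding w_def m_def by (intro mult_left_mono) auto
    also have "\<dots> = (\<integral>\<^sup>+y. (ennreal (w y) * indicator (ball x \<rho>) y) * ennreal (K * R powr (- s) * g m) \<partial>lborel)"
      by (rule nn_integral_multc[symmetric]) measurable
    also have "\<dots> \<le> (\<integral>\<^sup>+y. ennreal (K * q\<^sup>2 * a powr q) * (ennreal (f (w0 y / R powr s)) * indicator (ball x \<rho>) y) \<partial>lborel)"
    proof (rule nn_integral_mono)
      fix y
      have "w y * (K * R powr (- s) * g m) \<le> K * q\<^sup>2 * a powr q * f (w0 y / R powr s)"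
      proof (cases "0 < w y")
        case True
        have t: "h' \<le> w0 y / R powr s" using w(3)[OF True] Rs by (simp add: h'_def divide_right_mono)
        have "w y * (K * R powr (- s) * g m) \<le> w0 y * (K * R powr (- s) * g m)"
          using w(2) c m g_nonneg by (intro mult_right_mono) auto
        also have "\<dots> = K * (w0 y / R powr s * g m)" by (simp add: powr_minus divide_inverse mult_ac)
        also have "\<dots> \<le> K * (q\<^sup>2 * (M / h) powr q * f (w0 y / R powr s))"
          using excess_le(1)[OF m(1,2,3) t] c m(4) by (intro mult_left_mono) auto
        also have "\<dots> \<le> K * (q\<^sup>2 * a powr q * f (w0 y / R powr s))"
          using Mh c f0 by (intro mult_left_mono mult_right_mono) auto
        finally show ?thesis by (simp add: mult_ac)
      next
        case False
        then have "w y = 0" using w(1)[of y] by linarith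
        then show ?thesis using f0[of y] c by simp
      qed
      then show "ennreal (w y) * indicator (ball x \<rho>) y * ennreal (K * R powr (- s) * g m)
         \<le> ennreal (K * q\<^sup>2 * a powr q) * (ennreal (f (w0 y / R powr s)) * indicator (ball x \<rho>) y)"
        using f0[of y] w(1)[of y] c m g_nonneg[of m] by (auto simp: indicator_def ennreal_mult[symmetric] intro!: ennreal_leI)
    qed
    also have "\<dots> = ennreal (K * q\<^sup>2 * a powr q) * (\<integral>\<^sup>+y\<in>ball x \<rho>. ennreal (f (w0 y / R powr s)) \<partial>lborel)"
      by (rule nn_integral_cmult) measurable
    also have "\<dots> \<le> ennreal (K * q\<^sup>2 * a powr q) * ennreal Y" using Y unfolding w0_def by (intro mult_left_mono) auto
    finally show ?thesis using Y c by (simp add: ennreal_mult)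
  qed
  have energy: "energy s f x r w \<le> ennreal (c * (2 powr q + K * q\<^sup>2) * a powr (?N + 2 * q) * Y)"
  proof -
    define A1 where "A1 = c * (\<rho> / (\<rho> - r)) powr q"
    define A2 where "A2 = c * (\<rho> / (\<rho> - r)) powr (real ?N + s * q)"
    have sq: "s * q \<le> q" using s1 s_pos q1 by (simp add: mult_le_cancel_right1)
    have b1: "1 \<le> \<rho> / (\<rho> - r)" using R r by simp
    have A1: "0 \<le> A1" "A1 \<le> c * a powr (?N + 2 * q)"
    proof -
      have "(\<rho> / (\<rho> - r)) powr q \<le> a powr q" using a b1 q1 by (intro powr_mono2) auto
      also have "\<dots> \<le> a powr (?N + 2 * q)" using a1 q1 by (intro powr_mono) auto
      finally show "A1 \<le> c * a powr (?N + 2 * q)" using c by (simp add: A1_def)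
    qed (use c in \<open>simp add: A1_def\<close>)
    have A2: "0 \<le> A2" "A2 * a powr q \<le> c * a powr (?N + 2 * q)"
    proof -
      have "(\<rho> / (\<rho> - r)) powr (real ?N + s * q) \<le> a powr (real ?N + s * q)" using a b1 q1 s_pos by (intro powr_mono2) auto
      also have "\<dots> \<le> a powr (?N + q)" using a1 q1 sq by (intro powr_mono) auto
      finally have "A2 * a powr q \<le> c * a powr (?N + q) * a powr q" using c by (simp add: A2_def mult_right_mono)
      also have "\<dots> = c * a powr (?N + 2 * q)" by (simp add: mult.assoc powr_add[symmetric] add.commute)
      finally show "A2 * a powr q \<le> c * a powr (?N + 2 * q)" .
    qed (use c in \<open>simp add: A2_def\<close>)
    have "energy s f x r w \<le> ennreal A1 * (\<integral>\<^sup>+y\<in>ball x \<rho>. ennreal (f (w y / \<rho> powr s)) \<partial>lborel)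
      + ennreal A2 * ((\<integral>\<^sup>+y\<in>ball x \<rho>. ennreal (w y) \<partial>lborel) * tail_int s g x (- ball x r) w)"
      using cacc unfolding w_def caccioppoli_rhs_def A1_def A2_def by (simp add: mult.assoc)
    also have "\<dots> \<le> ennreal A1 * ennreal (2 powr q * Y) + ennreal A2 * ennreal (K * q\<^sup>2 * a powr q * Y)"
      using term1 term2 by (intro add_mono mult_left_mono) auto
    also have "\<dots> = ennreal (A1 * (2 powr q * Y) + (A2 * a powr q) * (K * q\<^sup>2 * Y))"
      using A1 A2 Y c by (simp add: ennreal_mult[symmetric] ennreal_plus[symmetric] mult_ac del: ennreal_plus)
    also have "\<dots> \<le> ennreal ((c * a powr (?N + 2 * q)) * (2 powr q * Y) + (c * a powr (?N + 2 * q)) * (K * q\<^sup>2 * Y))"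
      using A1 A2 Y c by (intro ennreal_leI add_mono mult_right_mono) auto
    finally show ?thesis by (simp add: algebra_simps)
  qed
  \<comment> \<open>Chebyshev's inequality: \<open>w y > 0\<close> forces
    \<open>w0 y \<ge> h\<close>, hence each such point contributes at least \<open>f h'\<close> to
    the old integral.\<close>
  have meas: "emeasure lborel {y \<in> ball x r. 0 < w y} \<le> ennreal (unit_ball_vol ?N * (T / 2) ^ ?N / 2)"
  proof -
    have fh: "0 < f h'" using m f_pos by simp
    have "ennreal (f h') * emeasure lborel {y \<in> ball x r. 0 < w y} = (\<integral>\<^sup>+y. ennreal (f h') * indicator {y \<in> ball x r. 0 < w y} y \<partial>lborel)"
      by (rule nn_integral_cmult_indicator[symmetric]) measurable
    also have "\<dots> \<le> (\<integral>\<^sup>+y\<in>ball x \<rho>. ennreal (f (w0 y / R powr s)) \<partial>lborel)"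
    proof (rule nn_integral_mono)
      fix y
      have "f h' \<le> f (w0 y / R powr s)" if "0 < w y"
        using w(3)[OF that] Rs m by (intro f_mono) (auto simp: h'_def divide_right_mono)
      then show "ennreal (f h') * indicator {y \<in> ball x r. 0 < w y} y \<le> ennreal (f (w0 y / R powr s)) * indicator (ball x \<rho>) y"
        using R by (auto simp: indicator_def intro: ennreal_leI)
    qed
    also have "\<dots> \<le> ennreal Y" using Y unfolding w0_def by simp
    finally have le: "ennreal (f h') * emeasure lborel {y \<in> ball x r. 0 < w y} \<le> ennreal Y" .
    have "Y \<le> f h' * (unit_ball_vol ?N * (T / 2) ^ ?N / 2)"
    proof -
      have "a powr q * Y \<le> f m * (unit_ball_vol ?N * (T / 2) ^ ?N / 2)" using small by (simp add: m_def)
      also have "\<dots> \<le> ((M / h) powr q * f h') * (unit_ball_vol ?N * (T / 2) ^ ?N / 2)"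
        using excess_le(2)[OF m(1,2,3) order_refl] m(4) T by (intro mult_right_mono) auto
      also have "\<dots> \<le> (a powr q * f h') * (unit_ball_vol ?N * (T / 2) ^ ?N / 2)"
        using Mh fh T by (intro mult_right_mono) auto
      finally show ?thesis using a1 by (simp add: mult.assoc)
    qed
    then have "ennreal Y \<le> ennreal (f h') * ennreal (unit_ball_vol ?N * (T / 2) ^ ?N / 2)"
      using fh T by (simp add: ennreal_mult[symmetric] ennreal_leI)
    with le have "ennreal (f h') * emeasure lborel {y \<in> ball x r. 0 < w y} \<le> ennreal (f h') * ennreal (unit_ball_vol ?N * (T / 2) ^ ?N / 2)"
      by simp
    then show ?thesis using fh by (subst (asm) ennreal_mult_le_mult_iff) auto
  qed
  have Yw: "(\<integral>\<^sup>+y\<in>ball x r. ennreal (f (w y / R powr s)) \<partial>lborel) \<le> ennreal Y"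
  proof -
    have "(\<integral>\<^sup>+y\<in>ball x r. ennreal (f (w y / R powr s)) \<partial>lborel) \<le> (\<integral>\<^sup>+y\<in>ball x \<rho>. ennreal (f (w0 y / R powr s)) \<partial>lborel)"
      using w(1,2) R Rs by (intro nn_integral_mono) (auto simp: indicator_def intro!: ennreal_leI f_mono divide_right_mono)
    with Y show ?thesis unfolding w0_def by simp
  qed
  have "(\<integral>\<^sup>+y\<in>ball x r. ennreal (f (w y / R powr s)) \<partial>lborel) \<le> ennreal (gain_const q s0 ?N * (T / R) powr s0\<^sup>2) *
     (energy s f x r w + (\<integral>\<^sup>+y\<in>ball x r. ennreal (f (w y / R powr s)) \<partial>lborel))"
    using w(1) R T meas by (intro gain) auto
  also have "\<dots> \<le> ennreal (gain_const q s0 ?N * (T / R) powr s0\<^sup>2) *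
     (ennreal (c * (2 powr q + K * q\<^sup>2) * a powr (?N + 2 * q) * Y) + ennreal (a powr (?N + 2 * q) * Y))"
  proof (intro mult_left_mono add_mono energy)
    have "1 \<le> a powr (?N + 2 * q)" using a1 q1 by (intro ge_one_powr_ge_zero) auto
    then have "ennreal Y \<le> ennreal (a powr (?N + 2 * q) * Y)" using Y by (intro ennreal_leI) (simp add: mult_le_cancel_right1)
    with Yw show "(\<integral>\<^sup>+y\<in>ball x r. ennreal (f (w y / R powr s)) \<partial>lborel) \<le> ennreal (a powr (?N + 2 * q) * Y)" by simp
  qed simp
  also have "\<dots> = ennreal (step_const c K ?N * (T / R) powr s0\<^sup>2 * a powr (?N + 2 * q) * Y)"
    using Q0 c Y by (simp add: step_const_def ennreal_mult[symmetric] ennreal_plus[symmetric] del: ennreal_plus) (simp add: algebra_simps)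
  finally show ?thesis unfolding w_def .
qed

end

text \<open>The threshold \<open>\<nu>\<close> is obtained before \<open>s\<close>, \<open>f\<close>
  and \<open>g\<close> are fixed, which is what makes the final constant uniform. The integrals are
  shown to lie below a prescribed geometric sequence, so the recursion is checked against this
  sequence and never solved.\<close>

lemma de_giorgi:
  fixes p q s0 c K :: real
  assumes pq: "1 < p" "p \<le> q" and s0: "0 < s0" and c: "0 < c" "0 < K"
  obtains \<nu> where "0 < \<nu>"
    "\<And>s f g (v :: 'a::euclidean_space \<Rightarrow> real) x R k M. orlicz p q s0 s f g \<Longrightarrow> v \<in> borel_measurable borel \<Longrightarrow>
      0 < R \<Longrightarrow> 0 < M \<Longrightarrow>
      (\<And>r \<rho> k. 0 < r \<Longrightarrow> r < \<rho> \<Longrightarrow> \<rho> \<le> R \<Longrightarrow>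
        energy s f x r (\<lambda>y. max (v y - k) 0) \<le> caccioppoli_rhs q c s f g x r \<rho> (\<lambda>y. max (v y - k) 0)) \<Longrightarrow>
      (\<integral>\<^sup>+y\<in>ball x R. ennreal (f (max (v y - k) 0 / R powr s)) \<partial>lborel) \<le> ennreal (\<nu> * f (M / R powr s) * R ^ DIM('a)) \<Longrightarrow>
      tail_int s g x (- ball x (3 * R / 4)) (\<lambda>y. max (v y - k) 0) \<le> ennreal (K * R powr (- s) * g (M / R powr s)) \<Longrightarrow>
      AE y in lborel. y \<in> ball x (3 * R / 4) \<longrightarrow> v y \<le> k + M"
proof -
  let ?N = "DIM('a)"
  have q1: "1 < q" using pq by simp
  define C where "C = gain_const q s0 ?N * (c * (2 powr q + K * q\<^sup>2) + 1)"
  define \<gamma> where "\<gamma> = ?N + 2 * q"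
  have C: "0 < C"
  proof -
    have "0 < gain_const q s0 ?N"
      using q1 s0 by (auto simp: gain_const_def energy_const_def kernel_const_def intro!: mult_pos_pos divide_pos_pos add_nonneg_pos)
    moreover have "0 \<le> c * (2 powr q + K * q\<^sup>2)" using c by (intro mult_nonneg_nonneg add_nonneg_nonneg) auto
    ultimately show ?thesis by (simp add: C_def add_nonneg_pos)
  qed
  have s02: "0 < s0\<^sup>2" using s0 by simp
  \<comment> \<open>Step \<open>j\<close> multiplies by \<open>a powr \<gamma>\<close> with
    \<open>a = 8 * 2 ^ j\<close>. Letting \<open>T\<close> shrink like \<open>\<theta> ^ j\<close>
    cancels the growing part of this factor. The smallness condition of the step is then preserved
    if the integrals decrease like \<open>\<kappa> ^ j\<close>.\<close>
  define \<theta> where "\<theta> = 2 powr (- \<gamma> / s0\<^sup>2)"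
  define \<kappa> where "\<kappa> = \<theta> ^ ?N * 2 powr (- q)"
  have \<theta>: "0 < \<theta>" "\<theta> \<le> 1" "\<theta> powr s0\<^sup>2 = 2 powr (- \<gamma>)"
  proof -
    have "0 \<le> \<gamma> / s0\<^sup>2" using q1 by (simp add: \<gamma>_def)
    then show "\<theta> \<le> 1" using powr_mono[of "- \<gamma> / s0\<^sup>2" 0 2] by (simp add: \<theta>_def)
    show "\<theta> powr s0\<^sup>2 = 2 powr (- \<gamma>)" using s0 by (simp add: \<theta>_def powr_powr)
  qed (simp add: \<theta>_def)
  have \<kappa>: "0 < \<kappa>" "\<kappa> < 1"
  proof -
    have "\<theta> ^ ?N \<le> 1" using \<theta> by (intro power_le_one) auto
    then have "\<kappa> \<le> 1 * 2 powr (- q)" unfolding \<kappa>_def by (intro mult_right_mono) auto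
    moreover have "2 powr (- q) < 1" using q1 by (simp add: powr_less_one)
    ultimately show "\<kappa> < 1" by simp
  qed (use \<theta> in \<open>simp add: \<kappa>_def\<close>)
  \<comment> \<open>What remains of the step factor does not depend on \<open>j\<close> and has to
    be at most \<open>\<kappa>\<close>. The cap 3/4 keeps \<open>T\<close> below all the
    radii.\<close>
  define \<tau> where "\<tau> = min (3/4) ((\<kappa> / (C * 8 powr \<gamma>)) powr (1 / s0\<^sup>2))"
  have \<tau>: "0 < \<tau>" "\<tau> \<le> 3/4" "C * 8 powr \<gamma> * \<tau> powr s0\<^sup>2 \<le> \<kappa>"
  proof -
    have "\<tau> powr s0\<^sup>2 \<le> ((\<kappa> / (C * 8 powr \<gamma>)) powr (1 / s0\<^sup>2)) powr s0\<^sup>2"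
      using C \<kappa> by (intro powr_mono2) (auto simp: \<tau>_def)
    also have "\<dots> = \<kappa> / (C * 8 powr \<gamma>)" using s0 C \<kappa> by (simp add: powr_powr)
    finally show "C * 8 powr \<gamma> * \<tau> powr s0\<^sup>2 \<le> \<kappa>" using C by (simp add: field_simps)
  qed (use C \<kappa> in \<open>auto simp: \<tau>_def\<close>)
  \<comment> \<open>The value for which the smallness condition of \<open>de_giorgi_step\<close>
    holds with equality at every \<open>j\<close>.\<close>
  define \<nu> where "\<nu> = unit_ball_vol ?N * (\<tau> / 2) ^ ?N / 2 * 8 powr (- q)"
  have \<nu>: "0 < \<nu>" using \<tau> by (simp add: \<nu>_def)
  show thesis
  proof (rule that[OF \<nu>])
    fix s f g and v :: "'a \<Rightarrow> real" and x R k M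
    assume "orlicz p q s0 s f g" and v [measurable]: "v \<in> borel_measurable borel" and R: "0 < R" and M: "0 < M"
      and cacc: "\<And>r \<rho> k. 0 < r \<Longrightarrow> r < \<rho> \<Longrightarrow> \<rho> \<le> R \<Longrightarrow>
        energy s f x r (\<lambda>y. max (v y - k) 0) \<le> caccioppoli_rhs q c s f g x r \<rho> (\<lambda>y. max (v y - k) 0)"
      and Y0: "(\<integral>\<^sup>+y\<in>ball x R. ennreal (f (max (v y - k) 0 / R powr s)) \<partial>lborel) \<le> ennreal (\<nu> * f (M / R powr s) * R ^ ?N)"
      and tail: "tail_int s g x (- ball x (3 * R / 4)) (\<lambda>y. max (v y - k) 0) \<le> ennreal (K * R powr (- s) * g (M / R powr s))"
    interpret orlicz p q s0 s f g by fact
    define m where "m = M / R powr s"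
    have m: "0 < m" "0 < f m" using M R f_pos by (auto simp: m_def)
    define kk where "kk j = k + M * (1 - 1 / 2 ^ j)" for j :: nat
    define rr where "rr j = R * (3/4 + 1 / (4 * 2 ^ j))" for j :: nat
    define YY where "YY j = \<nu> * f m * R ^ ?N * \<kappa> ^ j" for j :: nat
    have rr: "3 * R / 4 \<le> rr j" "rr j \<le> R" "rr (Suc j) < rr j" for j
      using R by (auto simp: rr_def field_simps)
    have main: "(\<integral>\<^sup>+y\<in>ball x (rr j). ennreal (f (max (v y - kk j) 0 / R powr s)) \<partial>lborel) \<le> ennreal (YY j)" for j
    proof (induction j)
      case 0
      then show ?case using Y0 by (simp add: kk_def rr_def YY_def m_def)
    next
      case (Suc j)
      \<comment> \<open>Consecutive radii differ by \<open>R / 2 ^ (j + 3)\<close>, and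
        \<open>M / h = 2 ^ (j + 1)\<close>, so this \<open>a\<close> dominates both ratios.\<close>
      define a :: real where "a = 2 ^ (j + 3)"
      define h where "h = M / 2 ^ Suc j"
      define T where "T = \<tau> * R * \<theta> ^ j"
      have kk: "kk (Suc j) = kk j + h" by (simp add: kk_def h_def field_simps)
      have diff: "rr j - rr (Suc j) = R / 2 ^ (j + 3)" by (simp add: rr_def field_simps power_add)
      have T: "0 < T" "T \<le> rr (Suc j)"
      proof -
        have "\<tau> * R * \<theta> ^ j \<le> 3/4 * R * 1" using \<tau> R \<theta> by (intro mult_mono power_le_one) auto
        then show "T \<le> rr (Suc j)" using rr(1)[of "Suc j"] by (simp add: T_def)
      qed (use \<tau> R \<theta> in \<open>simp add: T_def\<close>)
      have apq: "a powr q = 8 powr q * (2 powr q) ^ j"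
      proof -
        have "a = 8 * 2 powr real j" by (simp add: a_def power_add powr_realpow)
        then show ?thesis by (simp add: powr_mult powr_powr powr_realpow[symmetric] mult.commute)
      qed
      have ag: "a powr \<gamma> = 8 powr \<gamma> * (2 powr \<gamma>) ^ j"
      proof -
        have "a = 8 * 2 powr real j" by (simp add: a_def power_add powr_realpow)
        then show ?thesis by (simp add: powr_mult powr_powr powr_realpow[symmetric] mult.commute)
      qed
      have "(\<integral>\<^sup>+y\<in>ball x (rr (Suc j)). ennreal (f (max (v y - (kk j + h)) 0 / R powr s)) \<partial>lborel)
        \<le> ennreal (step_const c K ?N * (T / R) powr s0\<^sup>2 * a powr (?N + 2 * q) * YY j)"
      proof (rule de_giorgi_step[where \<rho> = "rr j" and M = M])
        show "rr j / (rr j - rr (Suc j)) \<le> a"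
          unfolding diff a_def using rr(2)[of j] R by (simp add: divide_right_mono field_simps)
        show "energy s f x (rr (Suc j)) (\<lambda>y. max (v y - (kk j + h)) 0) \<le> caccioppoli_rhs q c s f g x (rr (Suc j)) (rr j) (\<lambda>y. max (v y - (kk j + h)) 0)"
          using rr[of j] rr[of "Suc j"] R by (intro cacc) auto
        show "tail_int s g x (- ball x (rr (Suc j))) (\<lambda>y. max (v y - (kk j + h)) 0) \<le> ennreal (K * R powr (- s) * g (M / R powr s))"
        proof (rule order_trans[OF _ tail])
          have "k \<le> kk (Suc j)" using M unfolding kk_def by (simp del: power_Suc)
          then have "k \<le> kk j + h" by (simp only: kk)
          then show "tail_int s g x (- ball x (rr (Suc j))) (\<lambda>y. max (v y - (kk j + h)) 0) \<le> tail_int s g x (- ball x (3 * R / 4)) (\<lambda>y. max (v y - k) 0)"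
            using rr(1)[of "Suc j"] by (intro tail_int_mono) auto
        qed
        show "a powr q * YY j \<le> f (M / R powr s) * (unit_ball_vol ?N * (T / 2) ^ ?N / 2)"
        proof -
          have "\<kappa> ^ j = (\<theta> ^ j) ^ ?N / (2 powr q) ^ j"
            by (simp add: \<kappa>_def power_mult_distrib powr_minus power_inverse divide_inverse power_mult[symmetric] mult.commute)
          then have "a powr q * YY j = f m * (unit_ball_vol ?N * (T / 2) ^ ?N / 2)"
            unfolding apq YY_def \<nu>_def T_def by (simp add: powr_minus power_mult_distrib power_divide field_simps)
          then show ?thesis by (simp add: m_def)
        qed
        show "0 \<le> YY j" using \<nu> m R \<kappa> by (simp add: YY_def)
        have "1 \<le> (2::real) ^ Suc j" by (rule one_le_power) simp
        then show "h \<le> M" using M by (simp add: h_def pos_divide_le_eq mult_le_cancel_left1 del: power_Suc)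
        show "M \<le> a * h" "0 < h" using M by (auto simp: h_def a_def field_simps power_add)
      qed (use Suc.IH rr R T c v in auto)
      also have "step_const c K ?N * (T / R) powr s0\<^sup>2 * a powr (?N + 2 * q) * YY j \<le> YY (Suc j)"
      proof -
        have "(T / R) powr s0\<^sup>2 = \<tau> powr s0\<^sup>2 * (\<theta> powr s0\<^sup>2) ^ j"
          using R \<tau>(1) \<theta>(1) by (simp add: T_def powr_mult powr_powr powr_realpow[symmetric] mult.commute)
        also have "\<dots> = \<tau> powr s0\<^sup>2 * (1 / (2 powr \<gamma>) ^ j)" unfolding \<theta>(3) by (simp add: powr_minus power_inverse divide_inverse)
        finally have "step_const c K ?N * (T / R) powr s0\<^sup>2 * a powr \<gamma> = C * 8 powr \<gamma> * \<tau> powr s0\<^sup>2"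
          unfolding ag step_const_def C_def by simp
        also have "\<dots> \<le> \<kappa>" by (rule \<tau>)
        finally have "step_const c K ?N * (T / R) powr s0\<^sup>2 * a powr \<gamma> * YY j \<le> \<kappa> * YY j"
          using \<nu> m R \<kappa> by (intro mult_right_mono) (auto simp: YY_def)
        then show ?thesis by (simp add: \<gamma>_def YY_def mult_ac)
      qed
      finally show ?case unfolding kk by (simp add: ennreal_leI order_trans)
    qed
    \<comment> \<open>This integral lies below every \<open>YY j\<close>, hence vanishes; as
      \<open>f\<close> is positive away from 0, there is almost everywhere no excess over
      \<open>k + M\<close>.\<close>
    define I where "I = (\<integral>\<^sup>+y\<in>ball x (3 * R / 4). ennreal (f (max (v y - (k + M)) 0 / R powr s)) \<partial>lborel)"
    have "I \<le> ennreal (YY j)" for j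
    proof -
      have "kk j \<le> k + M" using M by (simp add: kk_def field_simps)
      then have "I \<le> (\<integral>\<^sup>+y\<in>ball x (rr j). ennreal (f (max (v y - kk j) 0 / R powr s)) \<partial>lborel)"
        unfolding I_def using rr(1)[of j]
        by (intro nn_integral_mono) (auto simp: indicator_def intro!: ennreal_leI f_mono divide_right_mono)
      with main[of j] show ?thesis by simp
    qed
    moreover have "(\<lambda>j. ennreal (YY j)) \<longlonglongrightarrow> ennreal 0"
    proof (rule tendsto_ennrealI)
      have "(\<lambda>j. \<nu> * f m * R ^ ?N * \<kappa> ^ j) \<longlonglongrightarrow> \<nu> * f m * R ^ ?N * 0"
        using \<kappa> by (intro tendsto_intros LIMSEQ_realpow_zero) auto
      then show "YY \<longlonglongrightarrow> 0" by (simp add: YY_def[abs_def])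
    qed
    ultimately have "I \<le> ennreal 0" by (intro LIMSEQ_le_const[where X = "\<lambda>j. ennreal (YY j)"]) auto
    then have "I = 0" by simp
    then have "AE y in lborel. ennreal (f (max (v y - (k + M)) 0 / R powr s)) * indicator (ball x (3 * R / 4)) y = 0"
      unfolding I_def by (subst (asm) nn_integral_0_iff_AE) auto
    then show "AE y in lborel. y \<in> ball x (3 * R / 4) \<longrightarrow> v y \<le> k + M"
    proof (rule AE_mp, intro AE_I2 impI)
      fix y assume *: "ennreal (f (max (v y - (k + M)) 0 / R powr s)) * indicator (ball x (3 * R / 4)) y = 0" "y \<in> ball x (3 * R / 4)"
      then have "f (max (v y - (k + M)) 0 / R powr s) \<le> 0" by (simp add: ennreal_eq_0_iff)
      then show "v y \<le> k + M" using f_pos[of "(v y - (k + M)) / R powr s"] R by (auto simp: max_def split: if_splits)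
    qed
  qed
qed

subsection \<open>Shrinking of sublevel sets\<close>

lemma emeasure_subset_ball:
  fixes A :: "'a::euclidean_space set"
  assumes "A \<subseteq> ball x r"
  shows "emeasure lborel A = ennreal (measure lborel A)"
proof (rule emeasure_eq_ennreal_measure)
  have "emeasure lborel A \<le> emeasure lborel (ball x r)" using assms by (intro emeasure_mono) auto
  also have "\<dots> < top" using emeasure_ball_le[of x r] by (rule le_less_trans) simp
  finally show "emeasure lborel A \<noteq> top" by simp
qed

text \<open>The indicator of \<open>{u > k}\<close> is omitted, since the integrand vanishes elsewhere when \<open>g 0 = 0\<close>.\<close>

definition cross_term :: "real \<Rightarrow> (real \<Rightarrow> real) \<Rightarrow> 'a::euclidean_space \<Rightarrow> real \<Rightarrow> ('a \<Rightarrow> real) \<Rightarrow> real \<Rightarrow> ennreal" where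
  "cross_term s g x r u k = ennreal (1 - s) *
     (\<integral>\<^sup>+a\<in>ball x r. (\<integral>\<^sup>+b. ennreal (g (max (u b - k) 0 / norm (a - b) powr s)
        * (max (k - u a) 0 / norm (a - b) powr s) / norm (a - b) ^ DIM('a)) \<partial>lborel) \<partial>lborel)"

text \<open>Both classes fix one centre and let all radii up to \<open>R\<close> and all levels
  vary. The cross term is kept for truncations from below: it controls pairs that jump across two
  levels, and also the tail of \<open>u\<close> above a level.\<close>

definition lower_class where
  "lower_class q c s f g u x R \<longleftrightarrow> (\<forall>r \<rho> k. 0 < r \<longrightarrow> r < \<rho> \<longrightarrow> \<rho> \<le> R \<longrightarrow>
     energy s f x r (\<lambda>y. max (k - u y) 0) + cross_term s g x r u k \<le> caccioppoli_rhs q c s f g x r \<rho> (\<lambda>y. max (k - u y) 0))"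

definition upper_class where
  "upper_class q c s f g u x R \<longleftrightarrow> (\<forall>r \<rho> k. 0 < r \<longrightarrow> r < \<rho> \<longrightarrow> \<rho> \<le> R \<longrightarrow>
     energy s f x r (\<lambda>y. max (u y - k) 0) \<le> caccioppoli_rhs q c s f g x r \<rho> (\<lambda>y. max (u y - k) 0))"

text \<open>The factor \<open>q\<^sup>2 * 4 powr q\<close> comes from one use each of
  \<open>g_add\<close> and \<open>g_two\<close>. In \<open>rhs_const\<close> below,
  \<open>4 powr (N + q)\<close> bounds the powers of \<open>R / (R - r)\<close> for
  \<open>r \<le> 3 * R / 4\<close>, and the bracket has one summand for each term of the Caccioppoli
  inequality.\<close>

definition tail_const :: "real \<Rightarrow> real \<Rightarrow> nat \<Rightarrow> real" where
  "tail_const q s0 N = q\<^sup>2 * 4 powr q * kernel_const s0 N"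

definition rhs_const :: "real \<Rightarrow> real \<Rightarrow> real \<Rightarrow> real \<Rightarrow> nat \<Rightarrow> real" where
  "rhs_const q s0 c K N = c * 4 powr (N + q) * unit_ball_vol N * (1 + q * (tail_const q s0 N + q * 2 powr q * K))"

context orlicz begin

lemma tail_const_nonneg: "0 \<le> tail_const q s0 N"
  using s0 by (simp add: tail_const_def kernel_const_def)

lemma rhs_const_nonneg: "0 \<le> c \<Longrightarrow> 0 \<le> K \<Longrightarrow> 0 \<le> rhs_const q s0 c K N"
  using q1 tail_const_nonneg[of N] by (simp add: rhs_const_def)

section \<open>Tails, and the right-hand side of the Caccioppoli inequality at a fixed level\<close>

lemma powr_s_le: "0 < b \<Longrightarrow> 0 \<le> a \<Longrightarrow> a \<le> 2 * b \<Longrightarrow> a powr s \<le> 2 * b powr s"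
proof -
  assume "0 < b" "0 \<le> a" "a \<le> 2 * b"
  then have "a powr s \<le> (2 * b) powr s" using s_pos by (intro powr_mono2) auto
  also have "\<dots> = 2 powr s * b powr s" using \<open>0 < b\<close> by (simp add: powr_mult)
  also have "\<dots> \<le> 2 powr 1 * b powr s" using s1 by (intro mult_right_mono powr_mono) auto
  finally show ?thesis by simp
qed

lemma g_two: "0 \<le> t \<Longrightarrow> g (2 * t) \<le> q * 2 powr q * g t"
  using g_scale_upper[of 2 t] by simp

text \<open>Outside the ball \<open>norm (y - x) \<ge> R / 2\<close>, so the constant part
  \<open>k\<close> enters \<open>g\<close> with at most twice the argument
  \<open>k / R powr s\<close>. This value of \<open>g\<close> leaves the integral, and the far
  kernel supplies \<open>R powr (- s)\<close>.\<close>

lemma tail_bound: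
  fixes v w :: "'a::euclidean_space \<Rightarrow> real"
  assumes [measurable]: "w \<in> borel_measurable borel"
    and R: "0 < R" "R / 2 \<le> r" and k: "0 \<le> k"
    and v: "\<And>y. y \<notin> ball x r \<Longrightarrow> 0 \<le> v y \<and> v y \<le> k + w y" and w: "\<And>y. 0 \<le> w y"
  shows "tail_int s g x (- ball x r) v \<le> ennreal (tail_const q s0 DIM('a) * R powr (- s) * g (k / R powr s))
     + ennreal (q * 2 powr q) * tail_int s g x (- ball x r) w"
proof -
  let ?N = "DIM('a)"
  define m where "m = k / R powr s"
  have m: "0 \<le> m" using k by (simp add: m_def)
  define G where "G = q\<^sup>2 * 4 powr q * g m"
  have G: "0 \<le> G" using m g_nonneg by (simp add: G_def)
  define A where "A y = ennreal (1 / norm (y - x) powr (real ?N + s)) * indicator (- ball x r) y" for y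
  define B where "B y = ennreal (g (w y / norm (y - x) powr s) / norm (y - x) powr (real ?N + s)) * indicator (- ball x r) y" for y
  have [measurable]: "A \<in> borel_measurable borel" "B \<in> borel_measurable borel"
    unfolding A_def B_def by measurable
  have pw: "ennreal (g (v y / norm (y - x) powr s) / norm (y - x) powr (real ?N + s)) * indicator (- ball x r) y
    \<le> ennreal G * A y + ennreal (q * 2 powr q) * B y" for y
  proof (cases "y \<in> ball x r")
    case False
    define h where "h = norm (y - x)"
    have h: "R / 2 \<le> h" using False R by (simp add: h_def dist_norm norm_minus_commute)
    then have h0: "0 < h" using R by linarith
    have "R powr s \<le> 2 * h powr s" using h h0 R by (intro powr_s_le) auto
    then have "k / h powr s \<le> 2 * m" using h0 R k by (simp add: m_def field_simps mult_left_mono)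
    have "g (v y / h powr s) \<le> g (k / h powr s + w y / h powr s)"
      using v[OF False] h0 by (intro g_mono) (auto simp: add_divide_distrib[symmetric] divide_right_mono)
    also have "\<dots> \<le> q * 2 powr q * (g (k / h powr s) + g (w y / h powr s))"
      using k w by (intro g_add) auto
    also have "g (k / h powr s) \<le> g (2 * m)" using k \<open>k / h powr s \<le> 2 * m\<close> by (intro g_mono) auto
    also have "\<dots> \<le> q * 2 powr q * g m" using m by (rule g_two)
    finally have "g (v y / h powr s) \<le> q * 2 powr q * (q * 2 powr q * g m + g (w y / h powr s))"
      using q1 by simp
    also have "\<dots> = G + q * 2 powr q * g (w y / h powr s)"
    proof -
      have "(2::real) powr q * 2 powr q = 4 powr q" by (simp add: powr_mult[symmetric])
      then show ?thesis by (simp add: G_def power2_eq_square algebra_simps)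
    qed
    finally have "g (v y / h powr s) / h powr (real ?N + s) \<le> (G + q * 2 powr q * g (w y / h powr s)) / h powr (real ?N + s)"
      by (rule divide_right_mono) simp
    also have "\<dots> = G * (1 / h powr (real ?N + s)) + q * 2 powr q * (g (w y / h powr s) / h powr (real ?N + s))"
      by (simp add: add_divide_distrib)
    finally show ?thesis
      using False G q1 g_nonneg[of "w y / h powr s"] w[of y] unfolding A_def B_def h_def[symmetric]
      by (simp add: ennreal_mult[symmetric] ennreal_plus[symmetric] ennreal_leI del: ennreal_plus times_divide_eq_right)
  qed simp
  have "tail_int s g x (- ball x r) v \<le> ennreal (1 - s) * (\<integral>\<^sup>+y. ennreal G * A y + ennreal (q * 2 powr q) * B y \<partial>lborel)"
    unfolding tail_int_def using pw by (intro mult_left_mono nn_integral_mono) auto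
  also have "(\<integral>\<^sup>+y. ennreal G * A y + ennreal (q * 2 powr q) * B y \<partial>lborel) = ennreal G * (\<integral>\<^sup>+y. A y \<partial>lborel) + ennreal (q * 2 powr q) * (\<integral>\<^sup>+y. B y \<partial>lborel)"
    by (simp add: nn_integral_add nn_integral_cmult)
  also have "ennreal (1 - s) * \<dots> = ennreal G * (ennreal (1 - s) * (\<integral>\<^sup>+y. A y \<partial>lborel)) + ennreal (q * 2 powr q) * tail_int s g x (- ball x r) w"
    by (simp add: tail_int_def B_def[abs_def] distrib_left mult_ac)
  also have "\<dots> \<le> ennreal (tail_const q s0 ?N * R powr (- s) * g m) + ennreal (q * 2 powr q) * tail_int s g x (- ball x r) w"
  proof (rule add_right_mono)
    have r: "0 < r" using R by linarith
    have "ennreal (1 - s) * (\<integral>\<^sup>+y. A y \<partial>lborel) \<le> ennreal 1 * ennreal (2 * 2 ^ ?N * unit_ball_vol ?N * r powr (- s) / s)"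
      unfolding A_def using nn_integral_far_kernel[of s r x] s_pos s1 r by (intro mult_mono ennreal_leI) auto
    also have "\<dots> \<le> ennreal (kernel_const s0 ?N * R powr (- s))"
    proof -
      have "R powr s \<le> 2 * r powr s" using R r by (intro powr_s_le) auto
      then have "r powr (- s) \<le> 2 * R powr (- s)" using r R by (simp add: powr_minus field_simps)
      then have "2 * 2 ^ ?N * unit_ball_vol ?N * r powr (- s) / s \<le> 2 * 2 ^ ?N * unit_ball_vol ?N * (2 * R powr (- s)) / s0"
        using s0 s0_le by (intro frac_le mult_left_mono) auto
      then show ?thesis by (simp add: kernel_const_def ennreal_leI mult_ac)
    qed
    finally have "ennreal G * (ennreal (1 - s) * (\<integral>\<^sup>+y. A y \<partial>lborel)) \<le> ennreal G * ennreal (kernel_const s0 ?N * R powr (- s))"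
      by (rule mult_left_mono) simp
    also have "\<dots> = ennreal (tail_const q s0 ?N * R powr (- s) * g m)"
      using G s0 by (simp add: ennreal_mult[symmetric] kernel_const_def) (simp add: G_def tail_const_def kernel_const_def mult_ac)
    finally show "ennreal G * (ennreal (1 - s) * (\<integral>\<^sup>+y. A y \<partial>lborel)) \<le> ennreal (tail_const q s0 ?N * R powr (- s) * g m)" .
  qed
  finally show ?thesis by (simp add: m_def)
qed

text \<open>Inside the ball the truncation is at most \<open>k\<close>, outside it is at most
  \<open>k\<close> plus the negative part of \<open>u\<close>. Both terms then have the scale of
  \<open>f m\<close> times the volume of the ball, the nonlocal one because
  \<open>k * R powr (- s) * g m = m * g m \<le> q * f m\<close>.\<close>

lemma caccioppoli_rhs_le:
  fixes u :: "'a::euclidean_space \<Rightarrow> real"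
  assumes [measurable]: "u \<in> borel_measurable borel" and u: "\<And>y. y \<in> ball x R \<Longrightarrow> 0 \<le> u y"
    and R: "0 < R" "R / 2 \<le> r" "r \<le> 3 * R / 4" and k: "0 < k" and c: "0 < c" "0 \<le> K"
    and tail: "tail_int s g x UNIV (\<lambda>y. max (- u y) 0) \<le> ennreal (K * R powr (- s) * g (k / R powr s))"
  shows "caccioppoli_rhs q c s f g x r R (\<lambda>y. max (k - u y) 0) \<le> ennreal (rhs_const q s0 c K DIM('a) * R ^ DIM('a) * f (k / R powr s))"
proof -
  let ?N = "DIM('a)"
  define m where "m = k / R powr s"
  have m: "0 < m" using k R by (simp add: m_def)
  define \<omega> where "\<omega> = unit_ball_vol ?N"
  have \<omega>: "0 < \<omega>" by (simp add: \<omega>_def)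
  define v where "v = (\<lambda>y. max (k - u y) 0)"
  define a where "a = R / (R - r)"
  have a: "1 \<le> a" "a \<le> 4" using R by (auto simp: a_def field_simps)
  define K' where "K' = tail_const q s0 ?N + q * 2 powr q * K"
  have K': "0 \<le> K'" using tail_const_nonneg[of ?N] q1 c by (simp add: K'_def)
  have int_const: "(\<integral>\<^sup>+y\<in>ball x R. ennreal C \<partial>lborel) = ennreal (C * (\<omega> * R ^ ?N))" if "0 \<le> C" for C
    using that R by (subst nn_integral_cmult_indicator) (auto simp: emeasure_ball \<omega>_def ennreal_mult[symmetric])
  have 1: "(\<integral>\<^sup>+y\<in>ball x R. ennreal (f (v y / R powr s)) \<partial>lborel) \<le> ennreal (f m * (\<omega> * R ^ ?N))"
  proof -
    have "(\<integral>\<^sup>+y\<in>ball x R. ennreal (f (v y / R powr s)) \<partial>lborel) \<le> (\<integral>\<^sup>+y\<in>ball x R. ennreal (f m) \<partial>lborel)"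
      using u k by (intro nn_integral_mono) (auto simp: indicator_def v_def m_def intro!: ennreal_leI f_mono divide_right_mono)
    then show ?thesis using m f_nonneg by (simp add: int_const)
  qed
  have 2: "(\<integral>\<^sup>+y\<in>ball x R. ennreal (v y) \<partial>lborel) \<le> ennreal (k * (\<omega> * R ^ ?N))"
  proof -
    have "(\<integral>\<^sup>+y\<in>ball x R. ennreal (v y) \<partial>lborel) \<le> (\<integral>\<^sup>+y\<in>ball x R. ennreal k \<partial>lborel)"
      using u k by (intro nn_integral_mono) (auto simp: indicator_def v_def intro!: ennreal_leI)
    then show ?thesis using k by (simp add: int_const)
  qed
  have 3: "tail_int s g x (- ball x r) v \<le> ennreal (K' * R powr (- s) * g m)"
  proof -
    have "tail_int s g x (- ball x r) v \<le> ennreal (tail_const q s0 ?N * R powr (- s) * g (k / R powr s))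
       + ennreal (q * 2 powr q) * tail_int s g x (- ball x r) (\<lambda>y. max (- u y) 0)"
      using R k by (intro tail_bound) (auto simp: v_def)
    also have "tail_int s g x (- ball x r) (\<lambda>y. max (- u y) 0) \<le> tail_int s g x UNIV (\<lambda>y. max (- u y) 0)"
      by (intro tail_int_mono) auto
    also have "\<dots> \<le> ennreal (K * R powr (- s) * g (k / R powr s))" by (rule tail)
    finally have "tail_int s g x (- ball x r) v \<le> ennreal (tail_const q s0 ?N * R powr (- s) * g m) + ennreal (q * 2 powr q) * ennreal (K * R powr (- s) * g m)"
      by (simp add: m_def add_left_mono mult_left_mono)
    also have "\<dots> = ennreal (K' * R powr (- s) * g m)"
      using tail_const_nonneg[of ?N] q1 c m g_nonneg[of m] by (simp add: K'_def ennreal_mult[symmetric] ennreal_plus[symmetric] algebra_simps del: ennreal_plus)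
    finally show ?thesis .
  qed
  have "caccioppoli_rhs q c s f g x r R v \<le> ennreal (c * 4 powr (?N + q)) * ennreal (f m * (\<omega> * R ^ ?N)) +
     ennreal (c * 4 powr (?N + q)) * (ennreal (k * (\<omega> * R ^ ?N)) * ennreal (K' * R powr (- s) * g m))"
  proof -
    have sq: "s * q \<le> q" using s1 s_pos q1 by (simp add: mult_le_cancel_right1)
    have "a powr q \<le> 4 powr q" using a q1 by (intro powr_mono2) auto
    also have "\<dots> \<le> 4 powr (?N + q)" by (intro powr_mono) auto
    finally have A1: "c * a powr q \<le> c * 4 powr (?N + q)" using c by simp
    have "a powr (real ?N + s * q) \<le> 4 powr (real ?N + s * q)" using a q1 s_pos by (intro powr_mono2) auto
    also have "\<dots> \<le> 4 powr (?N + q)" using sq by (intro powr_mono) auto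
    finally have A2: "c * a powr (real ?N + s * q) \<le> c * 4 powr (?N + q)" using c by simp
    have "caccioppoli_rhs q c s f g x r R v = ennreal (c * a powr q) * (\<integral>\<^sup>+y\<in>ball x R. ennreal (f (v y / R powr s)) \<partial>lborel)
       + ennreal (c * a powr (real ?N + s * q)) * ((\<integral>\<^sup>+y\<in>ball x R. ennreal (v y) \<partial>lborel) * tail_int s g x (- ball x r) v)"
      by (simp add: caccioppoli_rhs_def a_def mult.assoc)
    then show ?thesis
      using ennreal_leI[OF A1] ennreal_leI[OF A2] 1 2 3 by (simp only:) (intro add_mono mult_mono, auto)
  qed
  also have "\<dots> = ennreal (c * 4 powr (?N + q) * \<omega> * R ^ ?N * (f m + K' * (k * R powr (- s) * g m)))"
    using c m k \<omega> R K' f_nonneg[of m] g_nonneg[of m] by (simp add: ennreal_mult[symmetric] ennreal_plus[symmetric] del: ennreal_plus) (simp add: algebra_simps)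
  also have "\<dots> \<le> ennreal (c * 4 powr (?N + q) * \<omega> * R ^ ?N * (f m + K' * (q * f m)))"
  proof (intro ennreal_leI mult_left_mono add_left_mono)
    show "k * R powr (- s) * g m \<le> q * f m" using gf_upper[of m] m by (simp add: m_def powr_minus divide_inverse)
  qed (use c \<omega> R K' in auto)
  also have "\<dots> = ennreal (rhs_const q s0 c K ?N * R ^ ?N * f m)"
    by (simp add: rhs_const_def \<omega>_def K'_def algebra_simps)
  finally show ?thesis by (simp add: v_def m_def)
qed

lemma f_scale_down: "0 < l \<Longrightarrow> l \<le> 1 \<Longrightarrow> 0 \<le> t \<Longrightarrow> f (l * t) \<le> l powr p * f t"
  using f_scale_lower[of "1 / l" "l * t"] by (simp add: powr_divide field_simps)

lemma f_le_tg: "0 \<le> t \<Longrightarrow> f t \<le> t * g t"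
proof -
  assume t: "0 \<le> t"
  have "f t \<le> p * f t" using p1 f_nonneg[OF t] by (simp add: mult_le_cancel_right1)
  with gf_lower[OF t] show ?thesis by linarith
qed

text \<open>At the level \<open>2 * (l * \<kappa>)\<close> the truncation from below is at least
  \<open>l * \<kappa>\<close> on the low set, and the one from above is at least
  \<open>\<kappa> / 2\<close> on the high set, as \<open>l \<le> 1/4\<close>. Hence the integrand is
  bounded below by \<open>b\<close>, which is linear in \<open>l\<close>, whereas the right-hand
  side is of order \<open>l powr p\<close>. The surplus \<open>l powr (p - 1)\<close> is small
  because \<open>p > 1\<close>.\<close>

lemma cross_levels:
  fixes u :: "'a::euclidean_space \<Rightarrow> real"
  assumes [measurable]: "u \<in> borel_measurable borel" and R: "0 < R" "r \<le> R" and l: "0 < l" "l \<le> 1/4" and \<kappa>: "0 < \<kappa>"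
    and C: "cross_term s g x r u (2 * (l * \<kappa>)) \<le> ennreal (C * R ^ DIM('a) * f (2 * (l * \<kappa>) / R powr s))" "0 \<le> C"
  shows "(1 - s) * measure lborel {y \<in> ball x r. u y < l * \<kappa>} * measure lborel {y \<in> ball x r. \<kappa> \<le> u y}
     \<le> C * 2 powr q * (2 * q * 4 powr q * 2 ^ DIM('a)) * (R ^ DIM('a))\<^sup>2 * l powr (p - 1)"
proof -
  let ?N = "DIM('a)"
  define E where "E = {y \<in> ball x r. u y < l * \<kappa>}"
  define F where "F = {y \<in> ball x r. \<kappa> \<le> u y}"
  have [measurable]: "E \<in> sets borel" "F \<in> sets borel" unfolding E_def F_def by measurable
  have fin: "emeasure lborel E = ennreal (measure lborel E)" "emeasure lborel F = ennreal (measure lborel F)"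
    by (rule emeasure_subset_ball[of _ x r]; auto simp: E_def F_def)+
  define m where "m = \<kappa> / R powr s"
  have m: "0 < m" using R \<kappa> by (simp add: m_def)
  define b where "b = g m * (l * m) / (2 * q * 4 powr q * 2 ^ ?N * R ^ ?N)"
  have b: "0 < b" using g_pos[OF m] l m q1 R by (simp add: b_def)
  have pw: "ennreal b * indicator E a * indicator F y \<le> ennreal (g (max (u y - 2 * (l * \<kappa>)) 0 / norm (a - y) powr s)
        * (max (2 * (l * \<kappa>) - u a) 0 / norm (a - y) powr s) / norm (a - y) ^ ?N) * indicator (ball x r) a" for a y
  proof (cases "a \<in> E \<and> y \<in> F")
    case True
    define h where "h = norm (a - y)"
    have lk: "l * \<kappa> \<le> \<kappa> / 4" using l \<kappa> by simp
    have "a \<noteq> y"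
    proof
      assume "a = y"
      then have "u y < l * \<kappa>" "\<kappa> \<le> u y" using True by (auto simp: E_def F_def)
      with lk \<kappa> show False by linarith
    qed
    then have h: "0 < h" by (simp add: h_def)
    have h2: "h \<le> 2 * R"
      using True R dist_triangle[of a y x] by (simp add: h_def E_def F_def dist_commute dist_norm[of a y, symmetric])
    have hs: "h powr s \<le> 2 * R powr s" using R h h2 by (intro powr_s_le) auto
    have "\<kappa> \<le> u y" using True by (simp add: F_def)
    then have "\<kappa> / 2 \<le> u y - 2 * (l * \<kappa>)" using lk by linarith
    then have uy: "\<kappa> / 2 \<le> max (u y - 2 * (l * \<kappa>)) 0" by (simp add: le_max_iff_disj)
    have "u a < l * \<kappa>" using True by (simp add: E_def)
    then have "l * \<kappa> \<le> 2 * (l * \<kappa>) - u a" by linarith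
    then have ua: "l * \<kappa> \<le> max (2 * (l * \<kappa>) - u a) 0" by (simp add: le_max_iff_disj)
    have "g m \<le> q * 4 powr q * g (m / 4)" using g_scale_upper[of 4 "m / 4"] m by simp
    moreover have "g (m / 4) \<le> g (max (u y - 2 * (l * \<kappa>)) 0 / h powr s)"
    proof (rule g_mono)
      have "m / 4 = (\<kappa> / 2) / (2 * R powr s)" by (simp add: m_def)
      also have "\<dots> \<le> max (u y - 2 * (l * \<kappa>)) 0 / h powr s" using h by (intro frac_le uy hs) auto
      finally show "m / 4 \<le> max (u y - 2 * (l * \<kappa>)) 0 / h powr s" .
    qed (use m in simp)
    ultimately have "g m \<le> q * 4 powr q * g (max (u y - 2 * (l * \<kappa>)) 0 / h powr s)"
      using q1 by (smt (verit) mult_left_mono mult_nonneg_nonneg powr_ge_zero)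
    then have 1: "g m / (q * 4 powr q) \<le> g (max (u y - 2 * (l * \<kappa>)) 0 / h powr s)"
      using q1 by (simp add: pos_divide_le_eq mult.commute)
    have 2: "l * m / 2 \<le> max (2 * (l * \<kappa>) - u a) 0 / h powr s"
    proof -
      have "l * m / 2 = (l * \<kappa>) / (2 * R powr s)" by (simp add: m_def)
      also have "\<dots> \<le> max (2 * (l * \<kappa>) - u a) 0 / h powr s" using h by (intro frac_le ua hs) auto
      finally show ?thesis .
    qed
    have 3: "h ^ ?N \<le> 2 ^ ?N * R ^ ?N" using power_mono[OF h2, of ?N] h by (simp add: power_mult_distrib)
    have "b = (g m / (q * 4 powr q)) * (l * m / 2) / (2 ^ ?N * R ^ ?N)" by (simp add: b_def)
    also have "\<dots> \<le> g (max (u y - 2 * (l * \<kappa>)) 0 / h powr s) * (max (2 * (l * \<kappa>) - u a) 0 / h powr s) / h ^ ?N"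
      using h m l q1 g_nonneg[of "max (u y - 2 * (l * \<kappa>)) 0 / h powr s"]
      by (intro frac_le[OF _ mult_mono[OF 1 2] _ 3]) auto
    finally show ?thesis using True unfolding h_def[symmetric] by (simp add: E_def ennreal_leI)
  qed auto
  have "ennreal (1 - s) * (ennreal b * ennreal (measure lborel E) * ennreal (measure lborel F)) =
     ennreal (1 - s) * (\<integral>\<^sup>+a. (\<integral>\<^sup>+y. ennreal b * indicator E a * indicator F y \<partial>lborel) \<partial>lborel)"
    by (simp add: nn_integral_cmult nn_integral_multc fin)
  also have "\<dots> \<le> cross_term s g x r u (2 * (l * \<kappa>))"
    unfolding cross_term_def
    by (subst nn_integral_multc[symmetric], measurable) (intro mult_left_mono nn_integral_mono pw, simp)
  also have "\<dots> \<le> ennreal (C * R ^ ?N * f (2 * (l * \<kappa>) / R powr s))" by (rule C)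
  finally have "(1 - s) * (b * measure lborel E * measure lborel F) \<le> C * R ^ ?N * f (2 * (l * \<kappa>) / R powr s)"
    using s1 b C R \<kappa> l f_nonneg by (simp add: ennreal_mult[symmetric] ennreal_le_iff)
  also have "\<dots> \<le> C * R ^ ?N * (2 powr q * (l powr p * (m * g m)))"
  proof (intro mult_left_mono)
    have "f (2 * (l * \<kappa>) / R powr s) = f (2 * (l * m))" by (simp add: m_def)
    also have "\<dots> \<le> 2 powr q * f (l * m)" using l m by (intro f_scale_upper) auto
    also have "\<dots> \<le> 2 powr q * (l powr p * f m)" using l m by (intro mult_left_mono f_scale_down) auto
    also have "\<dots> \<le> 2 powr q * (l powr p * (m * g m))" using m by (intro mult_left_mono f_le_tg) auto
    finally show "f (2 * (l * \<kappa>) / R powr s) \<le> 2 powr q * (l powr p * (m * g m))" .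
  qed (use C R in auto)
  also have "\<dots> = b * (C * 2 powr q * (2 * q * 4 powr q * 2 ^ ?N) * (R ^ ?N)\<^sup>2 * l powr (p - 1))"
  proof -
    have "l powr p = l * l powr (p - 1)" using l by (simp add: powr_mult_base)
    then show ?thesis using q1 R by (simp add: b_def power2_eq_square)
  qed
  finally have "b * ((1 - s) * measure lborel E * measure lborel F) \<le> b * (C * 2 powr q * (2 * q * 4 powr q * 2 ^ ?N) * (R ^ ?N)\<^sup>2 * l powr (p - 1))"
    by (simp add: mult_ac)
  then show ?thesis using b unfolding E_def F_def by simp
qed


lemma double_int_indicator_product:
  assumes "E \<subseteq> B" "F \<subseteq> B" and [measurable]: "E \<in> sets borel" "F \<in> sets borel"
  shows "double_int B (\<lambda>x y. indicator E x * indicator F y) = emeasure lborel E * emeasure lborel F"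
proof -
  have "double_int B (\<lambda>x y. indicator E x * indicator F y) = (\<integral>\<^sup>+x. (\<integral>\<^sup>+y. indicator E x * indicator F y \<partial>lborel) \<partial>lborel)"
    unfolding double_int_def using assms
    by (intro nn_integral_cong) (auto simp: indicator_def intro!: nn_integral_cong)
  also have "\<dots> = emeasure lborel E * emeasure lborel F"
    by (simp add: nn_integral_cmult nn_integral_multc)
  finally show ?thesis .
qed

definition shrink_const :: "real \<Rightarrow> nat \<Rightarrow> real" where
  "shrink_const c N = 2 ^ (N + 4) * (4 * q * (rhs_const q s0 c 1 N + kernel_const s0 N
     + rhs_const q s0 c 1 N * 2 powr q * (2 * q * 4 powr q * 2 ^ N)))"

text \<open>A quotient \<open>t \<ge> \<mu> m\<close> is absorbed by the energy with the small factor \<open>\<mu> powr (1 - p)\<close>.  Otherwise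
  one of the points lies in the intermediate level set \<open>D\<close>, or the pair crosses from \<open>E\<close> to \<open>F\<close>; in the
  latter case the bound on \<open>t\<close> forces the points to be far apart, and \<open>cross_levels\<close> applies.\<close>

lemma shrink_pointwise:
  fixes u :: "'a::euclidean_space \<Rightarrow> real"
  assumes R: "0 < R" "r \<le> R" and l: "0 < l" "l \<le> 1/4" and \<kappa>: "0 < \<kappa>" and \<mu>: "1 \<le> \<mu>"
    and xy: "x \<in> ball z r" "y \<in> ball z r"
  defines "m \<equiv> \<kappa> / R powr s" and "v \<equiv> \<lambda>y. max (\<kappa> - u y) 0" and "W \<equiv> \<lambda>y. min (max (\<kappa> - u y) 0) (\<kappa> - l * \<kappa>)"
    and "E \<equiv> {y \<in> ball z r. u y < l * \<kappa>}" and "F \<equiv> {y \<in> ball z r. \<kappa> \<le> u y}" and "D \<equiv> {y \<in> ball z r. l * \<kappa> \<le> u y \<and> u y < \<kappa>}"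
  shows "g m * (\<bar>W x - W y\<bar> * norm (x - y) powr (- (DIM('a) + \<sigma>)))
    \<le> 2 * q * \<mu> powr (1 - p) * R powr \<alpha> * (f (\<bar>v x - v y\<bar> / norm (x - y) powr s) / norm (x - y) ^ DIM('a))
      + \<mu> * q * f m * (indicator D x * norm (x - y) powr (\<alpha> - DIM('a)))
      + \<mu> * q * f m * (indicator D y * norm (y - x) powr (\<alpha> - DIM('a)))
      + 2 * \<mu> * q * f m * R powr \<alpha> * ((2 * \<mu>) powr (DIM('a) / s0) / R ^ DIM('a)) * (indicator E x * indicator F y + indicator F x * indicator E y)"
    (is "_ \<le> ?a + ?b + ?b' + ?c")
proof -
  let ?N = "DIM('a)"
  define h where "h = norm (x - y)"
  define t where "t = \<bar>v x - v y\<bar> / h powr s"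
  define k where "k = h powr (\<alpha> - ?N)"
  have m: "0 < m" using R \<kappa> by (simp add: m_def)
  have fm: "0 < f m" "0 \<le> g m" using f_pos[OF m] g_nonneg[of m] m by auto
  have t0: "0 \<le> t" by (simp add: t_def)
  have k0: "0 \<le> k" by (simp add: k_def)
  define a where "a = l * \<kappa>"
  have lk: "a \<le> \<kappa> / 4" using l \<kappa> by (simp add: a_def)
  have nn: "0 \<le> ?a" "0 \<le> ?b" "0 \<le> ?b'" "0 \<le> ?c"
    using q1 \<mu> fm t0 R f_nonneg[of t] by (auto simp: t_def h_def)
  show ?thesis
  proof (cases "W x = W y")
    case True
    then show ?thesis using nn by simp
  next
    case False
    then have h: "0 < h" by (auto simp: h_def)
    have kle: "k \<le> 2 * R powr \<alpha> / h ^ ?N" unfolding k_def h_def using xy R by (intro norm_kernel_split)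
    have Wt: "\<bar>W x - W y\<bar> / h powr s \<le> t"
      unfolding t_def W_def v_def by (intro divide_right_mono) (auto simp: min_def)
    have eq: "g m * (\<bar>W x - W y\<bar> * norm (x - y) powr (- (?N + \<sigma>))) = g m * (\<bar>W x - W y\<bar> / h powr s) * k"
    proof -
      have "norm (x - y) powr (- (?N + \<sigma>)) = h powr (- s) * k"
        unfolding k_def h_def powr_add[symmetric] by (simp add: \<sigma>_def algebra_simps)
      then show ?thesis by (simp add: powr_minus divide_inverse)
    qed
    have le: "g m * (\<bar>W x - W y\<bar> / h powr s) * k \<le> g m * t * k"
      using Wt fm k0 by (intro mult_right_mono mult_left_mono) auto
    show ?thesis
    proof (cases "\<mu> * m \<le> t")
      case True
      have "g m * t * k \<le> q * \<mu> powr (1 - p) * f t * (2 * R powr \<alpha> / h ^ ?N)"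
        using m k0 q1 f_nonneg[OF t0] by (intro mult_mono[OF g_young_large[OF _ \<mu> True] kle]) auto
      also have "\<dots> = ?a" by (simp add: t_def h_def)
      finally show ?thesis using nn eq le by linarith
    next
      case False
      then have tm: "t \<le> \<mu> * m" by simp
      have "g m * t \<le> g m * (\<mu> * m)" using tm fm by (intro mult_left_mono) auto
      also have "\<dots> = \<mu> * (m * g m)" by simp
      also have "\<dots> \<le> \<mu> * (q * f m)" using gf_upper[of m] m \<mu> by (intro mult_left_mono) auto
      finally have gt: "g m * t * k \<le> \<mu> * q * f m * k" using k0 by (intro mult_right_mono) auto
      have pairs: ?thesis if P: "(x \<in> E \<and> y \<in> F) \<or> (x \<in> F \<and> y \<in> E)"
      proof -
        have ind: "indicator E x * indicator F y + indicator F x * indicator E y \<ge> (1::real)" if "(x \<in> E \<and> y \<in> F) \<or> (x \<in> F \<and> y \<in> E)"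
          using that by auto
        have far: "k \<le> 2 * R powr \<alpha> * ((2 * \<mu>) powr (?N / s0) / R ^ ?N)" if "(x \<in> E \<and> y \<in> F) \<or> (x \<in> F \<and> y \<in> E)"
        proof -
          have "\<kappa> / 2 \<le> \<bar>v x - v y\<bar>" using that lk \<kappa> unfolding v_def E_def F_def a_def[symmetric] by auto
          then have "\<kappa> / 2 / h powr s \<le> t" unfolding t_def by (intro divide_right_mono) auto
          with tm have "\<kappa> / 2 / h powr s \<le> \<mu> * (\<kappa> / R powr s)" by (simp add: m_def)
          then have "\<kappa> * R powr s \<le> \<kappa> * (2 * \<mu> * h powr s)" using h R by (simp add: field_simps)
          then have "R powr s \<le> 2 * \<mu> * h powr s" using \<kappa> by simp
          then have "(R / h) powr s \<le> 2 * \<mu>" using h R by (simp add: powr_divide field_simps)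
          then have "((R / h) powr s) powr (?N / s0) \<le> (2 * \<mu>) powr (?N / s0)" using s0 by (intro powr_mono2) auto
          \<comment> \<open>Passing from the exponent \<open>d / s\<close> to the uniform
            \<open>d / s0\<close> enlarges only powers of numbers at least 1; for
            \<open>R / h \<le> 1\<close> the wanted bound holds because
            \<open>2 * \<mu> \<ge> 1\<close>.\<close>
          moreover have "(R / h) powr ?N \<le> ((R / h) powr s) powr (?N / s0) \<or> R / h \<le> 1"
          proof (cases "R / h \<le> 1")
            case False
            then have "(R / h) powr ?N \<le> (R / h) powr (s * (?N / s0))"
              using s0 s0_le by (intro powr_mono) (auto simp: field_simps)
            then show ?thesis by (simp add: powr_powr)
          qed simp
          moreover have "1 \<le> (2 * \<mu>) powr (?N / s0)" using \<mu> s0 by (intro ge_one_powr_ge_zero) auto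
          moreover have "(R / h) powr ?N \<le> 1" if "R / h \<le> 1" using that R h powr_mono2[of ?N "R / h" 1] by simp
          ultimately have "(R / h) ^ ?N \<le> (2 * \<mu>) powr (?N / s0)" using R h by (auto simp: powr_realpow)
          then have "1 / h ^ ?N \<le> (2 * \<mu>) powr (?N / s0) / R ^ ?N" using R h by (simp add: power_divide field_simps)
          then have "2 * R powr \<alpha> * (1 / h ^ ?N) \<le> 2 * R powr \<alpha> * ((2 * \<mu>) powr (?N / s0) / R ^ ?N)"
            by (intro mult_left_mono) auto
          with kle show ?thesis by simp
        qed
        have "\<mu> * q * f m * k \<le> \<mu> * q * f m * (2 * R powr \<alpha> * ((2 * \<mu>) powr (?N / s0) / R ^ ?N))"
          using far[OF P] \<mu> q1 fm by (intro mult_left_mono) auto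
        also have "\<dots> = 2 * \<mu> * q * f m * R powr \<alpha> * ((2 * \<mu>) powr (?N / s0) / R ^ ?N) * 1" by simp
        also have "\<dots> \<le> ?c" using ind[OF P] \<mu> q1 fm R by (intro mult_left_mono) auto
        finally show ?thesis using gt nn eq le by linarith
      qed
      \<comment> \<open>The last two cases contradict \<open>W x \<noteq> W y\<close>, since
        \<open>W\<close> is constant on \<open>E\<close> and on \<open>F\<close>.\<close>
      consider "x \<in> D" | "y \<in> D" | "x \<in> E" "y \<in> F" | "x \<in> F" "y \<in> E" | "x \<in> E" "y \<in> E" | "x \<in> F" "y \<in> F"
        using xy by (force simp: D_def E_def F_def)
      then show ?thesis
      proof cases
        case 1
        then have "\<mu> * q * f m * k = ?b" by (simp add: k_def h_def)
        then show ?thesis using gt nn eq le by linarith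
      next
        case 2
        then have "\<mu> * q * f m * k = ?b'" by (simp add: k_def h_def norm_minus_commute)
        then show ?thesis using gt nn eq le by linarith
      next
        case 5
        then have "W x = W y"
          using lk \<kappa> unfolding W_def E_def a_def[symmetric] by (auto simp: min_def max_def)
        then show ?thesis using \<open>W x \<noteq> W y\<close> by simp
      next
        case 6
        then have "W x = W y"
          using lk \<kappa> unfolding W_def F_def a_def[symmetric] by (auto simp: min_def max_def)
        then show ?thesis using \<open>W x \<noteq> W y\<close> by simp
      next
        case 3
        then show ?thesis using pairs by blast
      next
        case 4
        then show ?thesis using pairs by blast
      qed
    qed
  qed
qed

text \<open>A quantitative form of De Giorgi's isoperimetric inequality. On \<open>E\<close> and
  \<open>F\<close> the function \<open>W\<close> takes its two extreme values, so the product of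
  their measures is bounded by the integral of the differences of \<open>W\<close>, and this by the
  three contributions of \<open>shrink_pointwise\<close>. Choosing first \<open>\<mu>\<close> large
  and then \<open>l\<close> small leaves the measure of the layer between the levels as the only
  term that can be large.\<close>

lemma shrink_step:
  fixes u :: "'a::euclidean_space \<Rightarrow> real"
  assumes [measurable]: "u \<in> borel_measurable borel" and u: "\<And>y. y \<in> ball z R \<Longrightarrow> 0 \<le> u y"
    and R: "0 < R" "R / 2 \<le> r" "r \<le> 3 * R / 4" and l: "0 < l" "l \<le> 1/4" and \<kappa>: "0 < \<kappa>" and \<mu>: "1 \<le> \<mu>" and c: "0 < c"
    and lower: "lower_class q c s f g u z R"
    and tail: "tail_int s g z UNIV (\<lambda>y. max (- u y) 0) \<le> ennreal (R powr (- s) * g (l * \<kappa> / R powr s))"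
  shows "measure lborel {y \<in> ball z r. u y < l * \<kappa>} * measure lborel {y \<in> ball z r. \<kappa> \<le> u y}
    \<le> shrink_const c DIM('a) * ((R ^ DIM('a))\<^sup>2 * (\<mu> powr (1 - p) + \<mu> * (2 * \<mu>) powr (DIM('a) / s0) * l powr (p - 1))
       + \<mu> * R ^ DIM('a) * measure lborel {y \<in> ball z r. l * \<kappa> \<le> u y \<and> u y < \<kappa>})"
proof -
  let ?N = "DIM('a)" and ?B = "ball z r"
  define m where "m = \<kappa> / R powr s"
  define v where "v = (\<lambda>y. max (\<kappa> - u y) 0)"
  define W where "W = (\<lambda>y. min (max (\<kappa> - u y) 0) (\<kappa> - l * \<kappa>))"
  define E where "E = {y \<in> ball z r. u y < l * \<kappa>}"
  define F where "F = {y \<in> ball z r. \<kappa> \<le> u y}"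
  define D where "D = {y \<in> ball z r. l * \<kappa> \<le> u y \<and> u y < \<kappa>}"
  have [measurable]: "v \<in> borel_measurable borel" "W \<in> borel_measurable borel"
    "E \<in> sets borel" "F \<in> sets borel" "D \<in> sets borel"
    unfolding v_def W_def E_def F_def D_def by measurable
  have rR: "0 < r" "r < R" "r \<le> R" using R by auto
  have m: "0 < m" using R \<kappa> by (simp add: m_def)
  have gm: "0 < g m" "0 < f m" using g_pos f_pos m by auto
  define a where "a = l * \<kappa>"
  have lk: "0 < l * \<kappa>" "l * \<kappa> \<le> \<kappa> / 4" and lk': "0 < a" "a \<le> \<kappa> / 4" using l \<kappa> by (auto simp: a_def)
  have fin: "emeasure lborel E = ennreal (measure lborel E)" "emeasure lborel F = ennreal (measure lborel F)" "emeasure lborel D = ennreal (measure lborel D)"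
    by (rule emeasure_subset_ball[of _ z r]; auto simp: E_def F_def D_def)+
  define e where "e = measure lborel E * measure lborel F"
  have EF: "double_int ?B (\<lambda>x y. indicator E x * indicator F y) = ennreal e"
  proof -
    have "E \<subseteq> ?B" "F \<subseteq> ?B" by (auto simp: E_def F_def)
    then have "double_int ?B (\<lambda>x y. indicator E x * indicator F y) = emeasure lborel E * emeasure lborel F"
      by (rule double_int_indicator_product) measurable
    then show ?thesis by (simp add: fin e_def ennreal_mult)
  qed
  define C0 where "C0 = rhs_const q s0 c 1 ?N"
  have C0: "0 \<le> C0" unfolding C0_def using c by (intro rhs_const_nonneg) auto
  define C1 where "C1 = C0 * 2 powr q * (2 * q * 4 powr q * 2 ^ ?N)"
  have C1: "0 \<le> C1" using C0 q1 by (simp add: C1_def)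
  have kc: "0 \<le> kernel_const s0 ?N" using s0 by (simp add: kernel_const_def)
  \<comment> \<open>The tail is assumed small at the lowest level \<open>l * \<kappa>\<close>, hence
    at every higher one. This is used at \<open>\<kappa>\<close> for the energy of \<open>v\<close>
    and at \<open>2 * (l * \<kappa>)\<close> for the jumps from \<open>E\<close> to
    \<open>F\<close>.\<close>
  have cacc: "energy s f z r (\<lambda>y. max (k - u y) 0) + cross_term s g z r u k \<le> ennreal (C0 * R ^ ?N * f (k / R powr s))" if "l * \<kappa> \<le> k" for k
  proof -
    have k: "0 < k" using lk that by linarith
    have "tail_int s g z UNIV (\<lambda>y. max (- u y) 0) \<le> ennreal (1 * R powr (- s) * g (k / R powr s))"
      using lk that by (intro order_trans[OF tail] ennreal_leI) (auto intro!: mult_left_mono g_mono divide_right_mono)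
    then have "caccioppoli_rhs q c s f g z r R (\<lambda>y. max (k - u y) 0) \<le> ennreal (C0 * R ^ ?N * f (k / R powr s))"
      unfolding C0_def using u R k c by (intro caccioppoli_rhs_le) auto
    moreover have "energy s f z r (\<lambda>y. max (k - u y) 0) + cross_term s g z r u k \<le> caccioppoli_rhs q c s f g z r R (\<lambda>y. max (k - u y) 0)"
      using lower rR unfolding lower_class_def by auto
    ultimately show ?thesis by simp
  qed
  have energy: "energy s f z r v \<le> ennreal (C0 * R ^ ?N * f m)"
    using order_trans[OF _ cacc[of \<kappa>], of "energy s f z r v"] lk \<kappa> by (simp add: v_def m_def)
  have cross: "(1 - s) * e \<le> C1 * (R ^ ?N)\<^sup>2 * l powr (p - 1)"
    unfolding e_def E_def F_def C1_def mult.assoc[of "1 - s", symmetric]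
  proof (rule cross_levels)
    show "cross_term s g z r u (2 * (l * \<kappa>)) \<le> ennreal (C0 * R ^ ?N * f (2 * (l * \<kappa>) / R powr s))"
    proof -
      have "l * \<kappa> \<le> 2 * (l * \<kappa>)" using lk by linarith
      from cacc[OF this] show ?thesis by (rule order_trans[rotated]) simp
    qed
  qed (use R rR l \<kappa> C0 in auto)
  define k where "k x y = norm (x - y) powr (\<alpha> - ?N)" for x y :: 'a
  define Ek where "Ek x y = ennreal (f (\<bar>v x - v y\<bar> / norm (x - y) powr s) / norm (x - y) ^ ?N)" for x y
  define V where "V x y = ennreal (\<bar>W x - W y\<bar> * norm (x - y) powr (- (?N + \<sigma>)))" for x y
  have [measurable]: "(\<lambda>(x, y). k x y) \<in> borel_measurable (borel \<Otimes>\<^sub>M borel)"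
     "(\<lambda>(x, y). Ek x y) \<in> borel_measurable (borel \<Otimes>\<^sub>M borel)"
     and Vm [measurable]: "(\<lambda>(x, y). V x y) \<in> borel_measurable (borel \<Otimes>\<^sub>M borel)"
    unfolding k_def Ek_def V_def by measurable
  define A1 where "A1 = 2 * q * \<mu> powr (1 - p) * R powr \<alpha>"
  define A2 where "A2 = \<mu> * q * f m"
  define A3 where "A3 = 2 * \<mu> * q * f m * R powr \<alpha> * ((2 * \<mu>) powr (?N / s0) / R ^ ?N)"
  have A: "0 \<le> A1" "0 \<le> A2" "0 \<le> A3" using q1 \<mu> gm R by (auto simp: A1_def A2_def A3_def)
  define X1 where "X1 x y = ennreal A1 * Ek x y" for x y
  define X2 where "X2 x y = ennreal A2 * (indicator D x * ennreal (k x y))" for x y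
  define X3 where "X3 x y = ennreal A3 * (indicator E x * indicator F y)" for x y :: 'a
  have Xm [measurable]: "(\<lambda>(x, y). X1 x y) \<in> borel_measurable (borel \<Otimes>\<^sub>M borel)"
    "(\<lambda>(x, y). X2 x y) \<in> borel_measurable (borel \<Otimes>\<^sub>M borel)"
    "(\<lambda>(x, y). X3 x y) \<in> borel_measurable (borel \<Otimes>\<^sub>M borel)"
    "(\<lambda>(x, y). X2 y x) \<in> borel_measurable (borel \<Otimes>\<^sub>M borel)"
    "(\<lambda>(x, y). X3 y x) \<in> borel_measurable (borel \<Otimes>\<^sub>M borel)"
    unfolding X1_def X2_def X3_def by measurable
  have pw: "ennreal (g m) * V x y \<le> X1 x y + X2 x y + X2 y x + (X3 x y + X3 y x)" if "x \<in> ?B" "y \<in> ?B" for x y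
  proof -
    have le: "g m * (\<bar>W x - W y\<bar> * norm (x - y) powr (- (?N + \<sigma>)))
      \<le> A1 * (f (\<bar>v x - v y\<bar> / norm (x - y) powr s) / norm (x - y) ^ ?N)
        + A2 * (indicator D x * k x y) + A2 * (indicator D y * k y x)
        + A3 * (indicator E x * indicator F y + indicator F x * indicator E y)"
      unfolding m_def W_def v_def E_def F_def D_def A1_def A2_def A3_def k_def
      by (rule shrink_pointwise[OF R(1) rR(3) l \<kappa> \<mu> that])
    have ind: "ennreal (indicator S w) = indicator S w" for S and w :: 'a by (auto simp: indicator_def)
    have "0 \<le> f (\<bar>v x - v y\<bar> / norm (x - y) powr s) / norm (x - y) ^ ?N" using f_nonneg by simp
    then have "ennreal (A1 * (f (\<bar>v x - v y\<bar> / norm (x - y) powr s) / norm (x - y) ^ ?N)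
        + A2 * (indicator D x * k x y) + A2 * (indicator D y * k y x)
        + A3 * (indicator E x * indicator F y + indicator F x * indicator E y))
        = X1 x y + X2 x y + X2 y x + (X3 x y + X3 y x)"
      using A by (simp add: ennreal_plus ennreal_mult X1_def X2_def X3_def Ek_def k_def ind distrib_left mult_ac del: times_divide_eq_right)
    then show ?thesis using ennreal_leI[OF le] gm by (simp add: V_def ennreal_mult)
  qed
  have "ennreal (g m) * double_int ?B V = double_int ?B (\<lambda>x y. ennreal (g m) * V x y)"
    by (rule double_int_cmult[symmetric]) measurable
  also have "\<dots> \<le> double_int ?B (\<lambda>x y. X1 x y + X2 x y + X2 y x + (X3 x y + X3 y x))"
    by (rule double_int_mono) (rule pw)
  also have "\<dots> = double_int ?B X1 + double_int ?B X2 + double_int ?B X2 + (double_int ?B X3 + double_int ?B X3)"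
  proof -
    have "double_int ?B (\<lambda>x y. X1 x y + X2 x y + X2 y x + (X3 x y + X3 y x))
       = double_int ?B (\<lambda>x y. X1 x y + X2 x y + X2 y x) + double_int ?B (\<lambda>x y. X3 x y + X3 y x)"
      by (rule double_int_add) measurable
    also have "double_int ?B (\<lambda>x y. X3 x y + X3 y x) = double_int ?B X3 + double_int ?B (\<lambda>x y. X3 y x)" by (rule double_int_add) measurable
    also have "double_int ?B (\<lambda>x y. X3 y x) = double_int ?B X3" by (rule double_int_swap) measurable
    also have "double_int ?B (\<lambda>x y. X1 x y + X2 x y + X2 y x) = double_int ?B (\<lambda>x y. X1 x y + X2 x y) + double_int ?B (\<lambda>x y. X2 y x)" by (rule double_int_add) measurable
    also have "double_int ?B (\<lambda>x y. X2 y x) = double_int ?B X2" by (rule double_int_swap) measurable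
    also have "double_int ?B (\<lambda>x y. X1 x y + X2 x y) = double_int ?B X1 + double_int ?B X2" by (rule double_int_add) measurable
    finally show ?thesis .
  qed
  finally have "ennreal (1 - s) * (ennreal (g m) * double_int ?B V) \<le> ennreal (1 - s) * (double_int ?B X1 + double_int ?B X2 + double_int ?B X2 + (double_int ?B X3 + double_int ?B X3))"
    by (rule mult_left_mono) simp
  also have "\<dots> = ennreal (1 - s) * double_int ?B X1 + ennreal (1 - s) * double_int ?B X2 + ennreal (1 - s) * double_int ?B X2 + (ennreal (1 - s) * double_int ?B X3 + ennreal (1 - s) * double_int ?B X3)"
    by (simp add: distrib_left)
  also have "\<dots> \<le> ennreal (A1 * (C0 * R ^ ?N * f m)) + ennreal (A2 * (kernel_const s0 ?N * R powr \<alpha> * measure lborel D))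
     + ennreal (A2 * (kernel_const s0 ?N * R powr \<alpha> * measure lborel D)) + (ennreal (A3 * ((1 - s) * e)) + ennreal (A3 * ((1 - s) * e)))"
  proof -
    have "ennreal (1 - s) * double_int ?B X1 = ennreal A1 * (ennreal (1 - s) * double_int ?B Ek)"
      unfolding X1_def by (subst double_int_cmult) (measurable, simp only: mult_ac)
    also have "ennreal (1 - s) * double_int ?B Ek = energy s f z r v" by (simp add: energy_def Ek_def[abs_def])
    also have "ennreal A1 * \<dots> \<le> ennreal A1 * ennreal (C0 * R ^ ?N * f m)" using energy by (rule mult_left_mono) simp
    finally have 1: "ennreal (1 - s) * double_int ?B X1 \<le> ennreal (A1 * (C0 * R ^ ?N * f m))"
      using A C0 R gm by (simp add: ennreal_mult)
    have "ennreal (1 - s) * double_int ?B X2 = ennreal A2 * (ennreal (1 - s) * double_int ?B (\<lambda>x y. indicator D x * ennreal (k x y)))"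
      unfolding X2_def by (subst double_int_cmult) (measurable, simp only: mult_ac)
    also have "\<dots> \<le> ennreal A2 * (ennreal (kernel_const s0 ?N * R powr \<alpha>) * (\<integral>\<^sup>+x\<in>?B. indicator D x \<partial>lborel))"
      unfolding k_def using R rR by (intro mult_left_mono double_int_kernel_le) auto
    also have "(\<integral>\<^sup>+x\<in>?B. indicator D x \<partial>lborel) = (\<integral>\<^sup>+x. indicator D x \<partial>lborel)"
      by (intro nn_integral_cong) (auto simp: D_def indicator_def)
    finally have 2: "ennreal (1 - s) * double_int ?B X2 \<le> ennreal (A2 * (kernel_const s0 ?N * R powr \<alpha> * measure lborel D))"
      using A kc by (simp add: fin ennreal_mult mult.assoc)
    have "ennreal (1 - s) * double_int ?B X3 = ennreal A3 * (ennreal (1 - s) * double_int ?B (\<lambda>x y. indicator E x * indicator F y))"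
      unfolding X3_def by (subst double_int_cmult) (measurable, simp only: mult_ac)
    also have "double_int ?B (\<lambda>x y. indicator E x * indicator F y) = ennreal e"
      by (rule EF)
    finally have 3: "ennreal (1 - s) * double_int ?B X3 = ennreal (A3 * ((1 - s) * e))"
      using A s1 by (simp add: e_def ennreal_mult)
    show ?thesis using 1 2 3 by (intro add_mono) auto
  qed
  also have "\<dots> = ennreal (A1 * (C0 * R ^ ?N * f m) + 2 * (A2 * (kernel_const s0 ?N * R powr \<alpha> * measure lborel D)) + 2 * (A3 * ((1 - s) * e)))"
    using A C0 kc R gm s1 by (simp add: e_def ennreal_plus[symmetric] del: ennreal_plus)
  also have "\<dots> \<le> ennreal (A1 * (C0 * R ^ ?N * f m) + 2 * (A2 * (kernel_const s0 ?N * R powr \<alpha> * measure lborel D)) + 2 * (A3 * (C1 * (R ^ ?N)\<^sup>2 * l powr (p - 1))))"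
    using cross A by (intro ennreal_leI add_left_mono mult_left_mono) auto
  also have "\<dots> = ennreal (R powr \<alpha> * f m * R ^ ?N * (2 * q * C0 * \<mu> powr (1 - p)) + R powr \<alpha> * f m * (2 * \<mu> * q * kernel_const s0 ?N * measure lborel D)
      + R powr \<alpha> * f m * R ^ ?N * (4 * q * C1 * (\<mu> * (2 * \<mu>) powr (?N / s0) * l powr (p - 1))))"
    using R by (intro arg_cong[where f=ennreal]) (simp add: A1_def A2_def A3_def power2_eq_square field_simps)
  finally have up: "ennreal (1 - s) * (ennreal (g m) * double_int ?B V) \<le> \<dots>" .
  define S where "S = 4 * q * (C0 + kernel_const s0 ?N + C1)"
  have S: "2 * q * C0 \<le> S" "2 * q * kernel_const s0 ?N \<le> S" "4 * q * C1 \<le> S" "0 \<le> S"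
    using C0 C1 kc q1 by (auto simp: S_def algebra_simps add_nonneg_nonneg)
  define Z where "Z = R ^ ?N * (\<mu> powr (1 - p) + \<mu> * (2 * \<mu>) powr (?N / s0) * l powr (p - 1)) + \<mu> * measure lborel D"
  have Z: "0 \<le> Z" using R \<mu> by (simp add: Z_def)
  have up2: "ennreal (1 - s) * (ennreal (g m) * double_int ?B V) \<le> ennreal (R powr \<alpha> * f m * (S * Z))"
  proof (rule order_trans[OF up], rule ennreal_leI)
    have "R ^ ?N * (2 * q * C0 * \<mu> powr (1 - p)) + 2 * \<mu> * q * kernel_const s0 ?N * measure lborel D + R ^ ?N * (4 * q * C1 * (\<mu> * (2 * \<mu>) powr (?N / s0) * l powr (p - 1)))
      \<le> R ^ ?N * (S * \<mu> powr (1 - p)) + S * (\<mu> * measure lborel D) + R ^ ?N * (S * (\<mu> * (2 * \<mu>) powr (?N / s0) * l powr (p - 1)))"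
    proof (intro add_mono mult_left_mono mult_right_mono S)
      have "2 * \<mu> * q * kernel_const s0 ?N * measure lborel D = (2 * q * kernel_const s0 ?N) * (\<mu> * measure lborel D)" by simp
      also have "\<dots> \<le> S * (\<mu> * measure lborel D)" using S \<mu> by (intro mult_right_mono) auto
      finally show "2 * \<mu> * q * kernel_const s0 ?N * measure lborel D \<le> S * (\<mu> * measure lborel D)" .
    qed (use R \<mu> in auto)
    also have "\<dots> = S * Z" by (simp add: Z_def algebra_simps)
    finally have "R powr \<alpha> * f m * (R ^ ?N * (2 * q * C0 * \<mu> powr (1 - p)) + 2 * \<mu> * q * kernel_const s0 ?N * measure lborel D + R ^ ?N * (4 * q * C1 * (\<mu> * (2 * \<mu>) powr (?N / s0) * l powr (p - 1))))
       \<le> R powr \<alpha> * f m * (S * Z)" using gm by (intro mult_left_mono) auto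
    then show "R powr \<alpha> * f m * R ^ ?N * (2 * q * C0 * \<mu> powr (1 - p)) + R powr \<alpha> * f m * (2 * \<mu> * q * kernel_const s0 ?N * measure lborel D)
      + R powr \<alpha> * f m * R ^ ?N * (4 * q * C1 * (\<mu> * (2 * \<mu>) powr (?N / s0) * l powr (p - 1))) \<le> R powr \<alpha> * f m * (S * Z)"
      by (simp add: distrib_left mult.assoc)
  qed
  \<comment> \<open>The scale \<open>2 * R\<close> exceeds every distance in the ball, so the
    cut-off removes nothing. Between \<open>E\<close> and \<open>F\<close> the function
    \<open>W\<close> changes by \<open>\<kappa> - l * \<kappa>\<close>, which is at least
    \<open>3 / 4 * \<kappa>\<close>.\<close>
  have "ennreal (g m) * ennreal (3 / 4 * \<kappa> * e) \<le> ennreal (g m) * double_int ?B (\<lambda>x y. ennreal \<bar>W x - W y\<bar> * indicator {..<2 * R} (norm (x - y)))"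
  proof (rule mult_left_mono)
    have "ennreal (3 / 4 * \<kappa> * e) = ennreal (3 / 4 * \<kappa>) * double_int ?B (\<lambda>x y. indicator E x * indicator F y)"
      unfolding EF e_def using \<kappa> by (intro ennreal_mult) auto
    also have "\<dots> = double_int ?B (\<lambda>x y. ennreal (3 / 4 * \<kappa>) * (indicator E x * indicator F y))"
      by (rule double_int_cmult[symmetric]) measurable
    also have "\<dots> \<le> double_int ?B (\<lambda>x y. ennreal \<bar>W x - W y\<bar> * indicator {..<2 * R} (norm (x - y)))"
    proof (rule double_int_mono)
      fix x y assume xy: "x \<in> ?B" "y \<in> ?B"
      show "ennreal (3 / 4 * \<kappa>) * (indicator E x * indicator F y) \<le> ennreal \<bar>W x - W y\<bar> * indicator {..<2 * R} (norm (x - y))"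
      proof (cases "x \<in> E \<and> y \<in> F")
        case True
        have "norm (x - y) < 2 * R" using xy rR dist_triangle[of x y z] by (simp add: dist_commute dist_norm[of x y, symmetric])
        moreover have "3 / 4 * \<kappa> \<le> \<bar>W x - W y\<bar>" using True lk' unfolding W_def E_def F_def a_def[symmetric] by (auto simp: min_def max_def)
        ultimately show ?thesis using True by (simp add: ennreal_leI)
      qed auto
    qed
    finally show "ennreal (3 / 4 * \<kappa> * e) \<le> \<dots>" .
  qed simp
  also have "\<dots> \<le> ennreal (g m) * (ennreal (2 * (2 * R) powr (?N + \<sigma>) * (1 - \<sigma>)) * double_int ?B V)"
    unfolding V_def using \<sigma> R by (intro mult_left_mono double_int_diff_le_kernel) auto
  also have "\<dots> \<le> ennreal (g m) * (ennreal (2 ^ (?N + 3) * R powr (?N + \<sigma>) * (1 - s)) * double_int ?B V)"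
  proof (intro mult_left_mono mult_right_mono ennreal_leI)
    have "2 powr (?N + \<sigma>) \<le> 2 powr (?N + 1)" using \<sigma> by (intro powr_mono) auto
    also have "\<dots> = 2 ^ (?N + 1)" by (simp add: powr_add powr_realpow)
    finally have "2 * (2 * R) powr (?N + \<sigma>) * (1 - \<sigma>) \<le> 2 * (2 ^ (?N + 1) * R powr (?N + \<sigma>)) * (2 * (1 - s))"
      using R \<sigma> by (intro mult_mono) (auto simp: powr_mult)
    also have "2 * (2 ^ (?N + 1) * R powr (?N + \<sigma>)) * (2 * (1 - s)) = 2 ^ (?N + 3) * R powr (?N + \<sigma>) * (1 - s)"
      by (simp add: power_add algebra_simps)
    finally show "2 * (2 * R) powr (?N + \<sigma>) * (1 - \<sigma>) \<le> 2 ^ (?N + 3) * R powr (?N + \<sigma>) * (1 - s)" .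
  qed auto
  also have "\<dots> = ennreal (2 ^ (?N + 3) * R powr (?N + \<sigma>)) * (ennreal (1 - s) * (ennreal (g m) * double_int ?B V))"
    using s1 by (simp add: ennreal_mult mult_ac)
  also have "\<dots> \<le> ennreal (2 ^ (?N + 3) * R powr (?N + \<sigma>)) * ennreal (R powr \<alpha> * f m * (S * Z))"
    using up2 by (intro mult_left_mono) auto
  finally have fin: "ennreal (g m) * ennreal (3 / 4 * \<kappa> * e) \<le> ennreal (2 ^ (?N + 3) * R powr (?N + \<sigma>)) * ennreal (R powr \<alpha> * f m * (S * Z))" .
  have nn: "0 \<le> g m" "0 \<le> 3 / 4 * \<kappa> * e" "0 \<le> 2 ^ (?N + 3) * R powr (?N + \<sigma>)" "0 \<le> R powr \<alpha> * f m * (S * Z)"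
    using gm S Z \<kappa> by (auto simp: e_def)
  have "ennreal (g m * (3 / 4 * \<kappa> * e)) \<le> ennreal (2 ^ (?N + 3) * R powr (?N + \<sigma>) * (R powr \<alpha> * f m * (S * Z)))"
    using fin by (simp only: ennreal_mult[OF nn(1,2)] ennreal_mult[OF nn(3,4)])
  then have "g m * (3 / 4 * \<kappa> * e) \<le> 2 ^ (?N + 3) * R powr (?N + \<sigma>) * (R powr \<alpha> * f m * (S * Z))"
    using gm S Z by (simp add: ennreal_le_iff)
  also have "\<dots> = 2 ^ (?N + 3) * (R powr (?N + \<sigma>) * R powr \<alpha>) * f m * (S * Z)" by simp
  also have "R powr (?N + \<sigma>) * R powr \<alpha> = R ^ ?N * R powr s"
    using R by (simp add: powr_add[symmetric] powr_realpow[symmetric] \<sigma>_def)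
  also have "2 ^ (?N + 3) * (R ^ ?N * R powr s) * f m * (S * Z) \<le> 2 ^ (?N + 3) * (R ^ ?N * R powr s) * (m * g m) * (S * Z)"
    using f_le_tg[of m] m R S Z by (intro mult_right_mono mult_left_mono) auto
  also have "\<dots> = g m * \<kappa> * (2 ^ (?N + 3) * R ^ ?N * (S * Z))" using R by (simp add: m_def)
  finally have "(g m * \<kappa>) * (3 / 4 * e) \<le> (g m * \<kappa>) * (2 ^ (?N + 3) * R ^ ?N * (S * Z))" by (simp add: mult_ac)
  then have "3 / 4 * e \<le> 2 ^ (?N + 3) * R ^ ?N * (S * Z)" using gm \<kappa> by simp
  then have "e \<le> 4 / 3 * (2 ^ (?N + 3) * R ^ ?N * (S * Z))" by simp
  also have "\<dots> \<le> 2 * (2 ^ (?N + 3) * R ^ ?N * (S * Z))" using R S Z by (intro mult_right_mono) auto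
  also have "\<dots> = 2 ^ (?N + 4) * S * (R ^ ?N * Z)" by (simp add: power_add)
  also have "R ^ ?N * Z = (R ^ ?N)\<^sup>2 * (\<mu> powr (1 - p) + \<mu> * (2 * \<mu>) powr (?N / s0) * l powr (p - 1)) + \<mu> * R ^ ?N * measure lborel D"
    by (simp add: Z_def power2_eq_square algebra_simps)
  finally show ?thesis unfolding e_def E_def F_def D_def S_def shrink_const_def C1_def C0_def .
qed

end

lemma measure_mono_subset_ball:
  fixes A B :: "'a::euclidean_space set"
  assumes "A \<subseteq> B" "B \<subseteq> ball z r" "B \<in> sets borel"
  shows "measure lborel A \<le> measure lborel B"
  unfolding measure_def using assms emeasure_subset_ball[OF assms(2)]
  by (intro enn2real_mono emeasure_mono) auto

text \<open>If the set below the lowest level were larger than claimed, then so would be the sets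
  below all the intermediate levels \<open>l ^ j * k\<close>. By \<open>shrink_step\<close> each of
  the \<open>J\<close> layers between consecutive levels would have measure above
  \<open>\<epsilon> * R ^ d\<close>. These layers are disjoint, and the ball has no room for
  them.\<close>

lemma measure_shrinking:
  fixes p q s0 c \<delta> \<nu> :: real
  assumes pq: "1 < p" "p \<le> q" and s0: "0 < s0" and c: "0 < c" and \<delta>: "0 < \<delta>" and \<nu>: "0 < \<nu>"
  obtains \<eta> where "0 < \<eta>" "\<eta> \<le> 1"
    "\<And>s f g (u :: 'a::euclidean_space \<Rightarrow> real) z R k. orlicz p q s0 s f g \<Longrightarrow> u \<in> borel_measurable borel \<Longrightarrow>
      (\<And>y. y \<in> ball z R \<Longrightarrow> 0 \<le> u y) \<Longrightarrow> 0 < R \<Longrightarrow> 0 < k \<Longrightarrow> lower_class q c s f g u z R \<Longrightarrow>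
      \<delta> * R ^ DIM('a) \<le> measure lborel {y \<in> ball z (2 * R / 3). k \<le> u y} \<Longrightarrow>
      tail_int s g z UNIV (\<lambda>y. max (- u y) 0) \<le> ennreal (R powr (- s) * g (\<eta> * k / R powr s)) \<Longrightarrow>
      measure lborel {y \<in> ball z (2 * R / 3). u y < \<eta> * k} \<le> \<nu> * R ^ DIM('a)"
proof -
  let ?N = "DIM('a)"
  \<comment> \<open>Outside the locale no instance is at hand to show that
    \<open>shrink_const\<close> is nonnegative; the absolute value and \<open>+ 1\<close> supply a
    positive bound.\<close>
  define C where "C = \<bar>orlicz.shrink_const q s0 c ?N\<bar> + 1"
  have C: "0 < C" "orlicz.shrink_const q s0 c ?N \<le> C" by (auto simp: C_def)
  define a where "a = \<delta> * \<nu> / (3 * C)"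
  have a: "0 < a" using \<delta> \<nu> C by (simp add: a_def)
  \<comment> \<open>The product \<open>\<delta> * \<nu>\<close> is divided into thirds. First
    \<open>\<mu>\<close> makes the absorbed pairs cost at most one third, then \<open>l\<close>
    beats the powers of \<open>\<mu>\<close> in the jump term; the last third must come from the
    layer, and gives \<open>\<epsilon>\<close>.\<close>
  define \<mu> where "\<mu> = max 1 (a powr (1 / (1 - p)))"
  have \<mu>: "1 \<le> \<mu>" "C * \<mu> powr (1 - p) \<le> \<delta> * \<nu> / 3"
  proof -
    have "\<mu> powr (1 - p) \<le> (a powr (1 / (1 - p))) powr (1 - p)"
      using a pq by (intro powr_mono2') (auto simp: \<mu>_def)
    also have "\<dots> = a" using a pq by (simp add: powr_powr)
    finally show "C * \<mu> powr (1 - p) \<le> \<delta> * \<nu> / 3" using C by (simp add: a_def field_simps)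
  qed (simp add: \<mu>_def)
  define b where "b = a / (\<mu> * (2 * \<mu>) powr (?N / s0))"
  have b: "0 < b" using a \<mu> by (simp add: b_def)
  define l where "l = min (1/4) (b powr (1 / (p - 1)))"
  have l: "0 < l" "l \<le> 1/4" "C * (\<mu> * (2 * \<mu>) powr (?N / s0) * l powr (p - 1)) \<le> \<delta> * \<nu> / 3"
  proof -
    have "l powr (p - 1) \<le> (b powr (1 / (p - 1))) powr (p - 1)"
      using b pq by (intro powr_mono2) (auto simp: l_def)
    also have "\<dots> = b" using b pq by (simp add: powr_powr)
    finally have "\<mu> * (2 * \<mu>) powr (?N / s0) * l powr (p - 1) \<le> \<mu> * (2 * \<mu>) powr (?N / s0) * b"
      using \<mu> by (intro mult_left_mono) auto
    also have "\<dots> = a" using \<mu> by (simp add: b_def)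
    finally have "C * (\<mu> * (2 * \<mu>) powr (?N / s0) * l powr (p - 1)) \<le> C * a" using C by (intro mult_left_mono) auto
    then show "C * (\<mu> * (2 * \<mu>) powr (?N / s0) * l powr (p - 1)) \<le> \<delta> * \<nu> / 3" using C by (simp add: a_def)
  qed (use b in \<open>auto simp: l_def\<close>)
  define \<epsilon> where "\<epsilon> = a / \<mu>"
  have \<epsilon>: "0 < \<epsilon>" using a \<mu> by (simp add: \<epsilon>_def)
  obtain J :: nat where J: "unit_ball_vol ?N / \<epsilon> < real J" using reals_Archimedean2 by blast
  show thesis
  proof (rule that[of "l ^ J"])
    show "0 < l ^ J" "l ^ J \<le> 1" using l by (auto intro: power_le_one)
    fix s f g and u :: "'a \<Rightarrow> real" and z R k
    assume "orlicz p q s0 s f g" and um [measurable]: "u \<in> borel_measurable borel" and u: "\<And>y. y \<in> ball z R \<Longrightarrow> 0 \<le> u y"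
      and R: "0 < R" and k: "0 < k" and lower: "lower_class q c s f g u z R"
      and big: "\<delta> * R ^ ?N \<le> measure lborel {y \<in> ball z (2 * R / 3). k \<le> u y}"
      and tail: "tail_int s g z UNIV (\<lambda>y. max (- u y) 0) \<le> ennreal (R powr (- s) * g (l ^ J * k / R powr s))"
    interpret orlicz p q s0 s f g by fact
    define r where "r = 2 * R / 3"
    show "measure lborel {y \<in> ball z (2 * R / 3). u y < l ^ J * k} \<le> \<nu> * R ^ ?N"
    proof (rule ccontr)
      assume "\<not> ?thesis"
      then have E: "\<nu> * R ^ ?N < measure lborel {y \<in> ball z r. u y < l ^ J * k}" by (simp add: r_def)
      have fin: "emeasure lborel A \<noteq> top" if "A \<subseteq> ball z r" for A using emeasure_subset_ball[OF that] by simp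
      define D where "D j = {y \<in> ball z r. l ^ Suc j * k \<le> u y \<and> u y < l ^ j * k}" for j
      have [measurable]: "D j \<in> sets borel" for j unfolding D_def by measurable
      have Dj: "\<epsilon> * R ^ ?N < measure lborel (D j)" if j: "j < J" for j
      proof -
        define \<kappa> where "\<kappa> = l ^ j * k"
        have \<kappa>: "0 < \<kappa>" using l k by (simp add: \<kappa>_def)
        have lJ: "l ^ J \<le> l ^ Suc j" using l j by (intro power_decreasing) auto
        have l\<kappa>: "l ^ J * k \<le> l * \<kappa>" using mult_right_mono[OF lJ, of k] k by (simp add: \<kappa>_def mult_ac)
        have \<kappa>k: "\<kappa> \<le> k" using l k by (simp add: \<kappa>_def mult_le_cancel_right1 power_le_one)
        let ?E = "{y \<in> ball z r. u y < l * \<kappa>}" and ?F = "{y \<in> ball z r. \<kappa> \<le> u y}"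
        have 1: "\<nu> * R ^ ?N < measure lborel ?E"
        proof -
          have "measure lborel {y \<in> ball z r. u y < l ^ J * k} \<le> measure lborel ?E"
            using l\<kappa> by (intro measure_mono_subset_ball[of _ _ z r]) auto
          with E show ?thesis by simp
        qed
        have 2: "\<delta> * R ^ ?N \<le> measure lborel ?F"
        proof -
          have "measure lborel {y \<in> ball z r. k \<le> u y} \<le> measure lborel ?F"
            using \<kappa>k by (intro measure_mono_subset_ball[of _ _ z r]) auto
          with big show ?thesis by (simp add: r_def)
        qed
        have "\<nu> * R ^ ?N * (\<delta> * R ^ ?N) < measure lborel ?E * measure lborel ?F"
          using 1 2 \<delta> \<nu> R by (intro mult_less_le_imp_less) auto
        also have "\<dots> \<le> shrink_const c ?N * ((R ^ ?N)\<^sup>2 * (\<mu> powr (1 - p) + \<mu> * (2 * \<mu>) powr (?N / s0) * l powr (p - 1))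
             + \<mu> * R ^ ?N * measure lborel {y \<in> ball z r. l * \<kappa> \<le> u y \<and> u y < \<kappa>})"
        proof (rule shrink_step)
          show "tail_int s g z UNIV (\<lambda>y. max (- u y) 0) \<le> ennreal (R powr (- s) * g (l * \<kappa> / R powr s))"
            using l\<kappa> l k by (intro order_trans[OF tail] ennreal_leI mult_left_mono g_mono divide_right_mono) auto
        qed (use u R l \<kappa> \<mu> c lower in \<open>auto simp: r_def\<close>)
        also have "{y \<in> ball z r. l * \<kappa> \<le> u y \<and> u y < \<kappa>} = D j" by (simp add: D_def \<kappa>_def mult.assoc)
        also have "shrink_const c ?N * ((R ^ ?N)\<^sup>2 * (\<mu> powr (1 - p) + \<mu> * (2 * \<mu>) powr (?N / s0) * l powr (p - 1)) + \<mu> * R ^ ?N * measure lborel (D j))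
           \<le> C * ((R ^ ?N)\<^sup>2 * (\<mu> powr (1 - p) + \<mu> * (2 * \<mu>) powr (?N / s0) * l powr (p - 1)) + \<mu> * R ^ ?N * measure lborel (D j))"
          using C \<mu> R by (intro mult_right_mono) auto
        also have "\<dots> = (R ^ ?N)\<^sup>2 * (C * \<mu> powr (1 - p) + C * (\<mu> * (2 * \<mu>) powr (?N / s0) * l powr (p - 1))) + C * \<mu> * R ^ ?N * measure lborel (D j)"
          by (simp add: algebra_simps)
        also have "\<dots> \<le> (R ^ ?N)\<^sup>2 * (\<delta> * \<nu> / 3 + \<delta> * \<nu> / 3) + C * \<mu> * R ^ ?N * measure lborel (D j)"
          using \<mu> l by (intro add_right_mono mult_left_mono add_mono) auto
        finally have "(R ^ ?N)\<^sup>2 * (\<delta> * \<nu> / 3) < C * \<mu> * R ^ ?N * measure lborel (D j)"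
          by (simp add: power2_eq_square field_simps)
        also have "(R ^ ?N)\<^sup>2 * (\<delta> * \<nu> / 3) = C * \<mu> * R ^ ?N * (\<epsilon> * R ^ ?N)"
          using C \<mu> by (simp add: \<epsilon>_def a_def power2_eq_square)
        finally show ?thesis using C \<mu> R by simp
      qed
      have disj: "disjoint_family_on D {..<J}"
      proof -
        have "D i \<inter> D j = {}" if "i < j" for i j
        proof -
          have "l ^ j \<le> l ^ Suc i" using l that by (intro power_decreasing) auto
          then have "l ^ j * k \<le> l ^ Suc i * k" using k by (intro mult_right_mono) auto
          then show ?thesis by (auto simp: D_def)
        qed
        then show ?thesis unfolding disjoint_family_on_def by (metis Int_commute linorder_neqE_nat)
      qed
      have "ennreal (real J * (\<epsilon> * R ^ ?N)) \<le> ennreal (\<Sum>j<J. measure lborel (D j))"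
        using sum_bounded_below[of "{..<J}" "\<epsilon> * R ^ ?N" "\<lambda>j. measure lborel (D j)"] Dj by (intro ennreal_leI) (auto simp: less_imp_le)
      also have "\<dots> = (\<Sum>j<J. ennreal (measure lborel (D j)))" by simp
      also have "\<dots> = (\<Sum>j<J. emeasure lborel (D j))"
        by (intro sum.cong refl emeasure_subset_ball[symmetric, of _ z r]) (auto simp: D_def)
      also have "\<dots> = emeasure lborel (\<Union>j<J. D j)" using disj by (intro sum_emeasure) auto
      also have "\<dots> \<le> emeasure lborel (ball z r)" by (intro emeasure_mono) (auto simp: D_def)
      also have "\<dots> \<le> ennreal (unit_ball_vol ?N * R ^ ?N)"
        using R by (intro order_trans[OF emeasure_ball_le] ennreal_leI mult_left_mono power_mono) (auto simp: r_def)
      finally have "real J * (\<epsilon> * R ^ ?N) \<le> unit_ball_vol ?N * R ^ ?N" using R by (simp add: ennreal_le_iff)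
      then have "real J * \<epsilon> \<le> unit_ball_vol ?N" using R by (simp add: mult.assoc[symmetric])
      moreover have "unit_ball_vol ?N < real J * \<epsilon>" using J \<epsilon> by (simp add: pos_divide_less_eq)
      ultimately show False by simp
    qed
  qed
qed

subsection \<open>Growth lemma and control of the tail\<close>

text \<open>Shrinking makes \<open>{u < b}\<close> a small part of the ball of radius
  \<open>2 * R / 3\<close>. The De Giorgi iteration for \<open>- u\<close> at the level
  \<open>- b\<close> with height \<open>b / 2\<close> then gives \<open>u \<ge> b / 2\<close> on
  three quarters of that radius, that is on the ball of radius \<open>R / 2\<close>.\<close>

lemma growth:
  fixes p q s0 c \<delta> :: real
  assumes pq: "1 < p" "p \<le> q" and s0: "0 < s0" and c: "0 < c" and \<delta>: "0 < \<delta>"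
  obtains \<eta> where "0 < \<eta>" "\<eta> < 1"
    "\<And>s f g (u :: 'a::euclidean_space \<Rightarrow> real) z R k. orlicz p q s0 s f g \<Longrightarrow> u \<in> borel_measurable borel \<Longrightarrow>
      (\<And>y. y \<in> ball z R \<Longrightarrow> 0 \<le> u y) \<Longrightarrow> 0 < R \<Longrightarrow> 0 < k \<Longrightarrow> lower_class q c s f g u z R \<Longrightarrow>
      \<delta> * R ^ DIM('a) \<le> measure lborel {y \<in> ball z (2 * R / 3). k \<le> u y} \<Longrightarrow>
      tail_int s g z UNIV (\<lambda>y. max (- u y) 0) \<le> ennreal (R powr (- s) * g (\<eta> * k / R powr s)) \<Longrightarrow>
      AE y in lborel. y \<in> ball z (R / 2) \<longrightarrow> \<eta> * k \<le> u y"
proof -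
  let ?N = "DIM('a)"
  have q1: "1 < q" using pq by simp
  define K where "K = q * 2 powr q * (tail_const q s0 ?N + q * 2 powr q)"
  have tc: "0 \<le> tail_const q s0 ?N" using s0 by (simp add: tail_const_def kernel_const_def)
  have K: "0 < K" using q1 tc by (auto simp: K_def intro!: mult_pos_pos add_nonneg_pos)
  obtain \<nu> where \<nu>: "0 < \<nu>" and dg: "\<And>s f g (v :: 'a \<Rightarrow> real) x R k M. orlicz p q s0 s f g \<Longrightarrow> v \<in> borel_measurable borel \<Longrightarrow>
      0 < R \<Longrightarrow> 0 < M \<Longrightarrow>
      (\<And>r \<rho> k. 0 < r \<Longrightarrow> r < \<rho> \<Longrightarrow> \<rho> \<le> R \<Longrightarrow>
        energy s f x r (\<lambda>y. max (v y - k) 0) \<le> caccioppoli_rhs q c s f g x r \<rho> (\<lambda>y. max (v y - k) 0)) \<Longrightarrow>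
      (\<integral>\<^sup>+y\<in>ball x R. ennreal (f (max (v y - k) 0 / R powr s)) \<partial>lborel) \<le> ennreal (\<nu> * f (M / R powr s) * R ^ DIM('a)) \<Longrightarrow>
      tail_int s g x (- ball x (3 * R / 4)) (\<lambda>y. max (v y - k) 0) \<le> ennreal (K * R powr (- s) * g (M / R powr s)) \<Longrightarrow>
      AE y in lborel. y \<in> ball x (3 * R / 4) \<longrightarrow> v y \<le> k + M"
    using de_giorgi[OF pq s0 c K] by blast
  \<comment> \<open>The power of 2/3 converts \<open>R ^ d\<close> into the volume scale of radius
    \<open>2 * R / 3\<close>; the division by \<open>2 powr q\<close> pays for comparing the full
    height \<open>b\<close> of the truncation with the height \<open>b / 2\<close> of the
    iteration.\<close>
  define \<nu>' where "\<nu>' = \<nu> * (2 / 3) ^ ?N / 2 powr q"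
  have \<nu>': "0 < \<nu>'" using \<nu> by (simp add: \<nu>'_def)
  obtain \<eta> where \<eta>: "0 < \<eta>" "\<eta> \<le> 1" and shrink: "\<And>s f g (u :: 'a \<Rightarrow> real) z R k. orlicz p q s0 s f g \<Longrightarrow> u \<in> borel_measurable borel \<Longrightarrow>
      (\<And>y. y \<in> ball z R \<Longrightarrow> 0 \<le> u y) \<Longrightarrow> 0 < R \<Longrightarrow> 0 < k \<Longrightarrow> lower_class q c s f g u z R \<Longrightarrow>
      \<delta> * R ^ DIM('a) \<le> measure lborel {y \<in> ball z (2 * R / 3). k \<le> u y} \<Longrightarrow>
      tail_int s g z UNIV (\<lambda>y. max (- u y) 0) \<le> ennreal (R powr (- s) * g (\<eta> * k / R powr s)) \<Longrightarrow>
      measure lborel {y \<in> ball z (2 * R / 3). u y < \<eta> * k} \<le> \<nu>' * R ^ DIM('a)"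
    using measure_shrinking[OF pq s0 c \<delta> \<nu>'] by blast
  show thesis
  proof (rule that[of "\<eta> / 2"])
    show "0 < \<eta> / 2" "\<eta> / 2 < 1" using \<eta> by auto
    fix s f g and u :: "'a \<Rightarrow> real" and z R k
    assume O: "orlicz p q s0 s f g" and um [measurable]: "u \<in> borel_measurable borel" and u: "\<And>y. y \<in> ball z R \<Longrightarrow> 0 \<le> u y"
      and R: "0 < R" and k: "0 < k" and lower: "lower_class q c s f g u z R"
      and big: "\<delta> * R ^ ?N \<le> measure lborel {y \<in> ball z (2 * R / 3). k \<le> u y}"
      and tail: "tail_int s g z UNIV (\<lambda>y. max (- u y) 0) \<le> ennreal (R powr (- s) * g (\<eta> / 2 * k / R powr s))"
    interpret orlicz p q s0 s f g by fact
    define b where "b = \<eta> * k"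
    have b: "0 < b" using \<eta> k by (simp add: b_def)
    have tailb: "tail_int s g z UNIV (\<lambda>y. max (- u y) 0) \<le> ennreal (R powr (- s) * g (b / R powr s))"
      using b by (intro order_trans[OF tail] ennreal_leI mult_left_mono g_mono divide_right_mono) (auto simp: b_def[symmetric])
    have small: "measure lborel {y \<in> ball z (2 * R / 3). u y < b} \<le> \<nu>' * R ^ ?N"
      unfolding b_def using tailb by (intro shrink[OF O um u R k lower big]) (auto simp: b_def)
    define \<rho> where "\<rho> = 2 * R / 3"
    have \<rho>: "0 < \<rho>" "\<rho> \<le> R" "3 * \<rho> / 4 = R / 2" using R by (auto simp: \<rho>_def)
    define m where "m = b / 2 / \<rho> powr s"
    have m: "0 < m" "b / \<rho> powr s = 2 * m" using b \<rho> by (auto simp: m_def)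
    have "AE y in lborel. y \<in> ball z (3 * \<rho> / 4) \<longrightarrow> - u y \<le> - b + b / 2"
    proof (rule dg[OF O, where R = \<rho>])
      fix r \<rho>' k assume "0 < r" "r < \<rho>'" "\<rho>' \<le> \<rho>"
      then have "energy s f z r (\<lambda>y. max (- k - u y) 0) + cross_term s g z r u (- k) \<le> caccioppoli_rhs q c s f g z r \<rho>' (\<lambda>y. max (- k - u y) 0)"
        using lower \<rho> unfolding lower_class_def by auto
      then have "energy s f z r (\<lambda>y. max (- k - u y) 0) \<le> caccioppoli_rhs q c s f g z r \<rho>' (\<lambda>y. max (- k - u y) 0)"
        by (rule order_trans[rotated]) simp
      then show "energy s f z r (\<lambda>y. max (- u y - k) 0) \<le> caccioppoli_rhs q c s f g z r \<rho>' (\<lambda>y. max (- u y - k) 0)"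
        by (simp only: minus_diff_commute)
    next
      have "(\<integral>\<^sup>+y\<in>ball z \<rho>. ennreal (f (max (- u y - - b) 0 / \<rho> powr s)) \<partial>lborel)
        \<le> (\<integral>\<^sup>+y. ennreal (f (2 * m)) * indicator {y \<in> ball z \<rho>. u y < b} y \<partial>lborel)"
      proof (rule nn_integral_mono)
        fix y
        show "ennreal (f (max (- u y - - b) 0 / \<rho> powr s)) * indicator (ball z \<rho>) y \<le> ennreal (f (2 * m)) * indicator {y \<in> ball z \<rho>. u y < b} y"
        proof (cases "y \<in> ball z \<rho>")
          case True
          then have "0 \<le> u y" using u[of y] \<rho> by auto
          then show ?thesis using True b by (cases "u y < b") (auto simp: m(2)[symmetric] f_0 intro!: ennreal_leI f_mono divide_right_mono)
        qed simp
      qed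
      also have "\<dots> = ennreal (f (2 * m)) * emeasure lborel {y \<in> ball z \<rho>. u y < b}"
        by (rule nn_integral_cmult_indicator) measurable
      also have "emeasure lborel {y \<in> ball z \<rho>. u y < b} = ennreal (measure lborel {y \<in> ball z \<rho>. u y < b})"
        by (rule emeasure_subset_ball[of _ z \<rho>]) auto
      also have "ennreal (f (2 * m)) * \<dots> \<le> ennreal (2 powr q * f m) * ennreal (\<nu>' * R ^ ?N)"
        using small m f_scale_upper[of 2 m] unfolding \<rho>_def by (intro mult_mono ennreal_leI) auto
      also have "\<dots> = ennreal (\<nu> * f (b / 2 / \<rho> powr s) * \<rho> ^ ?N)"
        unfolding m_def[symmetric] using \<nu> m(1) R f_nonneg[of m]
        by (simp add: \<nu>'_def ennreal_mult[symmetric] \<rho>_def power_mult_distrib power_divide mult_ac)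
      finally show "(\<integral>\<^sup>+y\<in>ball z \<rho>. ennreal (f (max (- u y - - b) 0 / \<rho> powr s)) \<partial>lborel) \<le> ennreal (\<nu> * f (b / 2 / \<rho> powr s) * \<rho> ^ ?N)" .
    next
      have "tail_int s g z (- ball z (3 * \<rho> / 4)) (\<lambda>y. max (- u y - - b) 0)
         \<le> ennreal (tail_const q s0 ?N * \<rho> powr (- s) * g (b / \<rho> powr s))
           + ennreal (q * 2 powr q) * tail_int s g z (- ball z (3 * \<rho> / 4)) (\<lambda>y. max (- u y) 0)"
        using \<rho> b by (intro tail_bound) auto
      also have "tail_int s g z (- ball z (3 * \<rho> / 4)) (\<lambda>y. max (- u y) 0) \<le> tail_int s g z UNIV (\<lambda>y. max (- u y) 0)"
        by (intro tail_int_mono) auto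
      also have "\<dots> \<le> ennreal (R powr (- s) * g (b / R powr s))" by (rule tailb)
      also have "\<dots> \<le> ennreal (\<rho> powr (- s) * g (b / \<rho> powr s))"
      proof (intro ennreal_leI mult_mono g_mono)
        have "\<rho> powr s \<le> R powr s" using \<rho> s_pos by (intro powr_mono2) auto
        then show "b / R powr s \<le> b / \<rho> powr s" using \<rho> b by (intro divide_left_mono) auto
        show "R powr (- s) \<le> \<rho> powr (- s)" using \<rho> s_pos by (intro powr_mono2') auto
      qed (use b g_nonneg in auto)
      finally have "tail_int s g z (- ball z (3 * \<rho> / 4)) (\<lambda>y. max (- u y - - b) 0)
         \<le> ennreal (tail_const q s0 ?N * \<rho> powr (- s) * g (2 * m)) + ennreal (q * 2 powr q) * ennreal (\<rho> powr (- s) * g (2 * m))"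
        by (simp add: m add_left_mono mult_left_mono)
      also have "\<dots> = ennreal ((tail_const q s0 ?N + q * 2 powr q) * \<rho> powr (- s) * g (2 * m))"
        using tc q1 m g_nonneg[of "2 * m"] by (simp add: ennreal_mult[symmetric] ennreal_plus[symmetric] algebra_simps del: ennreal_plus)
      also have "\<dots> \<le> ennreal ((tail_const q s0 ?N + q * 2 powr q) * \<rho> powr (- s) * (q * 2 powr q * g m))"
        using tc q1 m g_two[of m] by (intro ennreal_leI mult_left_mono) auto
      also have "\<dots> = ennreal (K * \<rho> powr (- s) * g (b / 2 / \<rho> powr s))" by (simp add: K_def m_def mult_ac)
      finally show "tail_int s g z (- ball z (3 * \<rho> / 4)) (\<lambda>y. max (- u y - - b) 0) \<le> ennreal (K * \<rho> powr (- s) * g (b / 2 / \<rho> powr s))" .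
    qed (use b \<rho> in auto)
    then show "AE y in lborel. y \<in> ball z (R / 2) \<longrightarrow> \<eta> / 2 * k \<le> u y"
      unfolding \<rho>(3) by (rule AE_mp) (auto simp: b_def)
  qed
qed

section \<open>Comparison of tails\<close>

context orlicz begin

text \<open>For \<open>a\<close> in the ball and \<open>y\<close> outside,
  \<open>norm (a - y) \<le> 2 * norm (y - x)\<close>, so the kernel centred at \<open>x\<close> may
  be replaced by the one centred at \<open>a\<close>. The product of the two integrals is thereby
  dominated by a double integral of the form of the cross term. In this way a Caccioppoli inequality
  for truncations from below carries information about the tail of \<open>u\<close> from
  above.\<close>

lemma tail_upper:
  fixes u :: "'a::euclidean_space \<Rightarrow> real"
  assumes [measurable]: "u \<in> borel_measurable borel" and r: "0 < r"
  shows "(\<integral>\<^sup>+a\<in>ball x r. ennreal (max (k - u a) 0) \<partial>lborel) * tail_int s g x (- ball x r) (\<lambda>y. max (u y - k) 0)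
     \<le> ennreal (q * 2 powr q * 2 ^ (DIM('a) + 1)) * cross_term s g x r u k"
proof -
  let ?N = "DIM('a)"
  define C where "C = q * 2 powr q * 2 ^ (?N + 1)"
  have C: "0 < C" using q1 by (simp add: C_def)
  define P where "P a = ennreal (max (k - u a) 0) * indicator (ball x r) a" for a
  define Q where "Q y = ennreal (g (max (u y - k) 0 / norm (y - x) powr s) / norm (y - x) powr (real ?N + s)) * indicator (- ball x r) y" for y
  have [measurable]: "P \<in> borel_measurable borel" "Q \<in> borel_measurable borel" unfolding P_def Q_def by measurable
  define X where "X a b = ennreal (g (max (u b - k) 0 / norm (a - b) powr s) * (max (k - u a) 0 / norm (a - b) powr s) / norm (a - b) ^ ?N) * indicator (ball x r) a" for a b
  have pw: "P a * Q y \<le> ennreal C * X a y" for a y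
  proof (cases "a \<in> ball x r \<and> y \<notin> ball x r")
    case True
    define h where "h = norm (a - y)"
    define l where "l = norm (y - x)"
    have l: "r \<le> l" "0 < l" using True r by (auto simp: l_def dist_norm norm_minus_commute)
    have "a \<noteq> y" using True by auto
    then have h: "0 < h" by (simp add: h_def)
    have hl: "h \<le> 2 * l"
    proof -
      have "h \<le> norm (a - x) + l" unfolding h_def l_def using norm_triangle_ineq4[of "a - x" "y - x"] by simp
      moreover have "norm (a - x) < r" using True by (simp add: dist_norm norm_minus_commute)
      ultimately show ?thesis using l by linarith
    qed
    have hs: "h powr s \<le> 2 * l powr s" using h hl l by (intro powr_s_le) auto
    define U where "U = max (u y - k) 0"
    define V where "V = max (k - u a) 0"
    have UV: "0 \<le> U" "0 \<le> V" by (auto simp: U_def V_def)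
    have "U / l powr s \<le> 2 * (U / h powr s)" using hs h l UV by (simp add: field_simps mult_left_mono)
    then have "g (U / l powr s) \<le> g (2 * (U / h powr s))" using UV by (intro g_mono) auto
    also have "\<dots> \<le> q * 2 powr q * g (U / h powr s)" using UV by (intro g_two) auto
    finally have 1: "g (U / l powr s) \<le> q * 2 powr q * g (U / h powr s)" .
    have 2: "1 / l powr (real ?N + s) \<le> 2 ^ (?N + 1) * (1 / h powr s / h ^ ?N)"
    proof -
      have "h ^ ?N \<le> 2 ^ ?N * l ^ ?N" using power_mono[OF hl, of ?N] h by (simp add: power_mult_distrib)
      then have "h powr s * h ^ ?N \<le> 2 * l powr s * (2 ^ ?N * l ^ ?N)" using hs h by (intro mult_mono) auto
      also have "\<dots> = 2 ^ (?N + 1) * l powr (real ?N + s)" using l by (simp add: powr_add powr_realpow)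
      finally show ?thesis using h l by (simp add: field_simps)
    qed
    have "V * (g (U / l powr s) / l powr (real ?N + s)) = V * g (U / l powr s) * (1 / l powr (real ?N + s))" by simp
    also have "\<dots> \<le> V * (q * 2 powr q * g (U / h powr s)) * (2 ^ (?N + 1) * (1 / h powr s / h ^ ?N))"
      using UV g_nonneg[of "U / h powr s"] q1 by (intro mult_mono[OF mult_left_mono[OF 1] 2]) auto
    also have "\<dots> = C * (g (U / h powr s) * (V / h powr s) / h ^ ?N)" by (simp add: C_def)
    finally have le: "V * (g (U / l powr s) / l powr (real ?N + s)) \<le> C * (g (U / h powr s) * (V / h powr s) / h ^ ?N)" .
    have nn: "0 \<le> g (U / l powr s) / l powr (real ?N + s)" "0 \<le> g (U / h powr s) * (V / h powr s) / h ^ ?N"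
      using UV h g_nonneg[of "U / h powr s"] g_nonneg[of "U / l powr s"] by auto
    have "P a = ennreal V" "Q y = ennreal (g (U / l powr s) / l powr (real ?N + s))"
        "X a y = ennreal (g (U / h powr s) * (V / h powr s) / h ^ ?N)"
      using True by (auto simp: P_def Q_def X_def h_def l_def U_def V_def)
    then show ?thesis
      using ennreal_leI[OF le] by (simp only: ennreal_mult[OF UV(2) nn(1)] ennreal_mult[OF less_imp_le[OF C] nn(2)])
  qed (auto simp: P_def Q_def)
  have [measurable]: "(\<lambda>(a, b). X a b) \<in> borel_measurable (borel \<Otimes>\<^sub>M lborel)"
  proof -
    have "(\<lambda>(a, b). X a b) \<in> borel_measurable (borel \<Otimes>\<^sub>M borel)" unfolding X_def by measurable
    then show ?thesis by (subst measurable_cong_sets[OF sets_pair_measure_cong[OF refl sets_lborel] refl])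
  qed
  have "(\<integral>\<^sup>+a. P a \<partial>lborel) * (\<integral>\<^sup>+y. Q y \<partial>lborel) = (\<integral>\<^sup>+a. (\<integral>\<^sup>+y. P a * Q y \<partial>lborel) \<partial>lborel)"
    by (simp add: nn_integral_cmult nn_integral_multc)
  also have "\<dots> \<le> (\<integral>\<^sup>+a. (\<integral>\<^sup>+y. ennreal C * X a y \<partial>lborel) \<partial>lborel)"
    by (intro nn_integral_mono pw)
  also have "\<dots> = ennreal C * (\<integral>\<^sup>+a. (\<integral>\<^sup>+y. X a y \<partial>lborel) \<partial>lborel)"
    by (simp add: nn_integral_cmult)
  finally have "ennreal (1 - s) * ((\<integral>\<^sup>+a. P a \<partial>lborel) * (\<integral>\<^sup>+y. Q y \<partial>lborel)) \<le> ennreal (1 - s) * (ennreal C * (\<integral>\<^sup>+a. (\<integral>\<^sup>+y. X a y \<partial>lborel) \<partial>lborel))"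
    by (rule mult_left_mono) simp
  moreover have "ennreal (1 - s) * (\<integral>\<^sup>+a. (\<integral>\<^sup>+y. X a y \<partial>lborel) \<partial>lborel) = cross_term s g x r u k"
    unfolding cross_term_def X_def by (intro arg_cong2[where f="(*)"] nn_integral_cong refl) (auto simp: indicator_def)
  moreover have "tail_int s g x (- ball x r) (\<lambda>y. max (u y - k) 0) = ennreal (1 - s) * (\<integral>\<^sup>+y. Q y \<partial>lborel)"
    by (simp add: tail_int_def Q_def)
  moreover have "(\<integral>\<^sup>+a\<in>ball x r. ennreal (max (k - u a) 0) \<partial>lborel) = (\<integral>\<^sup>+a. P a \<partial>lborel)"
    by (simp add: P_def)
  ultimately show ?thesis unfolding C_def[symmetric] by (simp only: mult_ac)
qed

text \<open>Only points with \<open>norm (y - x0) \<ge> R\<close> contribute. As \<open>x\<close> is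
  within \<open>5 * R / 8\<close> of \<open>x0\<close>, such points satisfy
  \<open>norm (y - x0) \<le> 4 * norm (y - x)\<close>.\<close>

lemma tail_int_shift:
  fixes w :: "'a::euclidean_space \<Rightarrow> real"
  assumes [measurable]: "w \<in> borel_measurable borel" and w: "\<And>y. 0 \<le> w y" "\<And>y. y \<in> ball x0 R \<Longrightarrow> w y = 0"
    and x: "x \<in> ball x0 (5 * R / 8)"
  shows "tail_int s g x UNIV w \<le> ennreal (q * 4 powr q * 4 ^ (DIM('a) + 1)) * tail_int s g x0 UNIV w"
proof -
  let ?N = "DIM('a)"
  define C where "C = q * 4 powr q * 4 ^ (?N + 1)"
  have C: "0 < C" using q1 by (simp add: C_def)
  have pw: "ennreal (g (w y / norm (y - x) powr s) / norm (y - x) powr (real ?N + s))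
    \<le> ennreal C * ennreal (g (w y / norm (y - x0) powr s) / norm (y - x0) powr (real ?N + s))" for y
  proof (cases "y \<in> ball x0 R")
    case True
    then show ?thesis using w(2) by (simp add: g_0)
  next
    case False
    define l where "l = norm (y - x0)"
    define h where "h = norm (y - x)"
    have x': "norm (x - x0) < 5 * R / 8" using x by (simp add: dist_norm norm_minus_commute)
    have R: "0 < R" using le_less_trans[OF norm_ge_zero x'] by simp
    have l: "R \<le> l" "0 < l" using False R by (auto simp: l_def dist_norm norm_minus_commute)
    have "l \<le> h + norm (x - x0)" unfolding l_def h_def using norm_triangle_ineq[of "y - x" "x - x0"] by simp
    then have hl: "l \<le> 4 * h" "0 < h" using l x' by auto
    have hs: "l powr s \<le> 4 * h powr s"
    proof -
      have "l powr s \<le> (4 * h) powr s" using hl l s_pos by (intro powr_mono2) auto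
      also have "\<dots> \<le> 4 powr 1 * h powr s" using hl s1 by (simp add: powr_mult mult_right_mono powr_mono[of s 1 4, simplified])
      finally show ?thesis by simp
    qed
    have "w y / h powr s \<le> 4 * (w y / l powr s)" using hs hl l w(1)[of y] by (simp add: field_simps mult_left_mono)
    then have "g (w y / h powr s) \<le> g (4 * (w y / l powr s))" using w(1)[of y] by (intro g_mono) auto
    also have "\<dots> \<le> q * 4 powr q * g (w y / l powr s)" using w(1)[of y] by (intro g_scale_upper) auto
    finally have 1: "g (w y / h powr s) \<le> q * 4 powr q * g (w y / l powr s)" .
    have 2: "1 / h powr (real ?N + s) \<le> 4 ^ (?N + 1) * (1 / l powr (real ?N + s))"
    proof -
      have "l ^ ?N \<le> 4 ^ ?N * h ^ ?N" using power_mono[OF hl(1), of ?N] l by (simp add: power_mult_distrib)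
      then have "l powr s * l ^ ?N \<le> 4 * h powr s * (4 ^ ?N * h ^ ?N)" using hs l by (intro mult_mono) auto
      then show ?thesis using hl l by (simp add: powr_add powr_realpow field_simps)
    qed
    have "g (w y / h powr s) / h powr (real ?N + s) = g (w y / h powr s) * (1 / h powr (real ?N + s))" by simp
    also have "\<dots> \<le> (q * 4 powr q * g (w y / l powr s)) * (4 ^ (?N + 1) * (1 / l powr (real ?N + s)))"
      using w(1)[of y] g_nonneg[of "w y / l powr s"] q1 by (intro mult_mono[OF 1 2]) auto
    also have "\<dots> = C * (g (w y / l powr s) / l powr (real ?N + s))" by (simp add: C_def)
    finally show ?thesis unfolding h_def l_def using C w(1)[of y] g_nonneg[of "w y / norm (y - x0) powr s"]
      by (subst ennreal_mult[symmetric]) (auto intro: ennreal_leI)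
  qed
  have "tail_int s g x UNIV w \<le> ennreal (1 - s) * (\<integral>\<^sup>+y. ennreal C * ennreal (g (w y / norm (y - x0) powr s) / norm (y - x0) powr (real ?N + s)) \<partial>lborel)"
    unfolding tail_int_def using pw by (intro mult_left_mono nn_integral_mono) auto
  also have "\<dots> = ennreal (1 - s) * (ennreal C * (\<integral>\<^sup>+y. ennreal (g (w y / norm (y - x0) powr s) / norm (y - x0) powr (real ?N + s)) \<partial>lborel))"
    by (subst nn_integral_cmult) auto
  finally show ?thesis by (simp add: tail_int_def C_def mult_ac)
qed

end

subsection \<open>Spreading of positivity and local boundedness\<close>

text \<open>Chosen so that multiplying the argument of \<open>g\<close> by it dominates the constant in \<open>tail_int_shift\<close>.\<close>

definition shift_const :: "real \<Rightarrow> real \<Rightarrow> nat \<Rightarrow> real" where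
  "shift_const p q N = (q * (q * 4 powr q * 4 ^ (N + 1))) powr (1 / (p - 1))"

lemma shift_const_ge_1: "1 < p \<Longrightarrow> 1 < q \<Longrightarrow> 1 \<le> shift_const p q N"
proof -
  assume p: "1 < p" and q: "1 < q"
  have "1 \<le> (4::real) powr q" using q by (intro ge_one_powr_ge_zero) auto
  moreover have "1 \<le> (4::real) ^ (N + 1)" by (rule one_le_power) simp
  ultimately have "1 * (1 * 1 * 1) \<le> q * (q * 4 powr q * 4 ^ (N + 1))" using q by (intro mult_mono) auto
  then show ?thesis unfolding shift_const_def using p by (intro ge_one_powr_ge_zero) auto
qed

lemma measure_ge_of_AE_ball:
  fixes u :: "'a::euclidean_space \<Rightarrow> real"
  assumes [measurable]: "u \<in> borel_measurable borel" and r: "0 < r"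
    and sub: "ball x r \<subseteq> ball z R" and AE: "AE y in lborel. y \<in> ball x r \<longrightarrow> k \<le> u y"
  shows "unit_ball_vol DIM('a) * r ^ DIM('a) \<le> measure lborel {y \<in> ball z R. k \<le> u y}"
proof -
  have "ennreal (unit_ball_vol DIM('a) * r ^ DIM('a)) = emeasure lborel (ball x r)"
    using r by (simp add: emeasure_ball)
  also have "\<dots> \<le> emeasure lborel {y \<in> ball z R. k \<le> u y}"
    by (rule emeasure_mono_AE) (use AE sub in \<open>auto elim!: eventually_mono\<close>)
  also have "\<dots> = ennreal (measure lborel {y \<in> ball z R. k \<le> u y})"
    by (rule emeasure_subset_ball[of _ z R]) auto
  finally show ?thesis by (simp add: ennreal_le_iff)
qed

context orlicz begin

text \<open>With this the one assumption at \<open>x0\<close> serves all the balls used later: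
  recentring costs a constant that is absorbed into the level, and passing to a smaller radius only
  enlarges the right-hand side.\<close>

lemma tail_ok:
  fixes u :: "'a::euclidean_space \<Rightarrow> real"
  assumes [measurable]: "u \<in> borel_measurable borel" and u: "\<And>y. y \<in> ball x0 R \<Longrightarrow> 0 \<le> u y"
    and x: "x \<in> ball x0 (5 * R / 8)" and \<rho>: "0 < \<rho>" "\<rho> \<le> R" and L: "0 \<le> L" "shift_const p q DIM('a) * L \<le> b"
    and tail: "tail_int s g x0 UNIV (\<lambda>y. max (- u y) 0) \<le> ennreal (R powr (- s) * g (L / R powr s))"
  shows "tail_int s g x UNIV (\<lambda>y. max (- u y) 0) \<le> ennreal (\<rho> powr (- s) * g (b / \<rho> powr s))"
proof -
  let ?N = "DIM('a)"
  define C where "C = q * 4 powr q * 4 ^ (?N + 1)"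
  have C: "0 < C" using q1 by (simp add: C_def)
  define A where "A = shift_const p q ?N"
  have A1: "1 \<le> A" unfolding A_def using p1 q1 by (rule shift_const_ge_1)
  have A: "A powr (p - 1) = q * C" unfolding A_def shift_const_def C_def[symmetric] using p1 q1 C by (simp add: powr_powr)
  define t where "t = L / R powr s"
  have t: "0 \<le> t" using L by (simp add: t_def)
  have b: "0 \<le> b" "A * L \<le> b" using L A1 order_trans[OF mult_nonneg_nonneg, of A L b] by (auto simp: A_def)
  have R: "0 < R" using \<rho> by linarith
  have "q * C * g t \<le> q * g (A * t)" using g_scale_lower[OF A1 t] A by simp
  then have Cg: "C * g t \<le> g (A * t)" using q1 by (simp add: mult.assoc)
  have "tail_int s g x UNIV (\<lambda>y. max (- u y) 0) \<le> ennreal C * tail_int s g x0 UNIV (\<lambda>y. max (- u y) 0)"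
    unfolding C_def using u x by (intro tail_int_shift[where R = R]) auto
  also have "\<dots> \<le> ennreal C * ennreal (R powr (- s) * g t)"
    using tail unfolding t_def by (intro mult_left_mono) auto
  also have "\<dots> = ennreal (R powr (- s) * (C * g t))" using C t g_nonneg[OF t] by (simp add: ennreal_mult[symmetric] mult_ac)
  also have "\<dots> \<le> ennreal (\<rho> powr (- s) * g (b / \<rho> powr s))"
  proof (intro ennreal_leI mult_mono)
    show "R powr (- s) \<le> \<rho> powr (- s)" using \<rho> s_pos by (intro powr_mono2') auto
    have "\<rho> powr s \<le> R powr s" using \<rho> s_pos by (intro powr_mono2) auto
    then have "A * t \<le> b / \<rho> powr s" using b \<rho> R unfolding t_def by (simp add: frac_le)
    then have "g (A * t) \<le> g (b / \<rho> powr s)" using A1 t by (intro g_mono) auto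
    with Cg show "C * g t \<le> g (b / \<rho> powr s)" by linarith
  qed (use C g_nonneg[OF t] in auto)
  finally show ?thesis .
qed

text \<open>Each use of \<open>growth\<close> on the ball of radius \<open>4 * r\<close> doubles the
  radius of the ball on which \<open>u\<close> is bounded below and costs a factor
  \<open>\<eta>\<close>; the smaller ball has more than the required density there. The last use is
  on \<open>ball x0 R\<close>. The levels met on the way are at least the final one, which is
  assumed to dominate the tail.\<close>

lemma spread:
  fixes u :: "'a::euclidean_space \<Rightarrow> real"
  assumes um [measurable]: "u \<in> borel_measurable borel" and u: "\<And>y. y \<in> ball x0 R \<Longrightarrow> 0 \<le> u y" and R: "0 < R"
    and growth: "\<And>z R k. (\<And>y. y \<in> ball z R \<Longrightarrow> 0 \<le> u y) \<Longrightarrow> 0 < R \<Longrightarrow> 0 < k \<Longrightarrow> lower_class q c s f g u z R \<Longrightarrow>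
      unit_ball_vol DIM('a) / 24 ^ DIM('a) * R ^ DIM('a) \<le> measure lborel {y \<in> ball z (2 * R / 3). k \<le> u y} \<Longrightarrow>
      tail_int s g z UNIV (\<lambda>y. max (- u y) 0) \<le> ennreal (R powr (- s) * g (\<eta> * k / R powr s)) \<Longrightarrow>
      AE y in lborel. y \<in> ball z (R / 2) \<longrightarrow> \<eta> * k \<le> u y"
    and \<eta>: "0 < \<eta>" "\<eta> < 1"
    and lower: "\<And>x \<rho>. 0 < \<rho> \<Longrightarrow> ball x \<rho> \<subseteq> ball x0 R \<Longrightarrow> lower_class q c s f g u x \<rho>"
    and L: "0 \<le> L" and tail: "tail_int s g x0 UNIV (\<lambda>y. max (- u y) 0) \<le> ennreal (R powr (- s) * g (L / R powr s))"
    and x: "x \<in> ball x0 (5 * R / 8)" and k: "0 < k" and Lk: "shift_const p q DIM('a) * L \<le> \<eta> ^ Suc n * k"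
    and AE: "AE y in lborel. y \<in> ball x (R / (24 * 2 ^ n)) \<longrightarrow> k \<le> u y"
  shows "AE y in lborel. y \<in> ball x0 (R / 2) \<longrightarrow> \<eta> ^ Suc n * k \<le> u y"
  using k Lk AE
proof (induction n arbitrary: k)
  case 0
  have x0: "x0 \<in> ball x0 (5 * R / 8)" using R by simp
  \<comment> \<open>This inclusion determines the number 24, as
    \<open>5 / 8 + 1 / 24 = 2 / 3\<close>.\<close>
  have sub: "ball x (R / 24) \<subseteq> ball x0 (2 * R / 3)"
  proof
    fix y assume "y \<in> ball x (R / 24)"
    then show "y \<in> ball x0 (2 * R / 3)" using x dist_triangle[of x0 y x] by simp
  qed
  have "AE y in lborel. y \<in> ball x0 (R / 2) \<longrightarrow> \<eta> * k \<le> u y"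
  proof (rule growth[OF u R 0(1)])
    show "lower_class q c s f g u x0 R" using R by (intro lower) auto
    have "unit_ball_vol DIM('a) * (R / 24) ^ DIM('a) \<le> measure lborel {y \<in> ball x0 (2 * R / 3). k \<le> u y}"
      using R sub 0(3) by (intro measure_ge_of_AE_ball) auto
    then show "unit_ball_vol DIM('a) / 24 ^ DIM('a) * R ^ DIM('a) \<le> measure lborel {y \<in> ball x0 (2 * R / 3). k \<le> u y}"
      by (simp add: power_divide)
    show "tail_int s g x0 UNIV (\<lambda>y. max (- u y) 0) \<le> ennreal (R powr (- s) * g (\<eta> * k / R powr s))"
      using 0(2) R by (intro tail_ok[OF um u x0 R order_refl L _ tail]) auto
  qed
  then show ?case by simp
next
  case (Suc n)
  define r where "r = R / (24 * 2 ^ Suc n)"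
  have r: "0 < r" "4 * r \<le> R / 12" "2 * r = R / (24 * 2 ^ n)"
  proof -
    have "1 \<le> (2::real) ^ n" by (rule one_le_power) simp
    then show "4 * r \<le> R / 12" using R by (simp add: r_def field_simps)
  qed (use R in \<open>auto simp: r_def\<close>)
  have sub: "ball x (4 * r) \<subseteq> ball x0 R"
  proof
    fix y assume "y \<in> ball x (4 * r)"
    then show "y \<in> ball x0 R" using x r(2) R dist_triangle[of x0 y x] by simp
  qed
  have "\<eta> ^ Suc (Suc n) * k \<le> \<eta> * k"
  proof -
    have "\<eta> ^ Suc n \<le> 1" using \<eta> by (intro power_le_one) auto
    then show ?thesis using \<eta> Suc.prems(1) by (simp add: mult_le_cancel_right1 mult_le_cancel_left2)
  qed
  then have L1: "shift_const p q DIM('a) * L \<le> \<eta> * k" using Suc.prems(2) by linarith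
  have "AE y in lborel. y \<in> ball x (4 * r / 2) \<longrightarrow> \<eta> * k \<le> u y"
  proof (rule growth)
    show "lower_class q c s f g u x (4 * r)" using r sub by (intro lower) auto
    have "unit_ball_vol DIM('a) * r ^ DIM('a) \<le> measure lborel {y \<in> ball x (2 * (4 * r) / 3). k \<le> u y}"
      using r Suc.prems(3) by (intro measure_ge_of_AE_ball) (auto simp: r_def)
    moreover have "(1 / 24) ^ DIM('a) * (4 * r) ^ DIM('a) \<le> r ^ DIM('a)"
      unfolding power_mult_distrib[symmetric] using r by (intro power_mono) auto
    then have "unit_ball_vol DIM('a) * ((1 / 24) ^ DIM('a) * (4 * r) ^ DIM('a)) \<le> unit_ball_vol DIM('a) * r ^ DIM('a)"
      by (intro mult_left_mono) auto
    ultimately show "unit_ball_vol DIM('a) / 24 ^ DIM('a) * (4 * r) ^ DIM('a) \<le> measure lborel {y \<in> ball x (2 * (4 * r) / 3). k \<le> u y}"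
      by (simp add: power_divide)
    show "tail_int s g x UNIV (\<lambda>y. max (- u y) 0) \<le> ennreal ((4 * r) powr (- s) * g (\<eta> * k / (4 * r) powr s))"
      using r R by (intro tail_ok[OF um u x _ _ L L1 tail]) auto
  qed (use r sub u Suc.prems(1) in auto)
  then have "AE y in lborel. y \<in> ball x (R / (24 * 2 ^ n)) \<longrightarrow> \<eta> * k \<le> u y" using r(3) by simp
  then have "AE y in lborel. y \<in> ball x0 (R / 2) \<longrightarrow> \<eta> ^ Suc n * (\<eta> * k) \<le> u y"
    using Suc.prems \<eta> by (intro Suc.IH) (auto simp: mult_ac)
  then show ?case by (simp add: mult_ac)
qed

section \<open>Local boundedness, without control of the bound\<close>

lemma f_g_unbounded:
  obtains t where "0 < t" "X \<le> f t" "X \<le> g t"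
proof -
  define a where "a = max 0 (X / f 1)"
  have f1: "0 < f 1" by (simp add: f_pos)
  define t where "t = max 1 (max a (a powr (1 / (p - 1))))"
  have t: "1 \<le> t" "a \<le> t" "a powr (1 / (p - 1)) \<le> t" by (auto simp: t_def)
  have a0: "0 \<le> a" by (simp add: a_def)
  have Xa: "X \<le> a * f 1" using f1 by (simp add: a_def max_def field_simps)
  have "a \<le> t powr (p - 1)"
  proof (cases "a = 0")
    case False
    then have "a = (a powr (1 / (p - 1))) powr (p - 1)" using p1 a0 by (simp add: powr_powr)
    also have "\<dots> \<le> t powr (p - 1)" using p1 t by (intro powr_mono2) auto
    finally show ?thesis .
  qed simp
  moreover have ft: "t powr p * f 1 \<le> f t" using f_scale_lower[of t 1] t by simp
  moreover have "t * t powr (p - 1) = t powr p" using t by (simp add: powr_mult_base)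
  ultimately have "t * (a * f 1) \<le> f t" using f1 t
    by (smt (verit, best) mult.assoc mult_left_mono mult_right_mono)
  then have 1: "t * X \<le> f t" using Xa t by (smt (verit) mult_left_mono)
  have "t * X \<le> t * g t" using 1 f_le_tg[of t] t by linarith
  then have "X \<le> g t" using t by simp
  moreover have "X \<le> f t"
  proof (cases "0 \<le> X")
    case True
    then have "X \<le> t * X" using t by (simp add: mult_le_cancel_right1)
    with 1 show ?thesis by linarith
  next
    case False
    then show ?thesis using f_nonneg[of t] t by linarith
  qed
  ultimately show ?thesis using that[of t] t by simp
qed

lemma lower_class_cross_term:
  assumes "lower_class q c s f g u x R" "0 < r" "r < R"
  shows "cross_term s g x r u k \<le> caccioppoli_rhs q c s f g x r R (\<lambda>y. max (k - u y) 0)"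
proof -
  have "energy s f x r (\<lambda>y. max (k - u y) 0) + cross_term s g x r u k \<le> caccioppoli_rhs q c s f g x r R (\<lambda>y. max (k - u y) 0)"
    using assms unfolding lower_class_def by auto
  then show ?thesis by (rule order_trans[rotated]) simp
qed

text \<open>Wherever the first integral on the left can be bounded below, this yields a bound for
  the tail of \<open>u\<close> above the level \<open>k\<close>.\<close>

lemma tail_upper_bound:
  fixes u :: "'a::euclidean_space \<Rightarrow> real"
  assumes um [measurable]: "u \<in> borel_measurable borel" and u: "\<And>y. y \<in> ball x R \<Longrightarrow> 0 \<le> u y" and R: "0 < R" and k: "0 < k" and c: "0 < c"
    and lower: "lower_class q c s f g u x R"
    and tail: "tail_int s g x UNIV (\<lambda>y. max (- u y) 0) \<le> ennreal (R powr (- s) * g (k / R powr s))"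
  shows "(\<integral>\<^sup>+a\<in>ball x (3 * R / 4). ennreal (max (k - u a) 0) \<partial>lborel) * tail_int s g x (- ball x (3 * R / 4)) (\<lambda>y. max (u y - k) 0)
    \<le> ennreal (q * 2 powr q * 2 ^ (DIM('a) + 1) * rhs_const q s0 c 1 DIM('a) * R ^ DIM('a) * f (k / R powr s))"
proof -
  have "(\<integral>\<^sup>+a\<in>ball x (3 * R / 4). ennreal (max (k - u a) 0) \<partial>lborel) * tail_int s g x (- ball x (3 * R / 4)) (\<lambda>y. max (u y - k) 0)
    \<le> ennreal (q * 2 powr q * 2 ^ (DIM('a) + 1)) * cross_term s g x (3 * R / 4) u k"
    using R by (intro tail_upper) auto
  also have "cross_term s g x (3 * R / 4) u k \<le> caccioppoli_rhs q c s f g x (3 * R / 4) R (\<lambda>y. max (k - u y) 0)"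
    using lower R by (intro lower_class_cross_term) auto
  also have "\<dots> \<le> ennreal (rhs_const q s0 c 1 DIM('a) * R ^ DIM('a) * f (k / R powr s))"
    using tail R k c u by (intro caccioppoli_rhs_le) auto
  finally have "(\<integral>\<^sup>+a\<in>ball x (3 * R / 4). ennreal (max (k - u a) 0) \<partial>lborel) * tail_int s g x (- ball x (3 * R / 4)) (\<lambda>y. max (u y - k) 0)
    \<le> ennreal (q * 2 powr q * 2 ^ (DIM('a) + 1)) * ennreal (rhs_const q s0 c 1 DIM('a) * R ^ DIM('a) * f (k / R powr s))"
    by (simp add: mult_left_mono)
  also have "\<dots> = ennreal (q * 2 powr q * 2 ^ (DIM('a) + 1) * rhs_const q s0 c 1 DIM('a) * R ^ DIM('a) * f (k / R powr s))"
    using q1 rhs_const_nonneg[of c 1 "DIM('a)"] c R k f_nonneg[of "k / R powr s"]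
    by (subst ennreal_mult[symmetric]) (auto simp: mult.assoc)
  finally show ?thesis .
qed

text \<open>A qualitative statement: the bound may depend on \<open>u\<close>. Its purpose is to
  make the weighted supremum finite. Once the modular and the tail above some level are finite, a
  sufficiently large height fulfils both conditions of the De Giorgi iteration.\<close>

lemma locally_bounded:
  fixes u :: "'a::euclidean_space \<Rightarrow> real"
  assumes um [measurable]: "u \<in> borel_measurable borel" and u: "\<And>y. y \<in> ball x R \<Longrightarrow> 0 \<le> u y" and R: "0 < R" and c: "0 < c"
    and dg: "\<And>k M. 0 < M \<Longrightarrow>
      (\<integral>\<^sup>+y\<in>ball x R. ennreal (f (max (u y - k) 0 / R powr s)) \<partial>lborel) \<le> ennreal (\<nu> * f (M / R powr s) * R ^ DIM('a)) \<Longrightarrow>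
      tail_int s g x (- ball x (3 * R / 4)) (\<lambda>y. max (u y - k) 0) \<le> ennreal (K * R powr (- s) * g (M / R powr s)) \<Longrightarrow>
      AE y in lborel. y \<in> ball x (3 * R / 4) \<longrightarrow> u y \<le> k + M"
    and \<nu>: "0 < \<nu>" "0 < K"
    and lower: "lower_class q c s f g u x R"
    and fin: "(\<integral>\<^sup>+y\<in>ball x R. ennreal (f \<bar>u y\<bar>) \<partial>lborel) < \<infinity>"
    and L: "0 < L" and tail: "tail_int s g x UNIV (\<lambda>y. max (- u y) 0) \<le> ennreal (R powr (- s) * g (L / R powr s))"
  obtains M where "AE y in lborel. y \<in> ball x (3 * R / 4) \<longrightarrow> u y \<le> M"
proof -
  let ?N = "DIM('a)" and ?B = "ball x (3 * R / 4)"
  \<comment> \<open>A real-valued function cannot be at least \<open>L + n\<close> almost everywhere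
    on the ball for every \<open>n\<close>, so at some level the factor of the tail in
    \<open>tail_upper_bound\<close> is not zero.\<close>
  have "\<exists>n::nat. (\<integral>\<^sup>+a\<in>?B. ennreal (max (L + real n - u a) 0) \<partial>lborel) \<noteq> 0"
  proof (rule ccontr)
    assume "\<not> ?thesis"
    then have "AE a in lborel. ennreal (max (L + real n - u a) 0) * indicator ?B a = 0" for n :: nat
      by (subst nn_integral_0_iff_AE[symmetric]) auto
    then have "AE a in lborel. \<forall>n::nat. ennreal (max (L + real n - u a) 0) * indicator ?B a = 0"
      by (subst AE_all_countable) auto
    then have "AE a in lborel. a \<notin> ?B"
    proof (rule AE_mp, intro AE_I2 impI notI)
      fix a assume *: "\<forall>n::nat. ennreal (max (L + real n - u a) 0) * indicator ?B a = 0" "a \<in> ?B"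
      obtain n :: nat where "u a < real n" using reals_Archimedean2 by blast
      then have "0 < max (L + real n - u a) 0" using L by simp
      then show False using *(1)[rule_format, of n] *(2) by (simp add: ennreal_eq_0_iff)
    qed
    then have "emeasure lborel ?B = 0" by (subst (asm) AE_iff_measurable[of ?B]) auto
    moreover have "0 < unit_ball_vol (real ?N)" by simp
    ultimately show False using R by (simp add: emeasure_ball)
  qed
  then obtain n :: nat where n: "(\<integral>\<^sup>+a\<in>?B. ennreal (max (L + real n - u a) 0) \<partial>lborel) \<noteq> 0" by blast
  define k where "k = L + real n"
  have k: "0 < k" "L \<le> k" using L by (auto simp: k_def)
  define T where "T = tail_int s g x (- ?B) (\<lambda>y. max (u y - k) 0)"
  have "tail_int s g x UNIV (\<lambda>y. max (- u y) 0) \<le> ennreal (R powr (- s) * g (k / R powr s))"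
    using k L by (intro order_trans[OF tail] ennreal_leI mult_left_mono g_mono divide_right_mono) auto
  then have "(\<integral>\<^sup>+a\<in>?B. ennreal (max (k - u a) 0) \<partial>lborel) * T
     \<le> ennreal (q * 2 powr q * 2 ^ (?N + 1) * rhs_const q s0 c 1 ?N * R ^ ?N * f (k / R powr s))"
    unfolding T_def using k R c u lower by (intro tail_upper_bound) auto
  then have "(\<integral>\<^sup>+a\<in>?B. ennreal (max (k - u a) 0) \<partial>lborel) * T < top" by (rule le_less_trans) simp
  then have "T < top" using n unfolding k_def[symmetric] by (auto simp: ennreal_mult_less_top)
  then obtain T' where T': "T = ennreal T'" "0 \<le> T'" by (cases T) auto
  define Y where "Y = (\<integral>\<^sup>+y\<in>ball x R. ennreal (f (max (u y - k) 0 / R powr s)) \<partial>lborel)"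
  define l where "l = max 1 (1 / R powr s)"
  have "Y \<le> (\<integral>\<^sup>+y. ennreal (l powr q) * (ennreal (f \<bar>u y\<bar>) * indicator (ball x R) y) \<partial>lborel)"
    unfolding Y_def
  proof (rule nn_integral_mono)
    fix y
    have "max (u y - k) 0 / R powr s \<le> l * \<bar>u y\<bar>"
    proof -
      have "max (u y - k) 0 * (1 / R powr s) \<le> \<bar>u y\<bar> * l"
        using k R by (intro mult_mono) (auto simp: l_def)
      then show ?thesis by (simp add: mult.commute)
    qed
    then have "f (max (u y - k) 0 / R powr s) \<le> f (l * \<bar>u y\<bar>)" by (intro f_mono) auto
    also have "\<dots> \<le> l powr q * f \<bar>u y\<bar>" by (intro f_scale_upper) (auto simp: l_def)
    finally show "ennreal (f (max (u y - k) 0 / R powr s)) * indicator (ball x R) y \<le> ennreal (l powr q) * (ennreal (f \<bar>u y\<bar>) * indicator (ball x R) y)"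
      by (auto simp: indicator_def ennreal_mult[symmetric] f_nonneg intro!: ennreal_leI)
  qed
  also have "\<dots> = ennreal (l powr q) * (\<integral>\<^sup>+y\<in>ball x R. ennreal (f \<bar>u y\<bar>) \<partial>lborel)"
    by (rule nn_integral_cmult) measurable
  also have "\<dots> < top" using fin by (simp add: ennreal_mult_less_top)
  finally obtain Y' where Y': "Y = ennreal Y'" "0 \<le> Y'" by (cases Y) auto
  obtain t where t: "0 < t" "max (Y' / (\<nu> * R ^ ?N)) (T' / (K * R powr (- s))) \<le> f t" "max (Y' / (\<nu> * R ^ ?N)) (T' / (K * R powr (- s))) \<le> g t"
    by (rule f_g_unbounded)
  have Rs: "0 < R powr s" using R by simp
  have "AE y in lborel. y \<in> ?B \<longrightarrow> u y \<le> k + t * R powr s"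
  proof (rule dg)
    show "0 < t * R powr s" using t R by simp
    have "Y' \<le> \<nu> * f t * R ^ ?N" using t(2) \<nu> R by (simp add: field_simps)
    then show "(\<integral>\<^sup>+y\<in>ball x R. ennreal (f (max (u y - k) 0 / R powr s)) \<partial>lborel) \<le> ennreal (\<nu> * f (t * R powr s / R powr s) * R ^ ?N)"
      unfolding Y_def[symmetric] Y' using Rs by (simp add: ennreal_leI)
    have "T' \<le> g t * (K * R powr (- s))" using t(3) \<nu> R by (simp add: pos_divide_le_eq)
    then show "tail_int s g x (- ?B) (\<lambda>y. max (u y - k) 0) \<le> ennreal (K * R powr (- s) * g (t * R powr s / R powr s))"
      unfolding T_def[symmetric] T' using Rs by (simp add: ennreal_leI mult_ac)
  qed
  then show ?thesis by (rule that)
qed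

end

subsection \<open>A point where a weighted supremum is almost attained\<close>

text \<open>The weight \<open>(\<rho> - dist x0 y) powr \<beta>\<close> forces an almost maximal
  point to carry its own scale: on the ball whose radius \<open>r\<close> is half the distance to
  the boundary the weight is at least \<open>2 powr (- \<beta>)\<close> times its value at the
  centre, so \<open>u\<close> is bounded there by a fixed multiple of \<open>M\<close>. The last
  conclusion says that \<open>u\<close> really reaches this size near \<open>x\<close>.\<close>

lemma weighted_maximum:
  fixes u :: "'a::euclidean_space \<Rightarrow> real" and \<beta> \<rho> :: real
  assumes [measurable]: "u \<in> borel_measurable borel" and \<beta>: "0 < \<beta>" and \<rho>: "0 < \<rho>"
    and bd: "AE y in lborel. y \<in> ball x0 \<rho> \<longrightarrow> u y \<le> M0"
  obtains "AE y in lborel. y \<in> ball x0 \<rho> \<longrightarrow> u y \<le> 0"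
  | \<theta> x r M where "0 < \<theta>" "0 < r" "2 * r = \<rho> - dist x0 x" "M = \<theta> / 2 * (2 * r) powr (- \<beta>)"
      "AE y in lborel. y \<in> ball x0 \<rho> \<longrightarrow> u y * (\<rho> - dist x0 y) powr \<beta> \<le> \<theta>"
      "AE y in lborel. y \<in> ball x r \<longrightarrow> u y \<le> 2 powr (\<beta> + 1) * M"
      "\<not> (AE y in lborel. y \<in> ball x (3 * r / 4) \<longrightarrow> u y \<le> 3 * M / 4)"
proof -
  define w where "w y = (\<rho> - dist x0 y) powr \<beta>" for y
  have wm [measurable]: "w \<in> borel_measurable borel" unfolding w_def by measurable
  define P where "P t \<longleftrightarrow> (AE y in lborel. y \<in> ball x0 \<rho> \<longrightarrow> u y * w y \<le> t)" for t
  define t0 where "t0 = max M0 1 * \<rho> powr \<beta>"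
  have t0: "0 < t0" using \<rho> by (simp add: t0_def)
  have "P t0" unfolding P_def
  proof (rule AE_mp[OF bd], intro AE_I2 impI)
    fix y assume *: "y \<in> ball x0 \<rho> \<longrightarrow> u y \<le> M0" "y \<in> ball x0 \<rho>"
    have "u y * w y \<le> max M0 1 * w y" using * by (intro mult_right_mono) (auto simp: w_def)
    also have "\<dots> \<le> t0" unfolding t0_def w_def using * \<beta> by (intro mult_left_mono powr_mono2) auto
    finally show "u y * w y \<le> t0" .
  qed
  \<comment> \<open>An upper bound of the weighted function is halved until it fails. This yields
    \<open>\<theta>\<close> up to a factor 2; if the bound never fails, then
    \<open>u \<le> 0\<close> almost everywhere.\<close>
  show thesis
  proof (cases "\<forall>n::nat. P (t0 / 2 ^ n)")
    case True
    then have "AE y in lborel. \<forall>n::nat. y \<in> ball x0 \<rho> \<longrightarrow> u y * w y \<le> t0 / 2 ^ n"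
      unfolding P_def by (subst AE_all_countable)
    then have "AE y in lborel. y \<in> ball x0 \<rho> \<longrightarrow> u y \<le> 0"
    proof (rule AE_mp, intro AE_I2 impI)
      fix y assume *: "\<forall>n::nat. y \<in> ball x0 \<rho> \<longrightarrow> u y * w y \<le> t0 / 2 ^ n" "y \<in> ball x0 \<rho>"
      have "(\<lambda>n. t0 / 2 ^ n) \<longlonglongrightarrow> 0" by (rule LIMSEQ_divide_realpow_zero) simp
      then have "u y * w y \<le> 0" by (rule LIMSEQ_le_const) (use * in auto)
      moreover have "0 < w y" using *(2) by (simp add: w_def)
      ultimately show "u y \<le> 0" by (simp add: mult_le_0_iff)
    qed
    then show thesis by (rule that(1))
  next
    case False
    define n where "n = (LEAST n::nat. \<not> P (t0 / 2 ^ n))"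
    from False have "\<exists>n. \<not> P (t0 / 2 ^ n)" by blast
    from LeastI_ex[OF this] have nP: "\<not> P (t0 / 2 ^ n)" unfolding n_def .
    then obtain m where m: "n = Suc m" using \<open>P t0\<close> by (cases n) auto
    define \<theta> where "\<theta> = t0 / 2 ^ m"
    have \<theta>: "0 < \<theta>" using t0 by (simp add: \<theta>_def)
    have P\<theta>: "P \<theta>" using not_less_Least[of m "\<lambda>n. \<not> P (t0 / 2 ^ n)"] m unfolding \<theta>_def n_def[symmetric] by auto
    have nP\<theta>: "\<not> P (\<theta> / 2)" using nP m by (simp add: \<theta>_def mult.commute)
    define S where "S = {y \<in> ball x0 \<rho>. \<theta> / 2 < u y * w y}"
    have Sm [measurable]: "S \<in> sets borel" unfolding S_def by measurable
    have "\<not> negligible S"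
    proof
      assume "negligible S"
      then have "AE y in lebesgue. y \<notin> S" by (simp add: negligible_iff_null_sets AE_not_in)
      then have "AE y in lborel. y \<notin> S" by (simp add: AE_completion_iff)
      then have "P (\<theta> / 2)" unfolding P_def by (rule AE_mp) (auto simp: S_def)
      with nP\<theta> show False ..
    qed
    \<comment> \<open>Since \<open>S\<close> is not negligible, it has a point all of whose relative
      neighbourhoods are not negligible either. Mere membership in \<open>S\<close> would give no
      information about the almost everywhere behaviour near \<open>x\<close>.\<close>
    then obtain x where xS: "x \<in> S" and x: "\<And>U. openin (top_of_set S) U \<Longrightarrow> x \<in> U \<Longrightarrow> \<not> negligible U"
      unfolding locally_negligible_alt[of S] by blast
    define r where "r = (\<rho> - dist x0 x) / 2"
    have r: "0 < r" "2 * r = \<rho> - dist x0 x" using xS by (auto simp: r_def S_def)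
    define M where "M = \<theta> / 2 * (2 * r) powr (- \<beta>)"
    have M: "0 < M" using \<theta> r by (simp add: M_def)
    \<comment> \<open>Within \<open>\<epsilon>\<close> of \<open>x\<close> the distance to the
      boundary is at most \<open>2 * r * a\<close>, so the weight is at most 4/3 of its value at
      \<open>x\<close>, and \<open>\<theta> / 2 < u y * w y\<close> gives
      \<open>u y > 3 * M / 4\<close>.\<close>
    define a where "a = (4 / 3 :: real) powr (1 / \<beta>)"
    have a: "1 < a" "a powr \<beta> = 4 / 3"
      using \<beta> powr_less_mono[of 0 "1 / \<beta>" "4 / 3"] by (auto simp: a_def powr_powr)
    define \<epsilon> where "\<epsilon> = min (3 * r / 4) (2 * r * (a - 1))"
    have \<epsilon>: "0 < \<epsilon>" "\<epsilon> \<le> 3 * r / 4" "\<epsilon> \<le> 2 * r * (a - 1)" using r a by (auto simp: \<epsilon>_def)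
    show thesis
    proof (rule that(2)[OF \<theta> r M_def])
      show "AE y in lborel. y \<in> ball x0 \<rho> \<longrightarrow> u y * (\<rho> - dist x0 y) powr \<beta> \<le> \<theta>"
        using P\<theta> unfolding P_def w_def .
      show "AE y in lborel. y \<in> ball x r \<longrightarrow> u y \<le> 2 powr (\<beta> + 1) * M"
        using P\<theta> unfolding P_def
      proof (rule AE_mp, intro AE_I2 impI)
        fix y assume *: "y \<in> ball x0 \<rho> \<longrightarrow> u y * w y \<le> \<theta>" "y \<in> ball x r"
        have d: "r \<le> \<rho> - dist x0 y" using *(2) r dist_triangle[of x0 y x] by simp
        then have "y \<in> ball x0 \<rho>" using r by simp
        with * have uw: "u y * w y \<le> \<theta>" by simp
        have w: "r powr \<beta> \<le> w y" "0 < r powr \<beta>" using d r \<beta> by (auto simp: w_def intro: powr_mono2)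
        have eq: "2 powr (\<beta> + 1) * M = \<theta> / r powr \<beta>"
          using r by (simp add: M_def powr_add powr_minus powr_mult field_simps)
        show "u y \<le> 2 powr (\<beta> + 1) * M"
        proof (cases "0 \<le> u y")
          case True
          have "u y * r powr \<beta> \<le> u y * w y" using True w by (intro mult_left_mono) auto
          with uw have "u y * r powr \<beta> \<le> \<theta>" by linarith
          then show ?thesis unfolding eq using w by (simp add: pos_le_divide_eq)
        next
          case False
          moreover have "0 \<le> 2 powr (\<beta> + 1) * M" using M by simp
          ultimately show ?thesis by linarith
        qed
      qed
      show "\<not> (AE y in lborel. y \<in> ball x (3 * r / 4) \<longrightarrow> u y \<le> 3 * M / 4)"
      proof
        assume AE: "AE y in lborel. y \<in> ball x (3 * r / 4) \<longrightarrow> u y \<le> 3 * M / 4"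
        define U where "U = S \<inter> ball x \<epsilon>"
        have [measurable]: "U \<in> sets borel" unfolding U_def by measurable
        have gt: "3 * M / 4 < u y" if "y \<in> U" for y
        proof -
          have y: "\<theta> / 2 < u y * w y" "y \<in> ball x0 \<rho>" "dist x y < \<epsilon>" using that by (auto simp: U_def S_def)
          have wy: "0 < w y" using y(2) by (simp add: w_def)
          have "\<rho> - dist x0 y \<le> 2 * r * a"
            using y(3) \<epsilon>(3) r dist_triangle[of x0 x y] by (simp add: dist_commute algebra_simps)
          then have "w y \<le> (2 * r * a) powr \<beta>" unfolding w_def using y(2) \<beta> by (intro powr_mono2) auto
          also have "\<dots> = (2 * r) powr \<beta> * (4 / 3)" using r a by (simp add: powr_mult)
          finally have "3 * M / 4 * w y \<le> 3 * M / 4 * ((2 * r) powr \<beta> * (4 / 3))" using M by (intro mult_left_mono) auto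
          also have "\<dots> = \<theta> / 2" using r by (simp add: M_def powr_minus)
          also have "\<dots> < u y * w y" by (rule y)
          finally show ?thesis using wy by simp
        qed
        have "AE y in lborel. y \<notin> U"
          using AE by (rule AE_mp) (use gt \<epsilon> in \<open>force simp: U_def\<close>)
        then have "U \<in> null_sets lborel" by (simp add: AE_iff_null_sets)
        then have "negligible U" by (simp add: negligible_iff_null_sets null_sets_completionI)
        moreover have "openin (top_of_set S) U" unfolding U_def by (simp add: openin_open_Int)
        moreover have "x \<in> U" using xS \<epsilon> by (simp add: U_def)
        ultimately show False using x by blast
      qed
    qed
  qed
qed

subsection \<open>The Harnack inequality for Borel functions\<close>

context orlicz begin

text \<open>At the level \<open>k = 2 * B * M\<close>, twice the bound of \<open>u\<close>, the
  difference \<open>k - u\<close> is at least \<open>k / 2\<close> on the smaller ball. Dividing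
  \<open>tail_upper_bound\<close> by its integral controls the tail above \<open>k\<close>, and
  \<open>tail_bound\<close> lowers the level to \<open>M / 2\<close>, because the excess over
  \<open>M / 2\<close> is at most \<open>k\<close> plus the excess over \<open>k\<close>.\<close>

lemma tail_near_maximum:
  fixes u :: "'a::euclidean_space \<Rightarrow> real"
  assumes um [measurable]: "u \<in> borel_measurable borel" and u: "\<And>y. y \<in> ball x r \<Longrightarrow> 0 \<le> u y" and r: "0 < r" and c: "0 < c"
    and M: "0 < M" and B: "1 \<le> B"
    and lower: "lower_class q c s f g u x r"
    and tail: "tail_int s g x UNIV (\<lambda>y. max (- u y) 0) \<le> ennreal (r powr (- s) * g (2 * B * M / r powr s))"
    and bd: "AE y in lborel. y \<in> ball x r \<longrightarrow> u y \<le> B * M"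
  shows "tail_int s g x (- ball x (3 * r / 4)) (\<lambda>y. max (u y - M / 2) 0)
    \<le> ennreal ((tail_const q s0 DIM('a) + q * 2 powr q * (2 * 2 ^ DIM('a) / unit_ball_vol DIM('a) *
          (q * 2 powr q * 2 ^ (DIM('a) + 1) * rhs_const q s0 c 1 DIM('a))) + 1) * (q * (8 * B) powr q) *
          r powr (- s) * g (M / 4 / r powr s))"
proof -
  let ?N = "DIM('a)" and ?B = "ball x (3 * r / 4)"
  define \<omega> where "\<omega> = unit_ball_vol ?N"
  have \<omega>: "0 < \<omega>" by (simp add: \<omega>_def)
  define k where "k = 2 * B * M"
  have k: "0 < k" "M / 2 \<le> k"
  proof -
    have "1 * M \<le> B * M" using B M by (intro mult_right_mono) auto
    then show "0 < k" "M / 2 \<le> k" using M by (auto simp: k_def)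
  qed
  define \<kappa> where "\<kappa> = k / r powr s"
  have \<kappa>: "0 < \<kappa>" using k r by (simp add: \<kappa>_def)
  define C4 where "C4 = q * 2 powr q * 2 ^ (?N + 1) * rhs_const q s0 c 1 ?N"
  have C4: "0 \<le> C4" using q1 rhs_const_nonneg[of c 1 ?N] c by (simp add: C4_def)
  define C5 where "C5 = 2 * 2 ^ ?N / \<omega> * C4"
  have C5: "0 \<le> C5" using C4 \<omega> by (simp add: C5_def)
  define T where "T = tail_int s g x (- ?B) (\<lambda>y. max (u y - k) 0)"
  define v where "v = k / 2 * (\<omega> * (r / 2) ^ ?N)"
  have v: "0 < v" using k \<omega> r by (simp add: v_def)
  have "ennreal v * T \<le> (\<integral>\<^sup>+a\<in>?B. ennreal (max (k - u a) 0) \<partial>lborel) * T"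
  proof (rule mult_right_mono)
    have "ennreal v \<le> ennreal (k / 2 * (\<omega> * (3 * r / 4) ^ ?N))"
      unfolding v_def using k \<omega> r by (intro ennreal_leI mult_left_mono power_mono) auto
    also have "\<dots> = (\<integral>\<^sup>+a. ennreal (k / 2) * indicator ?B a \<partial>lborel)"
      using k r \<omega> by (subst nn_integral_cmult_indicator) (auto simp: emeasure_ball \<omega>_def ennreal_mult[symmetric])
    also have "\<dots> \<le> (\<integral>\<^sup>+a\<in>?B. ennreal (max (k - u a) 0) \<partial>lborel)"
    proof (rule nn_integral_mono_AE, rule AE_mp[OF bd], intro AE_I2 impI)
      fix a assume "a \<in> ball x r \<longrightarrow> u a \<le> B * M"
      then have "a \<in> ?B \<Longrightarrow> k / 2 \<le> max (k - u a) 0" using r by (auto simp: k_def)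
      then show "ennreal (k / 2) * indicator ?B a \<le> ennreal (max (k - u a) 0) * indicator ?B a"
        by (auto simp: indicator_def intro: ennreal_leI)
    qed
    finally show "ennreal v \<le> (\<integral>\<^sup>+a\<in>?B. ennreal (max (k - u a) 0) \<partial>lborel)" .
  qed simp
  also have "\<dots> \<le> ennreal (C4 * r ^ ?N * f \<kappa>)"
    unfolding T_def C4_def \<kappa>_def using u r k c lower tail by (intro tail_upper_bound) (auto simp: k_def)
  also have "\<dots> \<le> ennreal (C4 * r ^ ?N * (\<kappa> * g \<kappa>))"
    using C4 r \<kappa> by (intro ennreal_leI mult_left_mono f_le_tg) auto
  also have "C4 * r ^ ?N * (\<kappa> * g \<kappa>) = v * (C5 * r powr (- s) * g \<kappa>)"
    using \<omega> k r by (simp add: v_def C5_def \<kappa>_def powr_minus power_divide field_simps)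
  also have "ennreal \<dots> = ennreal v * ennreal (C5 * r powr (- s) * g \<kappa>)"
    using v C5 g_nonneg[of \<kappa>] \<kappa> by (intro ennreal_mult) auto
  finally have T: "T \<le> ennreal (C5 * r powr (- s) * g \<kappa>)"
    using v by (subst (asm) ennreal_mult_le_mult_iff) auto
  have "tail_int s g x (- ?B) (\<lambda>y. max (u y - M / 2) 0) \<le> ennreal (tail_const q s0 ?N * r powr (- s) * g (k / r powr s)) + ennreal (q * 2 powr q) * T"
    unfolding T_def using r k M by (intro tail_bound) auto
  also have "\<dots> \<le> ennreal (tail_const q s0 ?N * r powr (- s) * g \<kappa>) + ennreal (q * 2 powr q) * ennreal (C5 * r powr (- s) * g \<kappa>)"
    using T unfolding \<kappa>_def by (intro add_left_mono mult_left_mono) auto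
  also have "\<dots> = ennreal ((tail_const q s0 ?N + q * 2 powr q * C5) * r powr (- s) * g \<kappa>)"
    using tail_const_nonneg[of ?N] q1 C5 \<kappa> g_nonneg[of \<kappa>] by (simp add: ennreal_mult[symmetric] ennreal_plus[symmetric] algebra_simps del: ennreal_plus)
  also have "\<dots> \<le> ennreal ((tail_const q s0 ?N + q * 2 powr q * C5 + 1) * r powr (- s) * (q * (8 * B) powr q * g (M / 4 / r powr s)))"
  proof (intro ennreal_leI mult_mono)
    have "g \<kappa> = g (8 * B * (M / 4 / r powr s))" by (simp add: \<kappa>_def k_def mult.assoc)
    also have "\<dots> \<le> q * (8 * B) powr q * g (M / 4 / r powr s)" using B M by (intro g_scale_upper) auto
    finally show "g \<kappa> \<le> q * (8 * B) powr q * g (M / 4 / r powr s)" .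
  qed (use tail_const_nonneg[of ?N] q1 C5 \<kappa> g_nonneg[of \<kappa>] in auto)
  finally show ?thesis by (simp add: C5_def C4_def \<omega>_def mult_ac)
qed

end

text \<open>Here \<open>n\<close> counts the doublings from the radius \<open>3 * r / 4\<close> up
  to \<open>R / 24\<close>, where \<open>spread\<close> can finish. Since \<open>2 ^ n\<close> is at
  most a multiple of \<open>R / r\<close>, a loss of \<open>2 powr (- \<beta>)\<close> per doubling
  is no worse than the weight.\<close>

lemma powr_dyadic_lower:
  fixes \<beta> r R :: real
  assumes "0 < \<beta>" "0 < r" "2 * r \<le> R"
  obtains n :: nat where "R / (24 * 2 ^ n) \<le> 3 * r / 4" "(2 * r / R) powr \<beta> \<le> (2 powr (- \<beta>)) ^ n"
proof (cases "R / 24 \<le> 3 * r / 4")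
  case True
  have "(2 * r / R) powr \<beta> \<le> 1" using assms by (intro powr_le1) auto
  then show ?thesis using that[of 0] True by simp
next
  case False
  then obtain n where n: "(R / 24) / 2 ^ Suc n \<le> 3 * r / 4" "3 * r / 4 < (R / 24) / 2 ^ n"
    using dyadic_interval[of "3 * r / 4" "R / 24"] assms by auto
  have "2 * r / R \<le> 1 / 2 ^ Suc n"
  proof -
    have "18 * r * 2 ^ n < R" using n(2) by (simp add: field_simps)
    then have "4 * r * 2 ^ n \<le> R" using assms by (smt (verit) mult_right_mono zero_le_power)
    then show ?thesis using assms by (simp add: field_simps)
  qed
  then have "(2 * r / R) powr \<beta> \<le> (1 / 2 ^ Suc n) powr \<beta>" using assms by (intro powr_mono2) auto
  also have "\<dots> = (2 powr (- \<beta>)) ^ Suc n"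
  proof -
    have "(1 / 2 ^ Suc n :: real) = 2 powr (- real (Suc n))" by (simp add: powr_minus powr_realpow[symmetric] divide_inverse del: of_nat_Suc power_Suc)
    then show ?thesis by (simp only: powr_powr) (simp add: powr_realpow[symmetric] powr_powr mult_ac del: of_nat_Suc power_Suc)
  qed
  finally show ?thesis using that[of "Suc n"] n(1) by simp
qed

text \<open>Here \<open>L\<close> is a positive number whose associated bound dominates the tail,
  and \<open>h\<close> stands in for the infimum. The dependence of the constants runs from
  \<open>\<eta>\<close> over \<open>\<beta>\<close>, \<open>B\<close>, \<open>K\<close>,
  \<open>\<nu>\<close> and \<open>\<delta>\<close> to \<open>\<eta>'\<close>.\<close>

lemma harnack_borel:
  fixes p q s0 c :: real
  assumes pq: "1 < p" "p \<le> q" and s0: "0 < s0" and c: "0 < c"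
  obtains C where "0 < C"
    "\<And>s f g (u :: 'a::euclidean_space \<Rightarrow> real) x0 R L. orlicz p q s0 s f g \<Longrightarrow> u \<in> borel_measurable borel \<Longrightarrow>
      (\<And>y. y \<in> ball x0 R \<Longrightarrow> 0 \<le> u y) \<Longrightarrow> 0 < R \<Longrightarrow> 0 < L \<Longrightarrow>
      (\<And>x \<rho>. 0 < \<rho> \<Longrightarrow> ball x \<rho> \<subseteq> ball x0 R \<Longrightarrow> lower_class q c s f g u x \<rho>) \<Longrightarrow>
      (\<And>x \<rho>. 0 < \<rho> \<Longrightarrow> ball x \<rho> \<subseteq> ball x0 R \<Longrightarrow> upper_class q c s f g u x \<rho>) \<Longrightarrow>
      (\<integral>\<^sup>+y\<in>ball x0 R. ennreal (f \<bar>u y\<bar>) \<partial>lborel) < \<infinity> \<Longrightarrow>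
      tail_int s g x0 UNIV (\<lambda>y. max (- u y) 0) \<le> ennreal (R powr (- s) * g (L / R powr s)) \<Longrightarrow>
      \<exists>h\<ge>0. (AE y in lborel. y \<in> ball x0 (R / 2) \<longrightarrow> h \<le> u y) \<and> (AE y in lborel. y \<in> ball x0 (R / 2) \<longrightarrow> u y \<le> C * (h + L))"
proof -
  let ?N = "DIM('a)"
  have q1: "1 < q" using pq by simp
  define \<omega> where "\<omega> = unit_ball_vol ?N"
  have \<omega>: "0 < \<omega>" by (simp add: \<omega>_def)
  define A where "A = shift_const p q ?N"
  have A: "1 \<le> A" unfolding A_def using pq(1) q1 by (rule shift_const_ge_1)
  have "0 < \<omega> / 24 ^ ?N" using \<omega> by simp
  from growth[OF pq s0 c this, where 'a = 'a] obtain \<eta> where \<eta>: "0 < \<eta>" "\<eta> < 1" and growth1: "\<And>s f g (u :: 'a \<Rightarrow> real) z R k. orlicz p q s0 s f g \<Longrightarrow> u \<in> borel_measurable borel \<Longrightarrow>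
      (\<And>y. y \<in> ball z R \<Longrightarrow> 0 \<le> u y) \<Longrightarrow> 0 < R \<Longrightarrow> 0 < k \<Longrightarrow> lower_class q c s f g u z R \<Longrightarrow>
      \<omega> / 24 ^ ?N * R ^ ?N \<le> measure lborel {y \<in> ball z (2 * R / 3). k \<le> u y} \<Longrightarrow>
      tail_int s g z UNIV (\<lambda>y. max (- u y) 0) \<le> ennreal (R powr (- s) * g (\<eta> * k / R powr s)) \<Longrightarrow>
      AE y in lborel. y \<in> ball z (R / 2) \<longrightarrow> \<eta> * k \<le> u y" by blast
  \<comment> \<open>With this exponent, halving the distance to the boundary changes the weight by
    the same factor \<open>\<eta>\<close> that \<open>spread\<close> loses per doubling of the
    radius.\<close>
  define \<beta> where "\<beta> = - log 2 \<eta>"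
  have \<beta>: "0 < \<beta>" "2 powr (- \<beta>) = \<eta>" using \<eta> by (auto simp: \<beta>_def log_less_zero_cancel_iff)
  define B where "B = 2 powr (\<beta> + 1)"
  have B: "1 \<le> B" unfolding B_def using \<beta> by (intro ge_one_powr_ge_zero) auto
  define K where "K = (tail_const q s0 ?N + q * 2 powr q * (2 * 2 ^ ?N / unit_ball_vol ?N *
          (q * 2 powr q * 2 ^ (?N + 1) * rhs_const q s0 c 1 ?N)) + 1) * (q * (8 * B) powr q)"
  have K: "0 < K"
  proof -
    have "0 \<le> tail_const q s0 ?N" using s0 by (simp add: tail_const_def kernel_const_def)
    moreover from this have "0 \<le> rhs_const q s0 c 1 ?N" using c q1 by (simp add: rhs_const_def)
    ultimately show ?thesis unfolding K_def using q1 B by (intro mult_pos_pos add_nonneg_pos add_nonneg_nonneg mult_nonneg_nonneg) auto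
  qed
  obtain \<nu> where \<nu>: "0 < \<nu>" and dg: "\<And>s f g (v :: 'a \<Rightarrow> real) x R k M. orlicz p q s0 s f g \<Longrightarrow> v \<in> borel_measurable borel \<Longrightarrow>
      0 < R \<Longrightarrow> 0 < M \<Longrightarrow>
      (\<And>r \<rho> k. 0 < r \<Longrightarrow> r < \<rho> \<Longrightarrow> \<rho> \<le> R \<Longrightarrow>
        energy s f x r (\<lambda>y. max (v y - k) 0) \<le> caccioppoli_rhs q c s f g x r \<rho> (\<lambda>y. max (v y - k) 0)) \<Longrightarrow>
      (\<integral>\<^sup>+y\<in>ball x R. ennreal (f (max (v y - k) 0 / R powr s)) \<partial>lborel) \<le> ennreal (\<nu> * f (M / R powr s) * R ^ DIM('a)) \<Longrightarrow>
      tail_int s g x (- ball x (3 * R / 4)) (\<lambda>y. max (v y - k) 0) \<le> ennreal (K * R powr (- s) * g (M / R powr s)) \<Longrightarrow>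
      AE y in lborel. y \<in> ball x (3 * R / 4) \<longrightarrow> v y \<le> k + M"
    using de_giorgi[OF pq s0 c K] by blast
  \<comment> \<open>If \<open>{u \<ge> M / 2}\<close> had measure below
    \<open>\<delta> * r ^ d\<close>, then \<open>u \<le> B * M\<close>, which is
    \<open>4 * B\<close> times the height \<open>M / 4\<close>, would push the modular of the excess
    below the threshold \<open>\<nu>\<close>.\<close>
  define \<delta> where "\<delta> = \<nu> / (4 * B) powr q"
  have \<delta>: "0 < \<delta>" using \<nu> B by (simp add: \<delta>_def)
  have "0 < \<delta> * (2 / 3) ^ ?N" using \<delta> by simp
  from growth[OF pq s0 c this, where 'a = 'a] obtain \<eta>' where \<eta>': "0 < \<eta>'" "\<eta>' < 1" and growth2: "\<And>s f g (u :: 'a \<Rightarrow> real) z R k. orlicz p q s0 s f g \<Longrightarrow> u \<in> borel_measurable borel \<Longrightarrow>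
      (\<And>y. y \<in> ball z R \<Longrightarrow> 0 \<le> u y) \<Longrightarrow> 0 < R \<Longrightarrow> 0 < k \<Longrightarrow> lower_class q c s f g u z R \<Longrightarrow>
      \<delta> * (2 / 3) ^ ?N * R ^ ?N \<le> measure lborel {y \<in> ball z (2 * R / 3). k \<le> u y} \<Longrightarrow>
      tail_int s g z UNIV (\<lambda>y. max (- u y) 0) \<le> ennreal (R powr (- s) * g (\<eta>' * k / R powr s)) \<Longrightarrow>
      AE y in lborel. y \<in> ball z (R / 2) \<longrightarrow> \<eta>' * k \<le> u y" by blast
  \<comment> \<open>The power of 8 arises because the half ball keeps the distance
    \<open>R / 8\<close> from the boundary of the larger ball. The quotient by
    \<open>\<eta> * \<eta>' / 4\<close> expresses \<open>\<Theta>\<close> through \<open>h\<close>,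
    and \<open>A\<close> covers the case where the tail dominates.\<close>
  define C where "C = 8 powr \<beta> * 4 * A / (\<eta> * \<eta>')"
  have C: "0 < C" using A \<eta> \<eta>' by (simp add: C_def)
  show thesis
  proof (rule that[OF C])
    fix s f g and u :: "'a \<Rightarrow> real" and x0 R L
    assume O: "orlicz p q s0 s f g" and um [measurable]: "u \<in> borel_measurable borel" and u: "\<And>y. y \<in> ball x0 R \<Longrightarrow> 0 \<le> u y"
      and R: "0 < R" and L: "0 < L"
      and lower: "\<And>x \<rho>. 0 < \<rho> \<Longrightarrow> ball x \<rho> \<subseteq> ball x0 R \<Longrightarrow> lower_class q c s f g u x \<rho>"
      and upper: "\<And>x \<rho>. 0 < \<rho> \<Longrightarrow> ball x \<rho> \<subseteq> ball x0 R \<Longrightarrow> upper_class q c s f g u x \<rho>"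
      and fin: "(\<integral>\<^sup>+y\<in>ball x0 R. ennreal (f \<bar>u y\<bar>) \<partial>lborel) < \<infinity>"
      and tail: "tail_int s g x0 UNIV (\<lambda>y. max (- u y) 0) \<le> ennreal (R powr (- s) * g (L / R powr s))"
    interpret orlicz p q s0 s f g by fact
    have dgu: "AE y in lborel. y \<in> ball x (3 * \<rho> / 4) \<longrightarrow> u y \<le> k + M"
      if "0 < \<rho>" "ball x \<rho> \<subseteq> ball x0 R" "0 < M"
        "(\<integral>\<^sup>+y\<in>ball x \<rho>. ennreal (f (max (u y - k) 0 / \<rho> powr s)) \<partial>lborel) \<le> ennreal (\<nu> * f (M / \<rho> powr s) * \<rho> ^ ?N)"
        "tail_int s g x (- ball x (3 * \<rho> / 4)) (\<lambda>y. max (u y - k) 0) \<le> ennreal (K * \<rho> powr (- s) * g (M / \<rho> powr s))" for x \<rho> k M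
      using upper[OF that(1,2)] unfolding upper_class_def by (intro dg[OF O um that(1,3) _ that(4,5)]) auto
    obtain M0 where "AE y in lborel. y \<in> ball x0 (3 * R / 4) \<longrightarrow> u y \<le> M0"
      using locally_bounded[OF um u R c dgu[OF R order_refl] \<nu> K lower[OF R order_refl] fin L tail] by blast
    then have M0: "AE y in lborel. y \<in> ball x0 (5 * R / 8) \<longrightarrow> u y \<le> M0"
      by (rule AE_mp) (use R in auto)
    have R58: "0 < 5 * R / 8" using R by simp
    show "\<exists>h\<ge>0. (AE y in lborel. y \<in> ball x0 (R / 2) \<longrightarrow> h \<le> u y) \<and> (AE y in lborel. y \<in> ball x0 (R / 2) \<longrightarrow> u y \<le> C * (h + L))"
    proof (rule weighted_maximum[OF um \<beta>(1) R58 M0])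
      assume neg: "AE y in lborel. y \<in> ball x0 (5 * R / 8) \<longrightarrow> u y \<le> 0"
      have "AE y in lborel. y \<in> ball x0 (R / 2) \<longrightarrow> u y \<le> C * (0 + L)"
        using neg
      proof (rule AE_mp, intro AE_I2 impI)
        fix y assume "y \<in> ball x0 (5 * R / 8) \<longrightarrow> u y \<le> 0" "y \<in> ball x0 (R / 2)"
        then have "u y \<le> 0" using R by auto
        also have "0 \<le> C * (0 + L)" using C L by simp
        finally show "u y \<le> C * (0 + L)" .
      qed
      moreover have "AE y in lborel. y \<in> ball x0 (R / 2) \<longrightarrow> 0 \<le> u y" using u R by (intro AE_I2) auto
      ultimately show ?thesis by (intro exI[of _ 0]) auto
    next
      fix \<theta> x r M
      assume \<theta>: "0 < \<theta>" and r: "0 < r" "2 * r = 5 * R / 8 - dist x0 x" and M_def: "M = \<theta> / 2 * (2 * r) powr (- \<beta>)"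
        and wmax: "AE y in lborel. y \<in> ball x0 (5 * R / 8) \<longrightarrow> u y * (5 * R / 8 - dist x0 y) powr \<beta> \<le> \<theta>"
        and bd: "AE y in lborel. y \<in> ball x r \<longrightarrow> u y \<le> 2 powr (\<beta> + 1) * M"
        and ex: "\<not> (AE y in lborel. y \<in> ball x (3 * r / 4) \<longrightarrow> u y \<le> 3 * M / 4)"
      define \<Theta> where "\<Theta> = \<theta> / R powr \<beta>"
      have \<Theta>: "0 < \<Theta>" using \<theta> R by (simp add: \<Theta>_def)
      define h where "h = \<eta> * \<eta>' / 4 * \<Theta>"
      have h: "0 < h" using \<eta> \<eta>' \<Theta> by (simp add: h_def)
      have up: "AE y in lborel. y \<in> ball x0 (R / 2) \<longrightarrow> u y \<le> 8 powr \<beta> * \<Theta>"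
        using wmax
      proof (rule AE_mp, intro AE_I2 impI)
        fix y assume *: "y \<in> ball x0 (5 * R / 8) \<longrightarrow> u y * (5 * R / 8 - dist x0 y) powr \<beta> \<le> \<theta>" "y \<in> ball x0 (R / 2)"
        have "u y * (R / 8) powr \<beta> \<le> u y * (5 * R / 8 - dist x0 y) powr \<beta>"
          using u[of y] *(2) \<beta> R by (intro mult_left_mono powr_mono2) auto
        also have "\<dots> \<le> \<theta>" using * R by auto
        finally show "u y \<le> 8 powr \<beta> * \<Theta>" using R by (simp add: \<Theta>_def powr_divide field_simps)
      qed
      have hC: "8 powr \<beta> * \<Theta> * A = C * h" using \<eta> \<eta>' by (simp add: C_def h_def)
      have upA: "8 powr \<beta> * \<Theta> \<le> C * h / A" using A by (simp add: hC[symmetric])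
      \<comment> \<open>If \<open>A * L > h\<close>, the upper bound \<open>C * h / A\<close> is
        below \<open>C * L\<close>, and 0 serves as lower bound. Otherwise every level at which the
        tail has to be absorbed is at least \<open>h\<close>, which dominates
        \<open>A * L\<close>.\<close>
      show ?thesis
      proof (cases "A * L \<le> h")
        case False
        have "AE y in lborel. y \<in> ball x0 (R / 2) \<longrightarrow> u y \<le> C * (0 + L)"
          using up
        proof (rule AE_mp, intro AE_I2 impI)
          fix y assume "y \<in> ball x0 (R / 2) \<longrightarrow> u y \<le> 8 powr \<beta> * \<Theta>" "y \<in> ball x0 (R / 2)"
          then have "u y \<le> C * h / A" using upA by auto
          also have "\<dots> \<le> C * (A * L) / A" using False C A by (intro divide_right_mono mult_left_mono) auto
          also have "\<dots> = C * (0 + L)" using A by simp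
          finally show "u y \<le> C * (0 + L)" .
        qed
        moreover have "AE y in lborel. y \<in> ball x0 (R / 2) \<longrightarrow> 0 \<le> u y" using u R by (intro AE_I2) auto
        ultimately show ?thesis by (intro exI[of _ 0]) auto
      next
        case True
        have x: "x \<in> ball x0 (5 * R / 8)" using r by simp
        have r2R: "2 * r \<le> R"
        proof -
          have "2 * r \<le> 5 * R / 8" using r(2) zero_le_dist[of x0 x] by linarith
          then show ?thesis using R by linarith
        qed
        have sub: "ball x (3 * r / 2) \<subseteq> ball x0 R"
        proof
          fix y assume "y \<in> ball x (3 * r / 2)"
          then have "dist x0 y < dist x0 x + 3 * r / 2" using dist_triangle[of x0 y x] by simp
          also have "\<dots> \<le> R" using r R by linarith
          finally show "y \<in> ball x0 R" by simp
        qed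
        have sub': "ball x r \<subseteq> ball x0 R" using sub r by (force simp: subset_eq)
        have M: "0 < M" using \<theta> r by (simp add: M_def)
        have M\<Theta>: "(2 * r / R) powr \<beta> * M = \<Theta> / 2"
          using r R by (simp add: M_def \<Theta>_def powr_divide powr_minus)
        have MM: "\<Theta> / 2 \<le> M"
        proof -
          have "(2 * r / R) powr \<beta> \<le> 1" using r r2R R \<beta> by (intro powr_le1) auto
          then have "(2 * r / R) powr \<beta> * M \<le> 1 * M" using M by (intro mult_right_mono) auto
          with M\<Theta> show ?thesis by simp
        qed
        have hM: "h \<le> \<eta>' * (M / 2)"
        proof -
          have "h = \<eta> * (\<eta>' * (\<Theta> / 2 / 2))" by (simp add: h_def)
          also have "\<dots> \<le> 1 * (\<eta>' * (M / 2))" using \<eta> \<eta>' MM \<Theta> by (intro mult_mono mult_left_mono divide_right_mono) auto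
          finally show ?thesis by simp
        qed
        have hB: "h \<le> 2 * B * M"
        proof -
          have "\<eta>' * (M / 2) \<le> 1 * M" using \<eta>' M by (intro mult_mono) auto
          moreover have "1 * M \<le> 2 * B * M" using B M by (intro mult_right_mono) auto
          ultimately show ?thesis using hM by linarith
        qed
        \<comment> \<open>Otherwise the De Giorgi iteration at the level \<open>M / 2\<close> with
          height \<open>M / 4\<close> would give \<open>u \<le> 3 * M / 4\<close> near
          \<open>x\<close>, against the choice of \<open>x\<close>.\<close>
        have big: "\<delta> * r ^ ?N \<le> measure lborel {y \<in> ball x r. M / 2 \<le> u y}"
        proof (rule ccontr)
          assume small: "\<not> ?thesis"
          have "AE y in lborel. y \<in> ball x (3 * r / 4) \<longrightarrow> u y \<le> M / 2 + M / 4"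
          proof (rule dgu[OF r(1) sub'])
            show "0 < M / 4" using M by simp
            define m where "m = M / 4 / r powr s"
            have m: "0 < m" using M r by (simp add: m_def)
            have "(\<integral>\<^sup>+y\<in>ball x r. ennreal (f (max (u y - M / 2) 0 / r powr s)) \<partial>lborel)
               \<le> (\<integral>\<^sup>+y. ennreal ((4 * B) powr q * f m) * indicator {y \<in> ball x r. M / 2 \<le> u y} y \<partial>lborel)"
            proof (rule nn_integral_mono_AE, rule AE_mp[OF bd], intro AE_I2 impI)
              fix y assume y: "y \<in> ball x r \<longrightarrow> u y \<le> 2 powr (\<beta> + 1) * M"
              show "ennreal (f (max (u y - M / 2) 0 / r powr s)) * indicator (ball x r) y \<le> ennreal ((4 * B) powr q * f m) * indicator {y \<in> ball x r. M / 2 \<le> u y} y"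
              proof (cases "y \<in> ball x r \<and> M / 2 \<le> u y")
                case True
                then have "max (u y - M / 2) 0 \<le> 4 * B * (M / 4)" using y M B by (auto simp: B_def)
                then have "max (u y - M / 2) 0 / r powr s \<le> 4 * B * m" unfolding m_def times_divide_eq_right by (intro divide_right_mono) auto
                then have "f (max (u y - M / 2) 0 / r powr s) \<le> f (4 * B * m)" by (intro f_mono) auto
                also have "\<dots> \<le> (4 * B) powr q * f m" using B m by (intro f_scale_upper) auto
                finally show ?thesis using True by (simp add: ennreal_leI)
              next
                case False
                then have "y \<in> ball x r \<Longrightarrow> max (u y - M / 2) 0 = 0" by auto
                then show ?thesis by (auto simp: f_0 indicator_def)
              qed
            qed
            also have "\<dots> = ennreal ((4 * B) powr q * f m) * emeasure lborel {y \<in> ball x r. M / 2 \<le> u y}"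
              by (rule nn_integral_cmult_indicator) measurable
            also have "emeasure lborel {y \<in> ball x r. M / 2 \<le> u y} = ennreal (measure lborel {y \<in> ball x r. M / 2 \<le> u y})"
              by (rule emeasure_subset_ball[of _ x r]) auto
            also have "\<dots> \<le> ennreal (\<delta> * r ^ ?N)" using small by (intro ennreal_leI) auto
            also have "ennreal ((4 * B) powr q * f m) * ennreal (\<delta> * r ^ ?N) = ennreal (\<nu> * f m * r ^ ?N)"
            proof -
              have "(4 * B) powr q * f m * (\<delta> * r ^ ?N) = \<nu> * f m * r ^ ?N" using B by (simp add: \<delta>_def)
              moreover have "0 \<le> (4 * B) powr q * f m" "0 \<le> \<delta> * r ^ ?N" using m r \<delta> f_nonneg[of m] by auto
              ultimately show ?thesis by (simp only: ennreal_mult[symmetric])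
            qed
            finally show "(\<integral>\<^sup>+y\<in>ball x r. ennreal (f (max (u y - M / 2) 0 / r powr s)) \<partial>lborel) \<le> ennreal (\<nu> * f (M / 4 / r powr s) * r ^ ?N)"
              by (simp add: m_def mult_left_mono)
            show "tail_int s g x (- ball x (3 * r / 4)) (\<lambda>y. max (u y - M / 2) 0) \<le> ennreal (K * r powr (- s) * g (M / 4 / r powr s))"
              unfolding K_def
            proof (rule tail_near_maximum[OF um _ r(1) c M B lower[OF r(1) sub']])
              show "tail_int s g x UNIV (\<lambda>y. max (- u y) 0) \<le> ennreal (r powr (- s) * g (2 * B * M / r powr s))"
                using r r2R L True hB by (intro tail_ok[OF um u x r(1) _ _ _ tail]) (auto simp: A_def)
              show "AE y in lborel. y \<in> ball x r \<longrightarrow> u y \<le> B * M" using bd by (simp add: B_def)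
            qed (use u sub' in auto)
          qed
          with ex show False by simp
        qed
        \<comment> \<open>Two thirds of the radius \<open>3 * r / 2\<close> is the radius
          \<open>r\<close> of \<open>big\<close>; the ball stays inside \<open>ball x0 R\<close>
          because \<open>dist x0 x + 2 * r = 5 * R / 8\<close>.\<close>
        have pos: "AE y in lborel. y \<in> ball x (3 * r / 2 / 2) \<longrightarrow> \<eta>' * (M / 2) \<le> u y"
        proof (rule growth2[OF O um])
          show "lower_class q c s f g u x (3 * r / 2)" using r sub by (intro lower) auto
          have "(2 / 3) ^ ?N * (3 * r / 2) ^ ?N = r ^ ?N" by (simp add: power_mult_distrib[symmetric])
          then show "\<delta> * (2 / 3) ^ ?N * (3 * r / 2) ^ ?N \<le> measure lborel {y \<in> ball x (2 * (3 * r / 2) / 3). M / 2 \<le> u y}"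
            using big by (simp add: mult.assoc)
          show "tail_int s g x UNIV (\<lambda>y. max (- u y) 0) \<le> ennreal ((3 * r / 2) powr (- s) * g (\<eta>' * (M / 2) / (3 * r / 2) powr s))"
            using r r2R L True hM by (intro tail_ok[OF um u x _ _ _ _ tail]) (auto simp: A_def)
        qed (use u sub M r in auto)
        obtain n where n: "R / (24 * 2 ^ n) \<le> 3 * r / 4" "(2 * r / R) powr \<beta> \<le> (2 powr (- \<beta>)) ^ n"
          using powr_dyadic_lower[OF \<beta>(1) r(1) r2R] by blast
        \<comment> \<open>The two powers match here: \<open>\<eta> ^ n * M\<close> is at least
          \<open>(2 * r / R) powr \<beta> * M = \<Theta> / 2\<close>, so the lower bound reaching
          the half ball does not depend on how small \<open>r\<close> is.\<close>
        have hn: "h \<le> \<eta> ^ Suc n * (\<eta>' * (M / 2))"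
        proof -
          have "h = \<eta> * \<eta>' / 2 * ((2 * r / R) powr \<beta> * M)" by (simp add: M\<Theta> h_def)
          also have "\<dots> \<le> \<eta> * \<eta>' / 2 * (\<eta> ^ n * M)" using n(2) \<eta> \<eta>' M unfolding \<beta>(2) by (intro mult_left_mono mult_right_mono) auto
          finally show ?thesis by (simp add: mult_ac)
        qed
        have "AE y in lborel. y \<in> ball x0 (R / 2) \<longrightarrow> \<eta> ^ Suc n * (\<eta>' * (M / 2)) \<le> u y"
        proof (rule spread[where c = c and L = L and x = x, OF um u R _ \<eta> lower _ tail x])
          fix z R k
          assume "\<And>y. y \<in> ball z R \<Longrightarrow> 0 \<le> u y" "0 < R" "0 < k" "lower_class q c s f g u z R"
            "unit_ball_vol ?N / 24 ^ ?N * R ^ ?N \<le> measure lborel {y \<in> ball z (2 * R / 3). k \<le> u y}"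
            "tail_int s g z UNIV (\<lambda>y. max (- u y) 0) \<le> ennreal (R powr (- s) * g (\<eta> * k / R powr s))"
          then show "AE y in lborel. y \<in> ball z (R / 2) \<longrightarrow> \<eta> * k \<le> u y"
            by (intro growth1[OF O um]) (auto simp: \<omega>_def)
        next
          show "0 < \<eta>' * (M / 2)" using \<eta>' M by simp
          show "shift_const p q ?N * L \<le> \<eta> ^ Suc n * (\<eta>' * (M / 2))" using True hn by (simp add: A_def)
          show "AE y in lborel. y \<in> ball x (R / (24 * 2 ^ n)) \<longrightarrow> \<eta>' * (M / 2) \<le> u y"
            using pos by (rule AE_mp) (use n(1) in auto)
        qed (use L in auto)
        then have "AE y in lborel. y \<in> ball x0 (R / 2) \<longrightarrow> h \<le> u y"
          by (rule AE_mp) (use hn in auto)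
        moreover have "AE y in lborel. y \<in> ball x0 (R / 2) \<longrightarrow> u y \<le> C * (h + L)"
          using up
        proof (rule AE_mp, intro AE_I2 impI)
          fix y assume "y \<in> ball x0 (R / 2) \<longrightarrow> u y \<le> 8 powr \<beta> * \<Theta>" "y \<in> ball x0 (R / 2)"
          then have "u y \<le> C * h / A" using upA by auto
          also have "\<dots> \<le> C * h / 1" using C h A by (intro divide_left_mono) auto
          also have "\<dots> \<le> C * (h + L)" using C L by (simp add: distrib_left)
          finally show "u y \<le> C * (h + L)" .
        qed
        ultimately show ?thesis using h by (intro exI[of _ h]) auto
      qed
    qed
  qed
qed

subsection \<open>Convex functions of power growth\<close>

lemma deriv_Ici_works:
  assumes "f differentiable_on {0..}" "0 \<le> t"
  shows "(f has_real_derivative deriv_Ici f t) (at t within {0..})"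
  using assms unfolding deriv_Ici_def differentiable_on_def
  by (auto simp: vector_derivative_works has_real_derivative_iff_has_vector_derivative)

text \<open>The growth condition is the sign of the derivative of \<open>f x * x powr (- a)\<close>,
  so this quotient is monotone in the corresponding direction.\<close>

lemma growth_ratio_mono:
  fixes f :: "real \<Rightarrow> real" and a :: real
  assumes f: "f differentiable_on {0..}" and t: "0 < t" "1 \<le> l"
  shows "(\<And>x. 0 < x \<Longrightarrow> x * deriv_Ici f x \<le> a * f x) \<Longrightarrow> f (l * t) \<le> l powr a * f t"
    and "(\<And>x. 0 < x \<Longrightarrow> a * f x \<le> x * deriv_Ici f x) \<Longrightarrow> l powr a * f t \<le> f (l * t)"
proof -
  have der: "((\<lambda>x. f x * x powr (- a)) has_real_derivative (x * deriv_Ici f x - a * f x) * x powr (- a - 1)) (at x)" if "0 < x" for x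
  proof -
    have "(f has_real_derivative deriv_Ici f x) (at x within {0..})" using that by (intro deriv_Ici_works f) auto
    moreover have "at x within {0..} = at x" using that by (intro at_within_interior) (simp add: interior_real_atLeast)
    ultimately have [derivative_intros]: "(f has_real_derivative deriv_Ici f x) (at x)" by simp
    have "x powr (- a) = x * x powr (- a - 1)" using that by (simp add: powr_mult_base)
    then show ?thesis using that by (auto intro!: derivative_eq_intros simp: algebra_simps)
  qed
  have tl: "t \<le> l * t" using t by (simp add: mult_le_cancel_right1)
  have conv: "f (l * t) * (l * t) powr (- a) = f (l * t) / l powr a / t powr a" "f t * t powr (- a) = f t / t powr a"
    using t by (auto simp: powr_mult powr_minus divide_inverse)
  show "f (l * t) \<le> l powr a * f t" if a: "\<And>x. 0 < x \<Longrightarrow> x * deriv_Ici f x \<le> a * f x"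
  proof -
    have "f (l * t) * (l * t) powr (- a) \<le> f t * t powr (- a)"
    proof (rule DERIV_nonpos_imp_nonincreasing[OF tl])
      fix x assume "t \<le> x" "x \<le> l * t"
      then have "0 < x" using t by linarith
      then show "\<exists>y. ((\<lambda>x. f x * x powr (- a)) has_real_derivative y) (at x) \<and> y \<le> 0"
        using der[of x] a[of x] by (intro exI conjI) (auto simp: mult_le_0_iff)
    qed
    then show ?thesis unfolding conv using t by (simp add: divide_le_cancel field_simps)
  qed
  show "l powr a * f t \<le> f (l * t)" if a: "\<And>x. 0 < x \<Longrightarrow> a * f x \<le> x * deriv_Ici f x"
  proof -
    have "f t * t powr (- a) \<le> f (l * t) * (l * t) powr (- a)"
    proof (rule DERIV_nonneg_imp_nondecreasing[OF tl])
      fix x assume "t \<le> x" "x \<le> l * t"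
      then have "0 < x" using t by linarith
      then show "\<exists>y. ((\<lambda>x. f x * x powr (- a)) has_real_derivative y) (at x) \<and> 0 \<le> y"
        using der[of x] a[of x] by (intro exI conjI) auto
    qed
    then show ?thesis unfolding conv using t by (simp add: divide_le_cancel field_simps)
  qed
qed

text \<open>At 0 the growth condition reads \<open>0 \<le> 0 \<le> 0\<close>, so the value is found
  from the difference quotient, squeezed between 0 and \<open>f 1 * t powr (p - 1)\<close>.\<close>

lemma deriv_Ici_0:
  fixes f :: "real \<Rightarrow> real"
  assumes f: "f differentiable_on {0..}" "f 0 = 0" and nn: "\<And>t. 0 \<le> t \<Longrightarrow> 0 \<le> f t" and p: "1 < p"
    and scale: "\<And>t l. 0 < t \<Longrightarrow> 1 \<le> l \<Longrightarrow> l powr p * f t \<le> f (l * t)"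
  shows "deriv_Ici f 0 = 0"
proof -
  have "((\<lambda>t. (f t - f 0) / (t - 0)) \<longlongrightarrow> deriv_Ici f 0) (at 0 within {0..})"
    using deriv_Ici_works[OF f(1), of 0] by (simp add: has_field_derivative_iff)
  then have lim: "((\<lambda>t. f t / t) \<longlongrightarrow> deriv_Ici f 0) (at_right 0)"
    using f(2) by (auto intro: tendsto_within_subset simp: greaterThan_def)
  have le: "f t / t \<le> f 1 * t powr (p - 1)" if "0 < t" "t \<le> 1" for t
  proof -
    have "(1 / t) powr p * f t \<le> f 1" using scale[of t "1 / t"] that by simp
    then have "f t \<le> f 1 * t powr p" using that by (simp add: powr_divide field_simps)
    also have "t powr p = t * t powr (p - 1)" using that by (simp add: powr_mult_base)
    finally have "f t \<le> f 1 * t powr (p - 1) * t" by (simp only: mult_ac)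
    then show ?thesis using that by (simp add: pos_divide_le_eq)
  qed
  have "((\<lambda>t. f t / t) \<longlongrightarrow> 0) (at_right 0)"
  proof (rule tendsto_sandwich)
    show "\<forall>\<^sub>F t in at_right 0. 0 \<le> f t / t"
      using nn by (auto simp: eventually_at_right_less eventually_at_topological intro!: eventually_mono[OF eventually_at_right_less[of 0]])
    show "\<forall>\<^sub>F t in at_right 0. f t / t \<le> f 1 * t powr (p - 1)"
      using eventually_at_right_real[of 0 1, OF zero_less_one] by (rule eventually_mono) (auto intro: le)
    have "((\<lambda>t. t powr (p - 1)) \<longlongrightarrow> 0) (at_right 0)"
      by (rule tendsto_zero_powrI[where b = "p - 1"]) (use p in \<open>auto intro!: tendsto_intros eventually_at_right_less eventually_mono[OF eventually_at_right_less[of 0]]\<close>)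
    then show "((\<lambda>t. f 1 * t powr (p - 1)) \<longlongrightarrow> 0) (at_right 0)"
      using tendsto_mult_left[of "\<lambda>t. t powr (p - 1)" 0 "at_right 0" "f 1"] by simp
  qed simp
  with lim show ?thesis by (rule tendsto_unique[rotated]) simp
qed

text \<open>Composing with \<open>max t 0\<close> makes \<open>f\<close> and its derivative monotone, hence Borel, on the whole line.\<close>

lemma orlicz_of_growth:
  fixes f :: "real \<Rightarrow> real" and p q s0 s :: real
  assumes pq: "1 < p" "p \<le> q" and s: "0 < s0" "s0 \<le> s" "s < 1"
    and nn: "\<forall>t\<ge>0. 0 \<le> f t" and conv: "convex_on {0..} f" and mono: "strict_mono_on {0..} f"
    and diff: "f differentiable_on {0..}" and f0: "f 0 = 0"
    and gr: "\<forall>t\<ge>0. p * f t \<le> t * deriv_Ici f t \<and> t * deriv_Ici f t \<le> q * f t"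
  shows "orlicz p q s0 s (\<lambda>t. f (max t 0)) (\<lambda>t. deriv_Ici f (max t 0))"
proof -
  have up: "f (l * t) \<le> l powr q * f t" if "0 < t" "1 \<le> l" for l t
    using growth_ratio_mono(1)[OF diff that, of q] gr by auto
  have lo: "l powr p * f t \<le> f (l * t)" if "0 < t" "1 \<le> l" for l t
    using growth_ratio_mono(2)[OF diff that, of p] gr by auto
  have g0: "deriv_Ici f 0 = 0" by (rule deriv_Ici_0[OF diff f0 _ pq(1) lo]) (use nn in auto)
  have fpos: "0 < f t" if "0 < t" for t using strict_mono_onD[OF mono, of 0 t] that f0 by simp
  have fmono: "f a \<le> f b" if "0 \<le> a" "a \<le> b" for a b
    using strict_mono_onD[OF mono, of a b] that by (cases "a = b") auto
  have tangent: "deriv_Ici f c * (x - c) \<le> f x - f c" if "0 < c" "0 \<le> x" for c x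
    using that deriv_Ici_works[OF diff, of c]
    by (intro convex_on_imp_above_tangent[OF conv]) (auto simp: interior_real_atLeast)
  have fdiff: "f b - f a \<le> deriv_Ici f b * (b - a)" if "0 \<le> a" "a \<le> b" for a b
  proof (cases "b = 0")
    case False
    then show ?thesis using tangent[of b a] that by (simp add: algebra_simps)
  qed (use that in simp)
  \<comment> \<open>Convexity yields a supporting tangent at interior points of the half-line. For
    \<open>a = 0\<close> monotonicity reduces to the derivative being nonnegative.\<close>
  have gmono: "deriv_Ici f a \<le> deriv_Ici f b" if "0 \<le> a" "a \<le> b" for a b
  proof (cases "a = 0")
    case True
    show ?thesis
    proof (cases "b = 0")
      case False
      then have "0 < b" using that by simp
      have "0 \<le> p * f b" using nn pq that by simp
      also have "\<dots> \<le> b * deriv_Ici f b" using gr that by auto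
      finally show ?thesis using True g0 \<open>0 < b\<close> by (simp add: zero_le_mult_iff)
    qed (use True in simp)
  next
    case False
    show ?thesis
    proof (cases "a = b")
      case ne: False
      have "deriv_Ici f a * (b - a) \<le> f b - f a" using tangent[of a b] that False by simp
      also have "\<dots> \<le> deriv_Ici f b * (b - a)" using fdiff that by simp
      finally show ?thesis using that ne by simp
    qed simp
  qed
  show ?thesis
  proof
    show "(\<lambda>t. f (max t 0)) \<in> borel_measurable borel"
      by (rule borel_measurable_mono) (auto simp: mono_def intro!: fmono)
    show "(\<lambda>t. deriv_Ici f (max t 0)) \<in> borel_measurable borel"
      by (rule borel_measurable_mono) (auto simp: mono_def intro!: gmono)
  next
    fix l t :: real assume lt: "1 \<le> l" "0 \<le> t"
    then have "0 \<le> l * t" by simp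
    then show "f (max (l * t) 0) \<le> l powr q * f (max t 0)" "l powr p * f (max t 0) \<le> f (max (l * t) 0)"
      using lt up[of t l] lo[of t l] f0 by (cases "t = 0"; simp)+
  qed (use assms fpos fmono gmono fdiff g0 in auto)
qed

subsection \<open>Passing to a Borel representative\<close>

text \<open>Making the dependence on the function explicit in \<open>\<Phi>\<close> allows the
  exchange of \<open>u\<close> for \<open>v\<close> under iterated integrals, one variable at a
  time.\<close>

lemma nn_integral_lebesgue_cong_AE:
  fixes \<Phi> :: "real \<Rightarrow> 'a::euclidean_space \<Rightarrow> ennreal"
  assumes uv: "AE y in lborel. u y = v y"
  shows "(\<integral>\<^sup>+x. \<Phi> (u x) x \<partial>lebesgue) = (\<integral>\<^sup>+x. \<Phi> (v x) x \<partial>lborel)"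
  unfolding nn_integral_completion by (rule nn_integral_cong_AE) (use uv in auto)

lemma modular_W_eq_energy:
  fixes u v :: "'a::euclidean_space \<Rightarrow> real"
  assumes uv: "AE y in lborel. u y = v y"
  shows "modular_W s f (ball x r) (\<lambda>y. \<phi> (u y)) = energy s (\<lambda>t. f (max t 0)) x r (\<lambda>y. \<phi> (v y))"
proof -
  have *: "max (\<bar>a\<bar> / norm b powr s) 0 = \<bar>a\<bar> / norm b powr s" for a :: real and b :: 'a
    by (intro max_absorb1) simp
  define I where "I a b x' y = ennreal (f (\<bar>\<phi> a - \<phi> b\<bar> / norm (x' - y) powr s) / norm (x' - y) ^ DIM('a))" for a b and x' y :: 'a
  have inner: "(\<integral>\<^sup>+y\<in>ball x r. I a (u y) z y \<partial>lebesgue) = (\<integral>\<^sup>+y\<in>ball x r. I a (v y) z y \<partial>lborel)" for a z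
    by (rule nn_integral_lebesgue_cong_AE[OF uv, of "\<lambda>b y. I a b z y * indicator (ball x r) y"])
  have "(\<integral>\<^sup>+z\<in>ball x r. (\<integral>\<^sup>+y\<in>ball x r. I (u z) (u y) z y \<partial>lebesgue) \<partial>lebesgue)
     = (\<integral>\<^sup>+z\<in>ball x r. (\<integral>\<^sup>+y\<in>ball x r. I (v z) (v y) z y \<partial>lborel) \<partial>lborel)"
    unfolding inner
    by (rule nn_integral_lebesgue_cong_AE[OF uv, of "\<lambda>a z. (\<integral>\<^sup>+y\<in>ball x r. I a (v y) z y \<partial>lborel) * indicator (ball x r) z"])
  then show ?thesis unfolding modular_W_def energy_def double_int_def I_def * by simp
qed

lemma cross_term_eq:
  fixes u v :: "'a::euclidean_space \<Rightarrow> real"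
  assumes uv: "AE y in lborel. u y = v y" and g0: "deriv_Ici f 0 = 0"
  shows "ennreal (1 - s) * (\<integral>\<^sup>+a\<in>ball x r. (\<integral>\<^sup>+b\<in>{y. u y > k}.
       ennreal (deriv_Ici f (max (u b - k) 0 / norm (a - b) powr s) * (max (- (u a - k)) 0 / norm (a - b) powr s)
                   / norm (a - b) ^ DIM('a)) \<partial>lebesgue) \<partial>lebesgue) = cross_term s (\<lambda>t. deriv_Ici f (max t 0)) x r v k"
proof -
  have *: "max (max c 0 / norm b powr s) 0 = max c 0 / norm b powr s" for c :: real and b :: 'a
    by (intro max_absorb1) simp
  define I where "I a b x' y = ennreal (deriv_Ici f (max (b - k) 0 / norm (x' - y) powr s) * (max (k - a) 0 / norm (x' - y) powr s)
                   / norm (x' - y) ^ DIM('a))" for a b and x' y :: 'a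
  have ind: "I a (u y) z y * indicator {y. u y > k} y = I a (u y) z y" for a z y
    by (auto simp: I_def indicator_def g0)
  have inner: "(\<integral>\<^sup>+y\<in>{y. u y > k}. I a (u y) z y \<partial>lebesgue) = (\<integral>\<^sup>+y. I a (v y) z y \<partial>lborel)" for a z
    unfolding ind by (rule nn_integral_lebesgue_cong_AE[OF uv, of "\<lambda>b y. I a b z y"])
  have "(\<integral>\<^sup>+z\<in>ball x r. (\<integral>\<^sup>+y\<in>{y. u y > k}. I (u z) (u y) z y \<partial>lebesgue) \<partial>lebesgue)
     = (\<integral>\<^sup>+z\<in>ball x r. (\<integral>\<^sup>+y. I (v z) (v y) z y \<partial>lborel) \<partial>lborel)"
    unfolding inner
    by (rule nn_integral_lebesgue_cong_AE[OF uv, of "\<lambda>a z. (\<integral>\<^sup>+y. I a (v y) z y \<partial>lborel) * indicator (ball x r) z"])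
  then show ?thesis unfolding cross_term_def I_def * minus_diff_eq by simp
qed

lemma caccioppoli_rhs_eq:
  fixes u v :: "'a::euclidean_space \<Rightarrow> real"
  assumes uv: "AE y in lborel. u y = v y" and \<phi>: "\<And>t. 0 \<le> \<phi> t"
  shows "ennreal (c * (R / (R - r)) powr q) * modular_L f (ball x R) (\<lambda>y. \<phi> (u y) / R powr s)
       + ennreal (c * (R / (R - r)) powr (real DIM('a) + s * q)) *
         (\<integral>\<^sup>+y\<in>ball x R. ennreal \<bar>\<phi> (u y)\<bar> \<partial>lebesgue) *
         (ennreal (1 - s) *
          (\<integral>\<^sup>+y\<in>- ball x r.
             ennreal (deriv_Ici f (\<phi> (u y) / norm (y - x) powr s) / norm (y - x) powr (real DIM('a) + s))
           \<partial>lebesgue))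
     = caccioppoli_rhs q c s (\<lambda>t. f (max t 0)) (\<lambda>t. deriv_Ici f (max t 0)) x r R (\<lambda>y. \<phi> (v y))"
proof -
  have *: "max (\<phi> a / b powr s) 0 = \<phi> a / b powr s" "\<bar>\<phi> a / b powr s\<bar> = \<phi> a / b powr s" "\<bar>\<phi> a\<bar> = \<phi> a" for a b :: real
    using \<phi>[of a] by auto
  have 1: "modular_L f (ball x R) (\<lambda>y. \<phi> (u y) / R powr s) = (\<integral>\<^sup>+y\<in>ball x R. ennreal (f (\<phi> (v y) / R powr s)) \<partial>lborel)"
    unfolding modular_L_def *
    by (rule nn_integral_lebesgue_cong_AE[OF uv, of "\<lambda>a y. ennreal (f (\<phi> a / R powr s)) * indicator (ball x R) y"])
  have 2: "(\<integral>\<^sup>+y\<in>ball x R. ennreal (\<phi> (u y)) \<partial>lebesgue) = (\<integral>\<^sup>+y\<in>ball x R. ennreal (\<phi> (v y)) \<partial>lborel)"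
    by (rule nn_integral_lebesgue_cong_AE[OF uv, of "\<lambda>a y. ennreal (\<phi> a) * indicator (ball x R) y"])
  have 3: "(\<integral>\<^sup>+y\<in>- ball x r. ennreal (deriv_Ici f (\<phi> (u y) / norm (y - x) powr s) / norm (y - x) powr (real DIM('a) + s)) \<partial>lebesgue)
     = (\<integral>\<^sup>+y\<in>- ball x r. ennreal (deriv_Ici f (\<phi> (v y) / norm (y - x) powr s) / norm (y - x) powr (real DIM('a) + s)) \<partial>lborel)"
    by (rule nn_integral_lebesgue_cong_AE[OF uv, of "\<lambda>a y. ennreal (deriv_Ici f (\<phi> a / norm (y - x) powr s) / norm (y - x) powr (real DIM('a) + s)) * indicator (- ball x r) y"])
  show ?thesis unfolding caccioppoli_rhs_def tail_int_def * 1 2 3 ..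
qed

text \<open>An open set contains none of its frontier points, so these lie outside any ball
  contained in it.\<close>

lemma boundary_dist_ge:
  assumes "open \<Omega>" "ball x \<rho> \<subseteq> \<Omega>"
  shows "ereal \<rho> \<le> boundary_dist x \<Omega>"
  unfolding boundary_dist_def
proof (rule INF_greatest)
  fix y assume "y \<in> frontier \<Omega>"
  then have "y \<notin> \<Omega>" using assms(1) by (simp add: frontier_def interior_open)
  with assms(2) have "y \<notin> ball x \<rho>" by blast
  then show "ereal \<rho> \<le> ereal (dist x y)" by simp
qed

lemma G_minus_imp_lower_class:
  fixes u v :: "'a::euclidean_space \<Rightarrow> real"
  assumes u: "u \<in> G_minus \<Omega> q c s f" and uv: "AE y in lborel. u y = v y" and g0: "deriv_Ici f 0 = 0"
    and \<Omega>: "open \<Omega>" and \<rho>: "0 < \<rho>" "ball x \<rho> \<subseteq> \<Omega>"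
  shows "lower_class q c s (\<lambda>t. f (max t 0)) (\<lambda>t. deriv_Ici f (max t 0)) v x \<rho>"
  unfolding lower_class_def
proof (intro allI impI)
  fix r R k assume *: "0 < r" "r < R" "R \<le> \<rho>"
  have "x \<in> \<Omega>" using \<rho> by auto
  moreover have "ball x R \<subseteq> \<Omega>" using \<rho>(2) *(3) by (auto simp: subset_eq)
  then have "ereal R \<le> boundary_dist x \<Omega>" by (rule boundary_dist_ge[OF \<Omega>])
  ultimately have "caccioppoli q c s f x r R (\<lambda>x. max (- (u x - k)) 0) (\<lambda>x. max (u x - k) 0) {y. u y > k}"
    using u * unfolding G_minus_def by blast
  then have "modular_W s f (ball x r) (\<lambda>y. max (- (u y - k)) 0) + cross_term s (\<lambda>t. deriv_Ici f (max t 0)) x r v k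
     \<le> caccioppoli_rhs q c s (\<lambda>t. f (max t 0)) (\<lambda>t. deriv_Ici f (max t 0)) x r R (\<lambda>y. max (- (v y - k)) 0)"
    unfolding caccioppoli_def cross_term_eq[OF uv g0]
    by (subst (asm) caccioppoli_rhs_eq[OF uv, of "\<lambda>t. max (- (t - k)) 0"]) auto
  then show "energy s (\<lambda>t. f (max t 0)) x r (\<lambda>y. max (k - v y) 0) + cross_term s (\<lambda>t. deriv_Ici f (max t 0)) x r v k
     \<le> caccioppoli_rhs q c s (\<lambda>t. f (max t 0)) (\<lambda>t. deriv_Ici f (max t 0)) x r R (\<lambda>y. max (k - v y) 0)"
    unfolding modular_W_eq_energy[OF uv, of s f x r "\<lambda>t. max (- (t - k)) 0"] by simp
qed

lemma G_plus_imp_upper_class: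
  fixes u v :: "'a::euclidean_space \<Rightarrow> real"
  assumes u: "u \<in> G_plus \<Omega> q c s f" and uv: "AE y in lborel. u y = v y"
    and \<Omega>: "open \<Omega>" and \<rho>: "0 < \<rho>" "ball x \<rho> \<subseteq> \<Omega>"
  shows "upper_class q c s (\<lambda>t. f (max t 0)) (\<lambda>t. deriv_Ici f (max t 0)) v x \<rho>"
  unfolding upper_class_def
proof (intro allI impI)
  fix r R k assume *: "0 < r" "r < R" "R \<le> \<rho>"
  have "x \<in> \<Omega>" using \<rho> by auto
  moreover have "ball x R \<subseteq> \<Omega>" using \<rho>(2) *(3) by (auto simp: subset_eq)
  then have "ereal R \<le> boundary_dist x \<Omega>" by (rule boundary_dist_ge[OF \<Omega>])
  ultimately have "caccioppoli q c s f x r R (\<lambda>x. max (u x - k) 0) (\<lambda>x. max (- (u x - k)) 0) {y. u y < k}"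
    using u * unfolding G_plus_def by blast
  then have "modular_W s f (ball x r) (\<lambda>y. max (u y - k) 0)
     \<le> caccioppoli_rhs q c s (\<lambda>t. f (max t 0)) (\<lambda>t. deriv_Ici f (max t 0)) x r R (\<lambda>y. max (v y - k) 0)"
    unfolding caccioppoli_def
    by (subst (asm) caccioppoli_rhs_eq[OF uv, of "\<lambda>t. max (t - k) 0"]) (auto elim: order_trans[rotated])
  then show "energy s (\<lambda>t. f (max t 0)) x r (\<lambda>y. max (v y - k) 0)
     \<le> caccioppoli_rhs q c s (\<lambda>t. f (max t 0)) (\<lambda>t. deriv_Ici f (max t 0)) x r R (\<lambda>y. max (v y - k) 0)"
    unfolding modular_W_eq_energy[OF uv, of s f x r "\<lambda>t. max (t - k) 0"] .
qed

text \<open>A strict bound on the infimum yields an actual \<open>t\<close> below \<open>b\<close>,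
  so the question whether the infimum is attained does not arise.\<close>

lemma gen_inverse_less_imp_le:
  assumes "gen_inverse g y < ennreal b" "\<And>t. 0 \<le> t \<Longrightarrow> t \<le> b \<Longrightarrow> g t \<le> g b"
  shows "y \<le> ennreal (g b)"
proof -
  obtain t where t: "0 \<le> t" "y \<le> ennreal (g t)" "ennreal t < ennreal b"
    using assms(1) unfolding gen_inverse_def INF_less_iff by auto
  then have "t \<le> b" by (simp add: ennreal_less_iff)
  with t assms(2)[of t] show ?thesis by (meson ennreal_leI order_trans)
qed

text \<open>Because \<open>v\<close> is nonnegative on the ball and the derivative vanishes at 0,
  the exterior integral in \<open>Tail\<close> is an integral over the whole space, the form that
  can be recentred.\<close>

lemma tail_int_le_of_Tail_less:
  fixes u v :: "'a::euclidean_space \<Rightarrow> real"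
  assumes O: "orlicz p q s0 s (\<lambda>t. f (max t 0)) (\<lambda>t. deriv_Ici f (max t 0))"
    and uv: "AE y in lborel. u y = v y" and v: "\<And>y. y \<in> ball x0 R \<Longrightarrow> 0 \<le> v y" and R: "0 < R" and L: "0 < L"
    and Tail: "Tail (deriv_Ici f) s (\<lambda>y. max (- u y) 0) x0 R < ennreal L"
  shows "tail_int s (\<lambda>t. deriv_Ici f (max t 0)) x0 UNIV (\<lambda>y. max (- v y) 0)
    \<le> ennreal (R powr (- s) * deriv_Ici f (max (L / R powr s) 0))"
proof -
  interpret orlicz p q s0 s "\<lambda>t. f (max t 0)" "\<lambda>t. deriv_Ici f (max t 0)" by (rule O)
  have Rs: "0 < R powr s" using R by simp
  define I where "I = (\<integral>\<^sup>+y\<in>- ball x0 R. ennreal (deriv_Ici f (\<bar>max (- u y) 0\<bar> / norm (y - x0) powr s) / norm (y - x0) powr (real DIM('a) + s)) \<partial>lebesgue)"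
  define y where "y = ennreal ((1 - s) * R powr s) * I"
  have "gen_inverse (deriv_Ici f) y < ennreal (L / R powr s)"
  proof (rule ccontr)
    assume "\<not> ?thesis"
    then have "ennreal (R powr s) * ennreal (L / R powr s) \<le> ennreal (R powr s) * gen_inverse (deriv_Ici f) y"
      by (intro mult_left_mono) auto
    also have "\<dots> < ennreal L" using Tail by (simp add: Tail_def y_def I_def)
    also have "ennreal (R powr s) * ennreal (L / R powr s) = ennreal L" using Rs L by (simp add: ennreal_mult[symmetric])
    finally show False by simp
  qed
  then have y: "y \<le> ennreal (deriv_Ici f (L / R powr s))"
  proof (rule gen_inverse_less_imp_le)
    fix t assume "0 \<le> t" "t \<le> L / R powr s"
    then show "deriv_Ici f t \<le> deriv_Ici f (L / R powr s)" using g_mono[of t "L / R powr s"] by simp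
  qed
  have I: "I = (\<integral>\<^sup>+y. ennreal (deriv_Ici f (max (max (- v y) 0 / norm (y - x0) powr s) 0) / norm (y - x0) powr (real DIM('a) + s)) \<partial>lborel)"
  proof -
    have *: "\<bar>max a 0\<bar> / b powr s = max (max a 0 / b powr s) 0" for a b :: real
      by (subst max_absorb1[of 0]) auto
    have "I = (\<integral>\<^sup>+y\<in>- ball x0 R. ennreal (deriv_Ici f (max (max (- v y) 0 / norm (y - x0) powr s) 0) / norm (y - x0) powr (real DIM('a) + s)) \<partial>lborel)"
      unfolding I_def *
      by (rule nn_integral_lebesgue_cong_AE[OF uv, of "\<lambda>a y. ennreal (deriv_Ici f (max (max (- a) 0 / norm (y - x0) powr s) 0) / norm (y - x0) powr (real DIM('a) + s)) * indicator (- ball x0 R) y"])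
    also have "\<dots> = (\<integral>\<^sup>+y. ennreal (deriv_Ici f (max (max (- v y) 0 / norm (y - x0) powr s) 0) / norm (y - x0) powr (real DIM('a) + s)) \<partial>lborel)"
    proof (rule nn_integral_cong)
      fix y
      show "ennreal (deriv_Ici f (max (max (- v y) 0 / norm (y - x0) powr s) 0) / norm (y - x0) powr (real DIM('a) + s)) * indicator (- ball x0 R) y
        = ennreal (deriv_Ici f (max (max (- v y) 0 / norm (y - x0) powr s) 0) / norm (y - x0) powr (real DIM('a) + s))"
        using v[of y] g_0 by (cases "y \<in> ball x0 R") (auto simp: indicator_def max_def)
    qed
    finally show ?thesis .
  qed
  have "tail_int s (\<lambda>t. deriv_Ici f (max t 0)) x0 UNIV (\<lambda>y. max (- v y) 0) = ennreal (1 - s) * I"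
    unfolding tail_int_def I by simp
  also have "\<dots> = ennreal (R powr (- s)) * y"
  proof -
    have "R powr (- s) * ((1 - s) * R powr s) = 1 - s" using R by (simp add: powr_minus)
    then have "ennreal (R powr (- s)) * ennreal ((1 - s) * R powr s) = ennreal (1 - s)"
      using s1 by (subst ennreal_mult[symmetric]) auto
    then show ?thesis by (simp only: y_def mult.assoc[symmetric])
  qed
  also have "\<dots> \<le> ennreal (R powr (- s)) * ennreal (deriv_Ici f (L / R powr s))"
    using y by (rule mult_left_mono) simp
  also have "\<dots> = ennreal (R powr (- s) * deriv_Ici f (max (L / R powr s) 0))"
    using L Rs g_nonneg[of "L / R powr s"] by (simp add: ennreal_mult)
  finally show ?thesis .
qed

section \<open>Essential bounds and the final limit\<close>

lemma ess_sup_on_le: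
  assumes [measurable]: "u \<in> borel_measurable lebesgue" and S: "S \<in> sets lebesgue"
    and AE: "AE y in lebesgue. y \<in> S \<longrightarrow> u y \<le> b"
  shows "ess_sup_on S u \<le> ereal b"
  unfolding ess_sup_on_def
proof (rule esssup_I)
  show "(\<lambda>x. ereal (u x)) \<in> borel_measurable (restrict_space lebesgue S)"
    by (rule measurable_restrict_space1) measurable
  show "AE x in restrict_space lebesgue S. ereal (u x) \<le> ereal b"
    using AE S by (subst AE_restrict_space_iff) auto
qed

lemma ess_inf_on_ge:
  assumes "u \<in> borel_measurable lebesgue" and "S \<in> sets lebesgue"
    and "AE y in lebesgue. y \<in> S \<longrightarrow> b \<le> u y"
  shows "ereal b \<le> ess_inf_on S u"
proof -
  have "ess_sup_on S (\<lambda>y. - u y) \<le> ereal (- b)"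
    using assms by (intro ess_sup_on_le) auto
  then have "- ereal (- b) \<le> - ess_sup_on S (\<lambda>y. - u y)" by (simp only: ereal_minus_le_minus)
  then show ?thesis by (simp add: ess_inf_on_def)
qed

theorem theorem1p1:
  fixes s0 p q c :: real
  assumes "0 < s0" "s0 < 1" "1 < p" "p \<le> q" "0 < c"
  shows "\<exists>C>0. \<forall>(s::real) (\<Omega>::(real ^ 'n) set) (f::real \<Rightarrow> real) (u::real ^ 'n \<Rightarrow> real) x0 R.
           s0 \<le> s \<and> s < 1 \<and> open \<Omega> \<and>
           (\<forall>t\<ge>0. 0 \<le> f t) \<and> convex_on {0..} f \<and> strict_mono_on {0..} f \<and>
           f differentiable_on {0..} \<and> f 0 = 0 \<and> f 1 = 1 \<and>
           (\<forall>t\<ge>0. p * f t \<le> t * deriv_Ici f t \<and> t * deriv_Ici f t \<le> q * f t) \<and>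
           u \<in> De_Giorgi_class \<Omega> q c s f \<and>
           0 < R \<and> ball x0 R \<subseteq> \<Omega> \<and> (AE x in lebesgue. x \<in> ball x0 R \<longrightarrow> 0 \<le> u x) \<longrightarrow>
           ess_sup_on (ball x0 (R / 2)) u
             \<le> ereal C * (ess_inf_on (ball x0 (R / 2)) u
                 + enn2ereal (Tail (deriv_Ici f) s (\<lambda>y. max (- u y) 0) x0 R))"
proof -
  from harnack_borel[OF assms(3,4,1,5), where 'a = "real ^ 'n"]
  obtain C where C: "0 < C" and harnack:
    "\<And>s f g (u :: real ^ 'n \<Rightarrow> real) x0 R L. orlicz p q s0 s f g \<Longrightarrow> u \<in> borel_measurable borel \<Longrightarrow>
      (\<And>y. y \<in> ball x0 R \<Longrightarrow> 0 \<le> u y) \<Longrightarrow> 0 < R \<Longrightarrow> 0 < L \<Longrightarrow>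
      (\<And>x \<rho>. 0 < \<rho> \<Longrightarrow> ball x \<rho> \<subseteq> ball x0 R \<Longrightarrow> lower_class q c s f g u x \<rho>) \<Longrightarrow>
      (\<And>x \<rho>. 0 < \<rho> \<Longrightarrow> ball x \<rho> \<subseteq> ball x0 R \<Longrightarrow> upper_class q c s f g u x \<rho>) \<Longrightarrow>
      (\<integral>\<^sup>+y\<in>ball x0 R. ennreal (f \<bar>u y\<bar>) \<partial>lborel) < \<infinity> \<Longrightarrow>
      tail_int s g x0 UNIV (\<lambda>y. max (- u y) 0) \<le> ennreal (R powr (- s) * g (L / R powr s)) \<Longrightarrow>
      \<exists>h\<ge>0. (AE y in lborel. y \<in> ball x0 (R / 2) \<longrightarrow> h \<le> u y) \<and> (AE y in lborel. y \<in> ball x0 (R / 2) \<longrightarrow> u y \<le> C * (h + L))"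
    by blast
  show ?thesis
  proof (intro exI[of _ C] conjI allI impI C, elim conjE)
    fix s :: real and \<Omega> :: "(real ^ 'n) set" and f :: "real \<Rightarrow> real" and u :: "real ^ 'n \<Rightarrow> real" and x0 R
    assume s: "s0 \<le> s" "s < 1" and \<Omega>: "open \<Omega>" and f: "\<forall>t\<ge>0. 0 \<le> f t" "convex_on {0..} f" "strict_mono_on {0..} f"
       "f differentiable_on {0..}" "f 0 = 0"
      and gr: "\<forall>t\<ge>0. p * f t \<le> t * deriv_Ici f t \<and> t * deriv_Ici f t \<le> q * f t"
      and u: "u \<in> De_Giorgi_class \<Omega> q c s f" and R: "0 < R" and sub: "ball x0 R \<subseteq> \<Omega>"
      and nonneg: "AE x in lebesgue. x \<in> ball x0 R \<longrightarrow> 0 \<le> u x"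
    define F where "F = (\<lambda>t. f (max t 0))"
    define G where "G = (\<lambda>t. deriv_Ici f (max t 0))"
    have O: "orlicz p q s0 s F G" unfolding F_def G_def using assms s f gr by (intro orlicz_of_growth) auto
    interpret orlicz p q s0 s F G by (rule O)
    have g0: "deriv_Ici f 0 = 0" using g_0 by (simp add: G_def)
    have um: "u \<in> borel_measurable lebesgue" and mL: "modular_L f \<Omega> u < \<infinity>"
      and uG: "u \<in> G_plus \<Omega> q c s f" "u \<in> G_minus \<Omega> q c s f"
      using u by (auto simp: De_Giorgi_class_def G_plus_def V_space_def)
    obtain u' where u' [measurable]: "u' \<in> borel_measurable borel" and uu': "AE y in lborel. u y = u' y"
      using completion_ex_borel_measurable_real[OF um] by auto
    \<comment> \<open>A further change on a null set makes nonnegativity hold at every point of the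
      ball.\<close>
    define v where "v y = (if y \<in> ball x0 R then max (u' y) 0 else u' y)" for y
    have vm [measurable]: "v \<in> borel_measurable borel" unfolding v_def by measurable
    have v0: "0 \<le> v y" if "y \<in> ball x0 R" for y using that by (simp add: v_def)
    have "AE y in lborel. y \<in> ball x0 R \<longrightarrow> 0 \<le> u y" using nonneg by (simp add: AE_completion_iff)
    with uu' have uv: "AE y in lborel. u y = v y" by eventually_elim (auto simp: v_def)
    have lower: "lower_class q c s F G v x \<rho>" if "0 < \<rho>" "ball x \<rho> \<subseteq> ball x0 R" for x \<rho>
      unfolding F_def G_def using that sub by (intro G_minus_imp_lower_class[OF uG(2) uv g0 \<Omega>]) auto
    have upper: "upper_class q c s F G v x \<rho>" if "0 < \<rho>" "ball x \<rho> \<subseteq> ball x0 R" for x \<rho>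
      unfolding F_def G_def using that sub by (intro G_plus_imp_upper_class[OF uG(1) uv \<Omega>]) auto
    have fin: "(\<integral>\<^sup>+y\<in>ball x0 R. ennreal (F \<bar>v y\<bar>) \<partial>lborel) < \<infinity>"
    proof -
      have "(\<integral>\<^sup>+y\<in>ball x0 R. ennreal (F \<bar>v y\<bar>) \<partial>lborel) = (\<integral>\<^sup>+y\<in>ball x0 R. ennreal (F \<bar>u y\<bar>) \<partial>lebesgue)"
        by (rule nn_integral_lebesgue_cong_AE[OF uv, symmetric, of "\<lambda>a y. ennreal (F \<bar>a\<bar>) * indicator (ball x0 R) y"])
      also have "\<dots> \<le> modular_L f \<Omega> u"
        unfolding modular_L_def using sub by (intro nn_integral_mono) (auto simp: indicator_def F_def)
      finally show ?thesis using mL by (rule le_less_trans)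
    qed
    define S where "S = ball x0 (R / 2)"
    have S: "S \<in> sets lebesgue" by (simp add: S_def)
    define i where "i = ess_inf_on S u"
    define T where "T = Tail (deriv_Ici f) s (\<lambda>y. max (- u y) 0) x0 R"
    \<comment> \<open>Every positive \<open>L\<close> strictly above the tail is admissible; letting
      \<open>L\<close> decrease to the tail afterwards also covers a vanishing tail.\<close>
    have bound: "ess_sup_on S u \<le> ereal C * (i + ereal L)" "0 \<le> i" if L: "0 < L" "T < ennreal L" for L
    proof -
      have "tail_int s G x0 UNIV (\<lambda>y. max (- v y) 0) \<le> ennreal (R powr (- s) * G (L / R powr s))"
        using O L(2) unfolding F_def G_def T_def by (intro tail_int_le_of_Tail_less[OF _ uv v0 R L(1)]) auto
      from harnack[OF O vm v0 R L(1) lower upper fin this]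
      obtain h where h: "0 \<le> h" "AE y in lborel. y \<in> S \<longrightarrow> h \<le> v y" "AE y in lborel. y \<in> S \<longrightarrow> v y \<le> C * (h + L)"
        unfolding S_def by blast
      have "AE y in lborel. y \<in> S \<longrightarrow> h \<le> u y" using h(2) uv by eventually_elim auto
      then have "AE y in lebesgue. y \<in> S \<longrightarrow> h \<le> u y" by (rule AE_completion)
      then have hi: "ereal h \<le> i" unfolding i_def by (rule ess_inf_on_ge[OF um S])
      then show "0 \<le> i" using h(1) by (metis ereal_less_eq(5) order_trans zero_ereal_def)
      have "AE y in lborel. y \<in> S \<longrightarrow> u y \<le> C * (h + L)" using h(3) uv by eventually_elim auto
      then have "AE y in lebesgue. y \<in> S \<longrightarrow> u y \<le> C * (h + L)" by (rule AE_completion)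
      then have "ess_sup_on S u \<le> ereal (C * (h + L))" by (rule ess_sup_on_le[OF um S])
      also have "\<dots> = ereal C * (ereal h + ereal L)" by simp
      also have "\<dots> \<le> ereal C * (i + ereal L)" using hi C by (intro ereal_mult_left_mono add_right_mono) auto
      finally show "ess_sup_on S u \<le> ereal C * (i + ereal L)" .
    qed
    have "ess_sup_on S u \<le> ereal C * (i + enn2ereal T)"
    proof (cases T)
      case (real t)
      have eq: "enn2ereal T = ereal t" using real by simp
      have i0: "0 \<le> i" using bound(2)[of "t + 1"] real by (simp add: ennreal_less_iff)
      show ?thesis
      proof (cases i)
        case (real j)
        show ?thesis
        proof (rule ereal_le_epsilon2)
          fix e :: real assume e: "0 < e"
          have "ess_sup_on S u \<le> ereal C * (i + ereal (t + e / C))"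
            using C e \<open>T = ennreal t\<close> \<open>0 \<le> t\<close> by (intro bound) (auto simp: ennreal_less_iff add_nonneg_pos)
          also have "\<dots> = ereal C * (i + enn2ereal T) + ereal e"
            unfolding eq real using C by (simp add: distrib_left)
          finally show "ess_sup_on S u \<le> ereal C * (i + enn2ereal T) + ereal e" .
        qed
      qed (use C i0 eq in auto)
    next
      case top
      \<comment> \<open>With an infinite tail the right-hand side is infinite, once
        \<open>i = - \<infinity>\<close> is excluded.\<close>
      have "0 \<le> i" unfolding i_def using nonneg R
        by (intro ess_inf_on_ge[OF um S, of 0, unfolded zero_ereal_def[symmetric]]) (auto simp: S_def elim!: eventually_mono)
      then have "ereal C * (i + enn2ereal T) = \<infinity>" using C top by (cases i) (auto simp: top_ereal_def)
      then show ?thesis by (simp only: ereal_less_eq(1))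
    qed
    then show "ess_sup_on (ball x0 (R / 2)) u
             \<le> ereal C * (ess_inf_on (ball x0 (R / 2)) u
                 + enn2ereal (Tail (deriv_Ici f) s (\<lambda>y. max (- u y) 0) x0 R))"
      by (simp add: S_def i_def T_def)
  qed
qed

end
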